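(* Let $n\geq 1$ and $0\leq r\leq n-1$ be integers, and let $\mu(r)=(n-r,1^{r})$ be the hook partition of $n$ with first row of length $n-r$ and with $r+1$ rows. Then for all partitions $\nu,\lambda\vdash n$, $$g_{\mu(r)\nu\lambda}=\sum_{k=0}^{r}(-1)^{r+k}\sum_{\substack{\gamma\vdash k\\ \rho\vdash n-k}} c^{\nu}_{\rho\gamma}\,c^{\lambda}_{\rho\gamma'},$$ where $\gamma'$ denotes the transpose (conjugate) partition of $\gamma$.
   Context: For partitions $\mu,\nu,\lambda\vdash n$, the Kronecker coefficient is $g_{\mu\nu\lambda}=\frac{1}{n!}\sum_{\sigma\in S_n}\chi_\mu(\sigma)\chi_\nu(\sigma)\chi_\lambda(\sigma)$, where $\chi_\mu$ is the irreducible character of the symmetric group $S_n$ labelled by $\mu$. For $\lambda\vdash n$, $\mu\vdash n-k$, $\nu\vdash k$, the Littlewood-Richardson number is $c^{\lambda}_{\mu\nu}=\langle s_\lambda,s_\mu s_\nu\rangle$, where $s_\lambda$ are Schur functions and $\langle\cdot,\cdot\rangle$ is the standard inner product on symmetric functions, for which Schur functions are orthonormal. The only partition of $0$ is $\emptyset$, and $c^{\lambda}_{\mu\emptyset}=\delta_{\lambda\mu}$. The transpose $\gamma'$ is obtained from $\gamma$ by interchanging rows and columns of its Young diagram, with $\emptyset'=\emptyset$. *)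

theory Defs
  imports
    Complex_Main
    "HOL-Library.FuncSet"
    "HOL-Library.Function_Algebras"
    "HOL-Library.Poly_Mapping"
    "HOL-Combinatorics.Permutations"
begin

section \<open>Partitions and Young diagrams\<close>

definition partitions :: "nat \<Rightarrow> nat list set" where
  "partitions n = {lam. sorted_wrt (\<ge>) lam \<and> (\<forall>p \<in> set lam. 0 < p) \<and> sum_list lam = n}"

text \<open>Rows and columns are numbered from 0; \<open>(i, j)\<close> is the cell in row \<open>i\<close> and column \<open>j\<close>.\<close>

definition diagram :: "nat list \<Rightarrow> (nat \<times> nat) set" where
  "diagram lam = {(i, j). i < length lam \<and> j < lam ! i}"

text \<open>The parts of the transpose are the column lengths; see \<open>diagram_transpose\<close> below.\<close>

definition transpose_part :: "nat list \<Rightarrow> nat list" where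
  "transpose_part lam =
     map (\<lambda>j. card {i. (i, j) \<in> diagram lam}) [0..<(if lam = [] then 0 else hd lam)]"

definition hook :: "nat \<Rightarrow> nat \<Rightarrow> nat list" where
  "hook n r = (n - r) # replicate r 1"

lemma finite_partitions: "finite (partitions n)"
proof (rule finite_subset)
  show "partitions n \<subseteq> {xs. set xs \<subseteq> {..n} \<and> length xs \<le> n}"
  proof
    fix xs assume "xs \<in> partitions n"
    hence pos: "\<forall>p \<in> set xs. 0 < p" and s: "sum_list xs = n"
      by (auto simp: partitions_def)
    have "length xs \<le> sum_list xs" using pos by (induction xs) auto
    moreover have "set xs \<subseteq> {..n}" using s member_le_sum_list by auto
    ultimately show "xs \<in> {xs. set xs \<subseteq> {..n} \<and> length xs \<le> n}" using s by simp
  qed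
qed (rule finite_lists_length_le, simp)

lemma partitions_0: "partitions 0 = {[]}"
proof -
  have "xs = []" if "xs \<in> partitions 0" for xs
    using that by (cases xs) (auto simp: partitions_def)
  thus ?thesis by (auto simp: partitions_def)
qed

lemma hook_in_partitions:
  assumes "1 \<le> n" "r \<le> n - 1"
  shows "hook n r \<in> partitions n"
proof -
  have "sorted_wrt (\<ge>) (replicate r (1::nat))" by (induction r) auto
  thus ?thesis using assms by (auto simp: partitions_def hook_def sum_list_replicate)
qed

lemma finite_diagram: "finite (diagram lam)"
proof -
  have "diagram lam = Sigma {..<length lam} (\<lambda>i. {..<lam ! i})" by (auto simp: diagram_def)
  thus ?thesis by simp
qed

lemma card_diagram: "card (diagram lam) = sum_list lam"
proof -
  have "diagram lam = Sigma {..<length lam} (\<lambda>i. {..<lam ! i})" by (auto simp: diagram_def)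
  thus ?thesis by (simp add: sum_list_sum_nth atLeast0LessThan)
qed

lemma diagram_transpose:
  assumes "lam \<in> partitions n"
  shows "diagram (transpose_part lam) = prod.swap ` diagram lam"
proof -
  have mono: "lam ! i' \<le> lam ! i" if "i \<le> i'" "i' < length lam" for i i'
    using assms that unfolding partitions_def
    by (cases "i = i'") (auto simp: sorted_wrt_iff_nth_less)
  have key: "i < card {i. (i, j) \<in> diagram lam} \<longleftrightarrow> (i, j) \<in> diagram lam" for i j
  proof -
    let ?C = "{i. (i, j) \<in> diagram lam}"
    have fin: "finite ?C" by (rule finite_subset[of _ "{..<length lam}"]) (auto simp: diagram_def)
    have down: "i \<in> ?C" if "i' \<in> ?C" "i \<le> i'" for i i'
      using that mono[of i i'] by (auto simp: diagram_def)
    show ?thesis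
    proof
      assume *: "i < card ?C"
      show "(i, j) \<in> diagram lam"
      proof (rule ccontr)
        assume "(i, j) \<notin> diagram lam"
        hence "?C \<subseteq> {..<i}" using down by (auto simp: not_le[symmetric])
        hence "card ?C \<le> i" using card_mono[of "{..<i}" ?C] by simp
        thus False using * by simp
      qed
    next
      assume "(i, j) \<in> diagram lam"
      hence "{..i} \<subseteq> ?C" using down by auto
      thus "i < card ?C" using card_mono[OF fin, of "{..i}"] by simp
    qed
  qed
  have hd: "j < (if lam = [] then 0 else hd lam)" if "(i, j) \<in> diagram lam" for i j
    using that mono[of 0 i] by (auto simp: diagram_def hd_conv_nth)
  show ?thesis
  proof (intro set_eqI iffI)
    fix c assume c: "c \<in> diagram (transpose_part lam)"
    obtain j i where ji: "c = (j, i)" by (cases c)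
    have "j < length (transpose_part lam)" "i < transpose_part lam ! j"
      using c unfolding ji diagram_def by auto
    hence "(i, j) \<in> diagram lam"
      unfolding key[of i j, symmetric] by (simp add: transpose_part_def)
    thus "c \<in> prod.swap ` diagram lam" using ji by force
  next
    fix c assume "c \<in> prod.swap ` diagram lam"
    then obtain i j where ij: "c = (j, i)" "(i, j) \<in> diagram lam" by force
    have "j < length (transpose_part lam)" "i < transpose_part lam ! j"
      using ij(2) hd[OF ij(2)] key[of i j] by (simp_all add: transpose_part_def)
    thus "c \<in> diagram (transpose_part lam)"
      using ij(1) by (simp add: diagram_def)
  qed
qed


section \<open>Irreducible characters of the symmetric group\<close>

definition cscale :: "complex \<Rightarrow> ('a \<Rightarrow> complex) \<Rightarrow> ('a \<Rightarrow> complex)" where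
  "cscale c v = (\<lambda>x. c * v x)"

global_interpretation cfun: vector_space "cscale :: complex \<Rightarrow> ('a \<Rightarrow> complex) \<Rightarrow> ('a \<Rightarrow> complex)"
  by unfold_locales (auto simp: cscale_def fun_eq_iff algebra_simps)

text \<open>The trace of a linear endomorphism \<open>f\<close> of a finite-dimensional space \<open>V\<close> of functions,
  computed in some basis of \<open>V\<close>.\<close>

definition trace_on :: "('a \<Rightarrow> complex) set \<Rightarrow> (('a \<Rightarrow> complex) \<Rightarrow> ('a \<Rightarrow> complex)) \<Rightarrow> complex" where
  "trace_on V f =
     (let B = (SOME B. cfun.independent B \<and> cfun.span B = V)
      in \<Sum>b\<in>B. cfun.representation B (f b) b)"

text \<open>The symmetric group \<open>S\<^sub>n\<close> consists of the permutations of \<open>{..<n}\<close>.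
  A tableau of shape \<open>lam\<close> has the entries \<open>0, \<dots>, n - 1\<close>, each once.\<close>

definition tableaux :: "nat list \<Rightarrow> (nat \<times> nat \<Rightarrow> nat) set" where
  "tableaux lam = {T. bij_betw T (diagram lam) {..<sum_list lam}}"

text \<open>A tabloid, i.e. a row-equivalence class of tableaux, is encoded as the sequence of the
  sets of entries of its rows.\<close>

definition tabloid :: "nat list \<Rightarrow> (nat \<times> nat \<Rightarrow> nat) \<Rightarrow> (nat \<Rightarrow> nat set)" where
  "tabloid lam T = (\<lambda>i. {T (i, j) |j. (i, j) \<in> diagram lam})"

definition column_stabilizer :: "nat list \<Rightarrow> (nat \<times> nat \<Rightarrow> nat) \<Rightarrow> (nat \<Rightarrow> nat) set" where
  "column_stabilizer lam T =
     {\<pi>. \<pi> permutes {..<sum_list lam} \<and>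
         (\<forall>j. \<pi> ` {T (i, j) |i. (i, j) \<in> diagram lam} = {T (i, j) |i. (i, j) \<in> diagram lam})}"

text \<open>Elements of the permutation module on tabloids are functions from tabloids to \<open>\<complex>\<close>
  (the coefficients). The polytabloid of \<open>T\<close> is the sum of \<open>sign \<pi> \<cdot> {\<pi> T}\<close> over the
  column stabilizer.\<close>

definition polytabloid :: "nat list \<Rightarrow> (nat \<times> nat \<Rightarrow> nat) \<Rightarrow> ((nat \<Rightarrow> nat set) \<Rightarrow> complex)" where
  "polytabloid lam T =
     (\<lambda>t. \<Sum>\<pi>\<in>column_stabilizer lam T. if tabloid lam (\<pi> \<circ> T) = t then of_int (sign \<pi>) else 0)"

definition specht :: "nat list \<Rightarrow> ((nat \<Rightarrow> nat set) \<Rightarrow> complex) set" where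
  "specht lam = cfun.span (polytabloid lam ` tableaux lam)"

text \<open>\<open>\<sigma>\<close> sends the basis vector of a tabloid \<open>t\<close> to the basis vector of \<open>\<sigma> t\<close>; in terms of
  coefficients this is composition with the action of the inverse of \<open>\<sigma>\<close>.\<close>

definition tabloid_action ::
    "(nat \<Rightarrow> nat) \<Rightarrow> ((nat \<Rightarrow> nat set) \<Rightarrow> complex) \<Rightarrow> ((nat \<Rightarrow> nat set) \<Rightarrow> complex)" where
  "tabloid_action \<sigma> v = (\<lambda>t. v (\<lambda>i. inv \<sigma> ` t i))"

text \<open>The irreducible character labelled by \<open>lam\<close> is that of the Specht module; thus \<open>[n]\<close> labels
  the trivial and \<open>[1, \<dots>, 1]\<close> the sign character.\<close>

definition irr_char :: "nat list \<Rightarrow> (nat \<Rightarrow> nat) \<Rightarrow> complex" where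
  "irr_char lam \<sigma> = trace_on (specht lam) (tabloid_action \<sigma>)"

definition kronecker :: "nat \<Rightarrow> nat list \<Rightarrow> nat list \<Rightarrow> nat list \<Rightarrow> complex" where
  "kronecker n \<mu> \<nu> lam =
     1 / fact n *
     (\<Sum>\<sigma> | \<sigma> permutes {..<n}. irr_char \<mu> \<sigma> * irr_char \<nu> \<sigma> * irr_char lam \<sigma>)"


section \<open>Schur functions and Littlewood-Richardson numbers\<close>

text \<open>A formal power series over \<open>\<int>\<close> in the variables \<open>x\<^sub>0, x\<^sub>1, \<dots>\<close> is given by its
  coefficients; a monomial is its finitely supported sequence of exponents.\<close>

type_synonym monomial = "nat \<Rightarrow>\<^sub>0 nat"
type_synonym series = "monomial \<Rightarrow> int"

definition series_mult :: "series \<Rightarrow> series \<Rightarrow> series" where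
  "series_mult f g = (\<lambda>m. \<Sum>(a, b) | a + b = m. f a * g b)"

text \<open>Semistandard tableaux are taken to be \<open>undefined\<close> outside the diagram, so that they can
  be counted.\<close>

definition semistandard :: "nat list \<Rightarrow> (nat \<times> nat \<Rightarrow> nat) set" where
  "semistandard lam =
     {T \<in> extensional (diagram lam).
        (\<forall>i j j'. (i, j) \<in> diagram lam \<longrightarrow> (i, j') \<in> diagram lam \<longrightarrow> j < j' \<longrightarrow> T (i, j) \<le> T (i, j')) \<and>
        (\<forall>i i' j. (i, j) \<in> diagram lam \<longrightarrow> (i', j) \<in> diagram lam \<longrightarrow> i < i' \<longrightarrow> T (i, j) < T (i', j))}"

definition schur :: "nat list \<Rightarrow> series" where
  "schur lam = (\<lambda>m. int (card
     {T \<in> semistandard lam. \<forall>k. card {c \<in> diagram lam. T c = k} = Poly_Mapping.lookup m k}))"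

text \<open>The coordinates of a symmetric function with respect to the basis of Schur functions.\<close>

definition schur_coords :: "series \<Rightarrow> (nat list \<Rightarrow>\<^sub>0 int)" where
  "schur_coords f =
     (THE a. Poly_Mapping.keys a \<subseteq> (\<Union>n. partitions n) \<and>
       f = (\<lambda>m. \<Sum>lam\<in>Poly_Mapping.keys a. Poly_Mapping.lookup a lam * schur lam m))"

text \<open>The bilinear form on symmetric functions for which the Schur functions are orthonormal.\<close>

definition hall_inner :: "series \<Rightarrow> series \<Rightarrow> int" where
  "hall_inner f g =
     (\<Sum>lam\<in>Poly_Mapping.keys (schur_coords f).
        Poly_Mapping.lookup (schur_coords f) lam * Poly_Mapping.lookup (schur_coords g) lam)"

definition lr_coeff :: "nat list \<Rightarrow> nat list \<Rightarrow> nat list \<Rightarrow> int" where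
  "lr_coeff lam \<mu> \<nu> = hall_inner (schur lam) (series_mult (schur \<mu>) (schur \<nu>))"

lemma finite_monomial_splits: "finite {(a, b). a + b = (m :: monomial)}"
proof -
  let ?S = "{a :: monomial. \<forall>k. Poly_Mapping.lookup a k \<le> Poly_Mapping.lookup m k}"
  have "inj_on (\<lambda>a. restrict (Poly_Mapping.lookup a) (Poly_Mapping.keys m)) ?S"
  proof (rule inj_onI)
    fix a b assume ab: "a \<in> ?S" "b \<in> ?S" "restrict (Poly_Mapping.lookup a) (Poly_Mapping.keys m) = restrict (Poly_Mapping.lookup b) (Poly_Mapping.keys m)"
    have "Poly_Mapping.lookup a k = Poly_Mapping.lookup b k" for k
    proof (cases "k \<in> Poly_Mapping.keys m")
      case True
      thus ?thesis using fun_cong[OF ab(3), of k] by simp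
    next
      case False
      hence "Poly_Mapping.lookup m k = 0" by (simp add: in_keys_iff)
      thus ?thesis using ab(1,2) by (metis (mono_tags, lifting) le_zero_eq mem_Collect_eq)
    qed
    thus "a = b" by (intro poly_mapping_eqI)
  qed
  moreover have "(\<lambda>a. restrict (Poly_Mapping.lookup a) (Poly_Mapping.keys m)) ` ?S \<subseteq> (\<Pi>\<^sub>E k\<in>Poly_Mapping.keys m. {..Poly_Mapping.lookup m k})"
    by auto
  moreover have "finite (\<Pi>\<^sub>E k\<in>Poly_Mapping.keys m. {..Poly_Mapping.lookup m k})" by (intro finite_PiE) auto
  ultimately have fin: "finite ?S" by (meson finite_imageD finite_subset)
  have "{(a, b). a + b = m} \<subseteq> ?S \<times> ?S" by (auto simp: lookup_add)
  thus ?thesis using fin by (meson finite_SigmaI finite_subset)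
qed

lemma finite_semistandard_content:
  "finite {T \<in> semistandard lam. \<forall>k. card {c \<in> diagram lam. T c = k} = Poly_Mapping.lookup m k}"
proof (rule finite_subset)
  show "{T \<in> semistandard lam. \<forall>k. card {c \<in> diagram lam. T c = k} = Poly_Mapping.lookup m k}
          \<subseteq> (\<Pi>\<^sub>E c\<in>diagram lam. Poly_Mapping.keys m)"
  proof
    fix T assume "T \<in> {T \<in> semistandard lam. \<forall>k. card {c \<in> diagram lam. T c = k} = Poly_Mapping.lookup m k}"
    hence T: "T \<in> semistandard lam" "\<forall>k. card {c \<in> diagram lam. T c = k} = Poly_Mapping.lookup m k"
      by auto
    have "T c \<in> Poly_Mapping.keys m" if "c \<in> diagram lam" for c
    proof -
      have "finite {c' \<in> diagram lam. T c' = T c}" using finite_diagram by simp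
      moreover have "c \<in> {c' \<in> diagram lam. T c' = T c}" using that by simp
      ultimately have "card {c' \<in> diagram lam. T c' = T c} \<noteq> 0" by (metis card_0_eq empty_iff)
      thus ?thesis using T(2) by (simp add: in_keys_iff)
    qed
    moreover have "T \<in> extensional (diagram lam)" using T(1) by (simp add: semistandard_def)
    ultimately show "T \<in> (\<Pi>\<^sub>E c\<in>diagram lam. Poly_Mapping.keys m)" by (auto simp: PiE_def)
  qed
qed (intro finite_PiE finite_diagram finite_keys)

end

theory Submission
  imports Defs "HOL-Library.Multiset"
begin

text \<open>
  The idea is to express everything through the group algebra of the symmetric group.
  If \<open>V\<close> has a projection \<open>F\<close>, the trace on \<open>V\<close> is a sum of matrix entries of \<open>F\<close>; for a Specht
  module the Young symmetrizer \<open>e = kap * rho\<close> with \<open>e * e = h e\<close> provides such a projection, so that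
  \<open>\<chi>(s) = (1/h) \<Sum>\<^sub>g e(g\<^sup>-\<^sup>1 s g)\<close>. Orthonormality, and \<open>\<chi>\<^sub>\<gamma>\<^sub>' = sgn \<chi>\<^sub>\<gamma>\<close>, follow from this formula by
  computing with \<open>e\<close>, without Schur's lemma or Maschke's theorem.

  The multiplicity of \<open>\<chi>\<^sub>\<lambda>\<close> in the permutation module on words of content \<open>a\<close> is the rank of \<open>e/h\<close>
  there, which is at least the Kostka number because the images of semistandard tableaux are
  triangular for the dominance order. The Cauchy identity for Kostka numbers and Bessel's inequality
  turn this bound into an equality (Young's rule), and Young's rule for the regular representation
  yields completeness of the characters. Hence \<open>c\<^sup>\<nu>\<^sub>\<rho>\<^sub>\<gamma>\<close> is the multiplicity of \<open>\<chi>\<^sub>\<rho> \<times> \<chi>\<^sub>\<gamma>\<close> in the restriction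
  of \<open>\<chi>\<^sub>\<nu>\<close> to \<open>S\<^sub>n\<^sub>-\<^sub>k \<times> S\<^sub>k\<close>, and by Parseval the inner double sum of the theorem is the pairing of
  \<open>\<chi>\<^sub>\<nu> \<chi>\<^sub>\<lambda>\<close> with the character induced from \<open>1 \<times> sgn\<close>. By Pieri that character is
  \<open>\<chi>\<^sub>\<mu>\<^sub>(\<^sub>k\<^sub>) + \<chi>\<^sub>\<mu>\<^sub>(\<^sub>k\<^sub>-\<^sub>1\<^sub>)\<close>, so the alternating sum telescopes to \<open>\<chi>\<^sub>\<mu>\<^sub>(\<^sub>r\<^sub>)\<close>.
\<close>

section \<open>Kostka numbers and the Cauchy identity\<close>

text \<open>The two sides of the theorem have unrelated definitions: traces in arbitrarily chosen
  bases of Specht modules, and coordinates of power series in the Schur basis. The bridge is a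
  number with a meaning on both sides: the count of semistandard tableaux of given shape and content
  is a coefficient of a Schur function, and also the multiplicity of a character in a module of
  words. Cutting words of length N + k into two pieces then corresponds to multiplying series. The
  obstacle is the upper bound for this multiplicity: whether the images of the semistandard tableaux
  span cannot be read off shape by shape. It is obtained for all shapes at once, from the sum of the
  squares of the multiplicities, which counts orbits on pairs of words. Coefficients are real
  because sums of squares must be positive, both for the symmetrizers and for this comparison;
  integrality of the Littlewood-Richardson numbers is recovered from triangularity. Shapes are
  functions rather than lists, so that interlacing inequalities need no case distinction on
  lengths.\<close>

definition par :: "nat \<Rightarrow> (nat \<Rightarrow> nat) set" where
  "par n = {p. antimono p \<and> (\<forall>i\<ge>n. p i = 0) \<and> sum p {..<n} = n}"

text \<open>Interlacing of the rows, which says that the skew shape \<open>p\<close> /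
  \<open>q\<close> is a horizontal strip: it has at most one cell in each column.\<close>

definition hstrip :: "(nat \<Rightarrow> nat) \<Rightarrow> (nat \<Rightarrow> nat) \<Rightarrow> bool" where
  "hstrip p q \<longleftrightarrow> (\<forall>i. q i \<le> p i \<and> p (Suc i) \<le> q i)"

lemma sum_extend_zero:
  fixes p :: "nat \<Rightarrow> nat"
  assumes "\<forall>i\<ge>n. p i = 0" "n \<le> N"
  shows "sum p {..<N} = sum p {..<n}"
  using assms by (intro sum.mono_neutral_right) auto

text \<open>A nonzero part at an index i \<ge> n would make all parts up to i nonzero and the sum
  larger than n. Hence shapes of different sizes can be summed over one common range.\<close>

lemma par_iff:
  assumes "n \<le> N"
  shows "p \<in> par n \<longleftrightarrow> antimono p \<and> (\<forall>i\<ge>N. p i = 0) \<and> sum p {..<N} = n"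
proof
  assume "p \<in> par n"
  thus "antimono p \<and> (\<forall>i\<ge>N. p i = 0) \<and> sum p {..<N} = n"
    using assms sum_extend_zero[of n p N] by (auto simp: par_def)
next
  assume r: "antimono p \<and> (\<forall>i\<ge>N. p i = 0) \<and> sum p {..<N} = n"
  have z: "p i = 0" if "i \<ge> n" for i
  proof (rule ccontr)
    assume "p i \<noteq> 0"
    hence "i < N" using r by (meson leI)
    have "1 \<le> p j" if "j \<le> i" for j
      using r \<open>p i \<noteq> 0\<close> antimonoD[of p j i] that by (simp add: Suc_leI)
    hence "sum (\<lambda>_. 1) {..i} \<le> sum p {..i}" by (intro sum_mono) auto
    also have "\<dots> \<le> sum p {..<N}" using \<open>i < N\<close> by (intro sum_mono2) auto
    finally show False using r that by simp
  qed
  thus "p \<in> par n" using r sum_extend_zero[of n p N] assms by (auto simp: par_def)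
qed

lemma par_antimono: "p \<in> par n \<Longrightarrow> i \<le> j \<Longrightarrow> p j \<le> p i"
  by (auto simp: par_def antimono_def)

lemma par_zero: "p \<in> par n \<Longrightarrow> n \<le> i \<Longrightarrow> p i = 0"
  by (auto simp: par_def)

lemma par_sum: "p \<in> par n \<Longrightarrow> n \<le> N \<Longrightarrow> sum p {..<N} = n"
  by (simp add: par_iff)

lemma par_le: "p \<in> par n \<Longrightarrow> p i \<le> n"
  using member_le_sum[of i "{..<n}" p] by (cases "i < n") (auto simp: par_def)

lemma finite_par [simp]: "finite (par n)"
proof (rule finite_subset)
  show "par n \<subseteq> {p. \<forall>x. (x \<in> {..<n} \<longrightarrow> p x \<in> {..n}) \<and> (x \<notin> {..<n} \<longrightarrow> p x = 0)}"
    using par_le by (auto simp: par_zero)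
qed (rule finite_set_of_finite_funs, auto)

lemma par_0: "par 0 = {\<lambda>_. 0}"
  by (auto simp: par_def antimono_def)

lemma hstrip_size:
  assumes "hstrip p q" "p \<in> par m" "q \<in> par n"
  shows "n \<le> m"
proof -
  have "n = sum q {..<m+n}" "m = sum p {..<m+n}" using assms by (simp_all add: par_sum)
  moreover have "sum q {..<m+n} \<le> sum p {..<m+n}"
    using assms by (intro sum_mono) (auto simp: hstrip_def)
  ultimately show ?thesis by simp
qed

lemma hstrip_same_size:
  assumes "hstrip p q" "p \<in> par n" "q \<in> par n"
  shows "q = p"
proof
  fix i
  have "sum p {..<n} = sum q {..<n}" using assms by (simp add: par_def)
  hence "q i = p i" if "i < n"
    using assms that by (auto simp: hstrip_def intro: sum_mono_inv[symmetric, of q "{..<n}" p, THEN sym])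
  thus "q i = p i" using assms by (cases "i < n") (auto simp: par_zero)
qed

text \<open>The entries of a tableau are taken below \<open>L\<close>, and its largest ones are stripped off first. The
  value is meaningful only for \<open>p \<in> par (size a)\<close>.\<close>

fun kostka :: "(nat \<Rightarrow> nat) \<Rightarrow> nat multiset \<Rightarrow> nat \<Rightarrow> nat" where
  "kostka p a 0 = (if p = (\<lambda>_. 0) \<and> a = {#} then 1 else 0)"
| "kostka p a (Suc L) =
     (\<Sum>q | q \<in> par (size (filter_mset (\<lambda>x. x \<noteq> L) a)) \<and> hstrip p q. kostka q (filter_mset (\<lambda>x. x \<noteq> L) a) L)"

text \<open>The inequalities for row \<open>l + 1\<close> of a common upper neighbour and for row \<open>l\<close> of a common
  lower neighbour of \<open>\<mu>\<close> and \<open>\<rho>\<close> describe the same interval; reflecting it gives the bijection.\<close>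

lemma reflect_sum:
  fixes \<mu> \<rho> lam \<tau> :: "nat \<Rightarrow> nat"
  assumes "\<And>l. lam (Suc l) + \<tau> l = min (\<mu> l) (\<rho> l) + max (\<mu> (Suc l)) (\<rho> (Suc l))"
    and "\<mu> \<in> par m" "\<rho> \<in> par s" and B: "m + s \<le> B"
  shows "sum lam {..<Suc B} + sum \<tau> {..<B} + max (\<mu> 0) (\<rho> 0) = lam 0 + m + s"
proof -
  have mm: "sum \<mu> {..<B} = m" "sum \<rho> {..<B} = s" using assms by (simp_all add: par_sum)
  have "(\<Sum>l<B. lam (Suc l)) + sum \<tau> {..<B} = (\<Sum>l<B. min (\<mu> l) (\<rho> l)) + (\<Sum>l<B. max (\<mu> (Suc l)) (\<rho> (Suc l)))"
    unfolding sum.distrib[symmetric] using assms(1) by (intro sum.cong) auto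
  moreover have "max (\<mu> 0) (\<rho> 0) + (\<Sum>l<B. max (\<mu> (Suc l)) (\<rho> (Suc l))) = (\<Sum>l<Suc B. max (\<mu> l) (\<rho> l))"
    by (simp only: sum.lessThan_Suc_shift)
  moreover have "(\<Sum>l<Suc B. max (\<mu> l) (\<rho> l)) = (\<Sum>l<B. max (\<mu> l) (\<rho> l))"
    using assms par_zero[of \<mu> m B] par_zero[of \<rho> s B] by simp
  moreover have "(\<Sum>l<B. max (\<mu> l) (\<rho> l)) + (\<Sum>l<B. min (\<mu> l) (\<rho> l)) = m + s"
    unfolding sum.distrib[symmetric] mm[symmetric] by (intro sum.cong) auto
  moreover have "sum lam {..<Suc B} = lam 0 + (\<Sum>l<B. lam (Suc l))"
    by (simp only: sum.lessThan_Suc_shift)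
  ultimately show ?thesis by linarith
qed

text \<open>The local rule of the Robinson-Schensted-Knuth correspondence. Rows 1, 2, ... of a
  common upper neighbour are reflected into rows 0, 1, ... of a common lower neighbour. Row 0 of the
  upper one is bounded only from below and absorbs the difference of the sizes; therefore all t with
  m + s \<le> t + N occur.\<close>

lemma card_common_strips:
  assumes \<mu>: "\<mu> \<in> par m" and \<rho>: "\<rho> \<in> par s"
  shows "card {lam \<in> par N. hstrip lam \<mu> \<and> hstrip lam \<rho>} =
         (\<Sum>t | t \<le> m \<and> m + s \<le> t + N. card {\<tau> \<in> par t. hstrip \<mu> \<tau> \<and> hstrip \<rho> \<tau>})"
proof -
  let ?U = "{lam \<in> par N. hstrip lam \<mu> \<and> hstrip lam \<rho>}"
  let ?T = "{t. t \<le> m \<and> m + s \<le> t + N}"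
  let ?D = "\<lambda>t. {\<tau> \<in> par t. hstrip \<mu> \<tau> \<and> hstrip \<rho> \<tau>}"
  let ?f = "\<lambda>lam l. min (\<mu> l) (\<rho> l) + max (\<mu> (Suc l)) (\<rho> (Suc l)) - lam (Suc l)"
  define B where "B = m + s + N"
  have z: "\<mu> i = 0" "\<rho> i = 0" if "i \<ge> B" for i
    using that \<mu> \<rho> par_zero[of \<mu> m i] par_zero[of \<rho> s i] by (auto simp: B_def)
  have anti: "\<mu> (Suc l) \<le> \<mu> l" "\<rho> (Suc l) \<le> \<rho> l" for l
    using \<mu> \<rho> by (auto intro: par_antimono)
  have rel: "lam (Suc l) + ?f lam l = min (\<mu> l) (\<rho> l) + max (\<mu> (Suc l)) (\<rho> (Suc l))" if "lam \<in> ?U" for lam l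
    using that by (auto simp: hstrip_def intro!: le_add_diff_inverse trans_le_add1)
  have sz: "sum lam {..<Suc B} = N" if "lam \<in> par N" for lam
    using that by (simp add: par_sum B_def del: sum.lessThan_Suc)
  have fD: "?f lam \<in> \<Union> (?D ` ?T)" if lam: "lam \<in> ?U" for lam
  proof -
    have b: "max (\<mu> (Suc l)) (\<rho> (Suc l)) \<le> ?f lam l" "?f lam l \<le> min (\<mu> l) (\<rho> l)" for l
    proof -
      have "lam (Suc l) \<le> min (\<mu> l) (\<rho> l)" "max (\<mu> (Suc l)) (\<rho> (Suc l)) \<le> lam (Suc l)"
        using lam by (auto simp: hstrip_def)
      thus "max (\<mu> (Suc l)) (\<rho> (Suc l)) \<le> ?f lam l" "?f lam l \<le> min (\<mu> l) (\<rho> l)" by linarith+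
    qed
    have h: "hstrip \<mu> (?f lam)" "hstrip \<rho> (?f lam)"
      unfolding hstrip_def using b by (meson max.bounded_iff min.bounded_iff)+
    have am: "antimono (?f lam)"
      unfolding decseq_Suc_iff using b by (meson max.bounded_iff min.bounded_iff order_trans)
    define t where "t = sum (?f lam) {..<B}"
    have zz: "\<forall>i\<ge>B. ?f lam i = 0" using z by simp
    have tm: "t \<le> m"
    proof -
      have "t \<le> sum \<mu> {..<B}" unfolding t_def using b by (intro sum_mono) auto
      thus ?thesis using \<mu> by (simp add: par_sum B_def)
    qed
    have "?f lam \<in> par t"
      using par_iff[of t B "?f lam"] am zz tm t_def by (simp add: B_def)
    moreover have "m + s \<le> t + N"
    proof -
      have "N + t + max (\<mu> 0) (\<rho> 0) = lam 0 + m + s"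
        using reflect_sum[of lam "?f lam" \<mu> \<rho> m s B] rel[OF lam] \<mu> \<rho> sz[of lam] lam t_def
        by (simp add: B_def del: sum.lessThan_Suc)
      moreover have "max (\<mu> 0) (\<rho> 0) \<le> lam 0" using lam by (auto simp: hstrip_def)
      ultimately show ?thesis by linarith
    qed
    ultimately show ?thesis using h tm by blast
  qed
  have inj: "inj_on ?f ?U"
  proof (rule inj_onI)
    fix x y assume xy: "x \<in> ?U" "y \<in> ?U" "?f x = ?f y"
    have S: "x (Suc l) = y (Suc l)" for l
      using rel[OF xy(1), of l] rel[OF xy(2), of l] fun_cong[OF xy(3), of l] by linarith
    have "sum x {..<Suc B} = sum y {..<Suc B}" using xy sz by simp
    hence "x 0 = y 0" using S by (simp only: sum.lessThan_Suc_shift)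
    thus "x = y" using S by (metis ext not0_implies_Suc)
  qed
  have surj: "\<exists>lam\<in>?U. ?f lam = \<tau>" if "t \<in> ?T" "\<tau> \<in> ?D t" for t \<tau>
  proof -
    have b: "max (\<mu> (Suc l)) (\<rho> (Suc l)) \<le> \<tau> l" "\<tau> l \<le> min (\<mu> l) (\<rho> l)" for l
      using that by (auto simp: hstrip_def)
    \<comment> \<open>Row 0 is the only freedom that the reflection leaves; its excess over the
      maximum is forced by the prescribed size \<open>N\<close>.\<close>
    define lam where "lam = (\<lambda>l. case l of 0 \<Rightarrow> max (\<mu> 0) (\<rho> 0) + (t + N - m - s)
                         | Suc l \<Rightarrow> min (\<mu> l) (\<rho> l) + max (\<mu> (Suc l)) (\<rho> (Suc l)) - \<tau> l)"
    have r: "lam (Suc l) + \<tau> l = min (\<mu> l) (\<rho> l) + max (\<mu> (Suc l)) (\<rho> (Suc l))" for l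
    proof -
      have "\<tau> l \<le> min (\<mu> l) (\<rho> l)" using b by blast
      hence "\<tau> l \<le> min (\<mu> l) (\<rho> l) + max (\<mu> (Suc l)) (\<rho> (Suc l))" by (rule trans_le_add1)
      thus ?thesis unfolding lam_def by (simp only: nat.case le_add_diff_inverse2)
    qed
    have up: "max (\<mu> l) (\<rho> l) \<le> lam l" for l
    proof (cases l)
      case 0 thus ?thesis by (simp add: lam_def)
    next
      case (Suc i)
      have "max (\<mu> (Suc i)) (\<rho> (Suc i)) \<le> lam (Suc i)" using r[of i] b[of i] by linarith
      thus ?thesis using Suc by simp
    qed
    have up2: "lam (Suc l) \<le> min (\<mu> l) (\<rho> l)" for l
      using r[of l] b[of l] by linarith
    have h: "hstrip lam \<mu>" "hstrip lam \<rho>"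
      unfolding hstrip_def using up up2 by (meson max.bounded_iff min.bounded_iff)+
    have am: "antimono lam"
      unfolding decseq_Suc_iff using up up2 by (meson max.bounded_iff min.bounded_iff order_trans)
    have "sum lam {..<Suc B} + t + max (\<mu> 0) (\<rho> 0) = lam 0 + m + s"
      using reflect_sum[OF r \<mu> \<rho>, of B] par_sum[of \<tau> t B] that by (simp add: B_def)
    hence "sum lam {..<Suc B} = N" using that by (simp add: lam_def del: sum.lessThan_Suc)
    moreover have "lam i = 0" if "i \<ge> Suc B" for i
      using that up2[of "i-1"] z[of "i-1"] by (cases i) auto
    ultimately have "lam \<in> par N" using am par_iff[of N "Suc B" lam] by (auto simp: B_def)
    moreover have "?f lam = \<tau>" using r by (intro ext) (metis diff_add_inverse)
    ultimately show ?thesis using h by blast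
  qed
  have "?f ` ?U = \<Union> (?D ` ?T)"
  proof
    show "?f ` ?U \<subseteq> \<Union> (?D ` ?T)" using fD by blast
    show "\<Union> (?D ` ?T) \<subseteq> ?f ` ?U"
    proof
      fix \<tau> assume "\<tau> \<in> \<Union> (?D ` ?T)"
      then obtain t where "t \<in> ?T" "\<tau> \<in> ?D t" by blast
      from surj[OF this] show "\<tau> \<in> ?f ` ?U" by blast
    qed
  qed
  hence "card ?U = card (\<Union> (?D ` ?T))" using card_image[OF inj] by simp
  also have "\<dots> = (\<Sum>t\<in>?T. card (?D t))"
  proof (rule card_UN_disjoint)
    show "\<forall>i\<in>?T. \<forall>j\<in>?T. i \<noteq> j \<longrightarrow> ?D i \<inter> ?D j = {}"
    proof (intro ballI impI)
      fix i j :: nat assume "i \<noteq> j"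
      have "i = j" if "p \<in> par i" "p \<in> par j" for p
        using par_sum[OF that(1), of "i+j"] par_sum[OF that(2), of "i+j"] by simp
      thus "?D i \<inter> ?D j = {}" using \<open>i \<noteq> j\<close> by blast
    qed
  qed auto
  finally show ?thesis .
qed

section \<open>Contents as multisets and the removal of a letter\<close>

lemma filter_ne_Suc_subset:
  "set_mset a \<subseteq> {..<Suc L} \<Longrightarrow> set_mset (filter_mset (\<lambda>x. x \<noteq> L) a) \<subseteq> {..<L}"
  by auto

lemma mset_split_letter: "filter_mset (\<lambda>x. x \<noteq> L) a + replicate_mset (count a L) L = a"
  by (rule multiset_eqI) simp

lemma size_split_letter: "size (filter_mset (\<lambda>x. x \<noteq> L) a) + count a L = size a"
  by (metis mset_split_letter size_replicate_mset size_union)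

lemma finite_submultisets [simp]: "finite {k. k \<subseteq># a \<and> P k}"
proof (rule finite_subset)
  show "{k. k \<subseteq># a \<and> P k} \<subseteq> mset ` {xs. set xs \<subseteq> set_mset a \<and> length xs \<le> size a}"
  proof
    fix k assume k: "k \<in> {k. k \<subseteq># a \<and> P k}"
    obtain xs where xs: "mset xs = k" using ex_mset by blast
    have "set xs \<subseteq> set_mset a" using k xs by (auto dest: mset_subset_eqD)
    moreover have "length xs \<le> size a" using k xs size_mset_mono[of k a] by auto
    ultimately show "k \<in> mset ` {xs. set xs \<subseteq> set_mset a \<and> length xs \<le> size a}" using xs by auto
  qed
qed (simp add: finite_lists_length_le)

text \<open>In terms of symmetric functions, the adjoint of multiplication by h_i sends h_a to the
  sum of h_(a - k) over the submultisets k of size i. The strip removed by the letter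
  \<open>L\<close> is exchanged with the strip \<open>lam\<close> / \<open>\<mu>\<close> by
  \<open>card_common_strips\<close>, after which the induction hypothesis applies to the smaller
  alphabet.\<close>

lemma kostka_add_strip:
  assumes "set_mset a \<subseteq> {..<L}" "\<mu> \<in> par m" "size a = m + i"
  shows "(\<Sum>lam | lam \<in> par (m + i) \<and> hstrip lam \<mu>. kostka lam a L) =
         (\<Sum>k | k \<subseteq># a \<and> size k = i. kostka \<mu> (a - k) L)"
  using assms
proof (induction L arbitrary: a \<mu> m i)
  case 0
  hence a: "a = {#}" "m = 0" "i = 0" by auto
  moreover have "\<mu> = (\<lambda>_. 0)" using 0 a by (simp add: par_0)
  moreover have "{lam \<in> par 0. hstrip lam (\<lambda>_. 0)} = {\<lambda>_. 0}" by (auto simp: par_0 hstrip_def)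
  moreover have "{k. k \<subseteq># {#} \<and> size k = 0} = {{#} :: nat multiset}" by auto
  ultimately show ?case by simp
next
  case (Suc L)
  define a' where "a' = filter_mset (\<lambda>x. x \<noteq> L) a"
  define j where "j = count a L"
  define s where "s = size a'"
  have a: "a = a' + replicate_mset j L" by (simp add: a'_def j_def mset_split_letter)
  have a'L: "set_mset a' \<subseteq> {..<L}" using Suc.prems(1) unfolding a'_def by (rule filter_ne_Suc_subset)
  have sj: "s + j = m + i" using Suc.prems(3) by (simp add: a s_def)
  let ?A = "{lam. lam \<in> par (m + i) \<and> hstrip lam \<mu>}"
  let ?T = "{t. t \<le> m \<and> m \<le> t + j}"
  have "(\<Sum>lam\<in>?A. kostka lam a (Suc L)) =
        (\<Sum>lam\<in>?A. \<Sum>\<rho> | \<rho> \<in> par s \<and> hstrip lam \<rho>. kostka \<rho> a' L)"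
    by (simp add: a'_def s_def)
  also have "\<dots> = (\<Sum>\<rho>\<in>par s. \<Sum>lam | lam \<in> ?A \<and> hstrip lam \<rho>. kostka \<rho> a' L)"
    using sum.swap_restrict[of ?A "par s" "\<lambda>lam \<rho>. kostka \<rho> a' L" "\<lambda>lam \<rho>. hstrip lam \<rho>"] by simp
  also have "\<dots> = (\<Sum>\<rho>\<in>par s. card {lam \<in> par (m+i). hstrip lam \<mu> \<and> hstrip lam \<rho>} * kostka \<rho> a' L)"
    by (intro sum.cong) (auto simp: conj_assoc)
  also have "\<dots> = (\<Sum>\<rho>\<in>par s. (\<Sum>t\<in>?T. card {\<tau> \<in> par t. hstrip \<mu> \<tau> \<and> hstrip \<rho> \<tau>}) * kostka \<rho> a' L)"
  proof (intro sum.cong refl)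
    fix \<rho> assume r: "\<rho> \<in> par s"
    have "{t. t \<le> m \<and> m + s \<le> t + (m + i)} = ?T" using sj by auto
    thus "card {lam \<in> par (m+i). hstrip lam \<mu> \<and> hstrip lam \<rho>} * kostka \<rho> a' L =
        (\<Sum>t\<in>?T. card {\<tau> \<in> par t. hstrip \<mu> \<tau> \<and> hstrip \<rho> \<tau>}) * kostka \<rho> a' L"
      using card_common_strips[OF Suc.prems(2) r, of "m+i"] by simp
  qed
  also have "\<dots> = (\<Sum>\<rho>\<in>par s. \<Sum>t\<in>?T. \<Sum>\<tau> | \<tau> \<in> {\<tau> \<in> par t. hstrip \<mu> \<tau>} \<and> hstrip \<rho> \<tau>. kostka \<rho> a' L)"
    by (intro sum.cong refl) (simp add: sum_distrib_right conj_assoc)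
  also have "\<dots> = (\<Sum>t\<in>?T. \<Sum>\<rho>\<in>par s. \<Sum>\<tau> | \<tau> \<in> {\<tau> \<in> par t. hstrip \<mu> \<tau>} \<and> hstrip \<rho> \<tau>. kostka \<rho> a' L)"
    by (rule sum.swap)
  also have "\<dots> = (\<Sum>t\<in>?T. \<Sum>\<tau>\<in>{\<tau> \<in> par t. hstrip \<mu> \<tau>}. \<Sum>\<rho> | \<rho> \<in> par s \<and> hstrip \<rho> \<tau>. kostka \<rho> a' L)"
    by (intro sum.cong refl sum.swap_restrict) auto
  also have "\<dots> = (\<Sum>t\<in>?T. \<Sum>\<tau>\<in>{\<tau> \<in> par t. hstrip \<mu> \<tau>}. \<Sum>k | k \<subseteq># a' \<and> size k + t = s. kostka \<tau> (a' - k) L)"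
  proof (intro sum.cong refl)
    fix t \<tau> assume t: "t \<in> ?T" "\<tau> \<in> {\<tau> \<in> par t. hstrip \<mu> \<tau>}"
    show "(\<Sum>\<rho> | \<rho> \<in> par s \<and> hstrip \<rho> \<tau>. kostka \<rho> a' L) = (\<Sum>k | k \<subseteq># a' \<and> size k + t = s. kostka \<tau> (a' - k) L)"
    proof (cases "t \<le> s")
      case True
      have "{k. k \<subseteq># a' \<and> size k + t = s} = {k. k \<subseteq># a' \<and> size k = s - t}" using True by auto
      thus ?thesis using Suc.IH[of a' \<tau> t "s - t"] a'L t True by (simp add: s_def)
    next
      case False
      hence e: "{\<rho>. \<rho> \<in> par s \<and> hstrip \<rho> \<tau>} = {}" using t hstrip_size by blast
      have e': "{k. k \<subseteq># a' \<and> size k + t = s} = {}" using False by auto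
      show ?thesis unfolding e e' by simp
    qed
  qed
  also have "\<dots> = (\<Sum>t\<in>?T. \<Sum>k | k \<subseteq># a' \<and> size k + t = s. \<Sum>\<tau>\<in>{\<tau> \<in> par t. hstrip \<mu> \<tau>}. kostka \<tau> (a' - k) L)"
    by (intro sum.cong refl sum.swap)
  also have "\<dots> = (\<Sum>(t,k)\<in>(SIGMA t:?T. {k. k \<subseteq># a' \<and> size k + t = s}).
                    \<Sum>\<tau>\<in>{\<tau> \<in> par t. hstrip \<mu> \<tau>}. kostka \<tau> (a' - k) L)"
    by (subst sum.Sigma) auto
  also have "\<dots> = (\<Sum>k | k \<subseteq># a \<and> size k = i. kostka \<mu> (a - k) (Suc L))"
  \<comment> \<open>Of the \<open>j\<close> letters \<open>L\<close>, the m - t that fill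
    \<open>\<mu>\<close> / \<open>\<tau>\<close> stay in the content; the other t + j - m are
    removed together with \<open>k\<close>.\<close>
  proof (rule sum.reindex_bij_witness[of _ "\<lambda>k. (s - size (filter_mset (\<lambda>x. x \<noteq> L) k), filter_mset (\<lambda>x. x \<noteq> L) k)"
          "\<lambda>(t, k). k + replicate_mset (t + j - m) L"], goal_cases)
    case (1 tk)
    obtain t k where tk: "tk = (t, k)" by (cases tk)
    have "L \<notin># k" using 1 tk a'L by (auto dest: mset_subset_eqD)
    hence "filter_mset (\<lambda>x. x \<noteq> L) (k + replicate_mset (t + j - m) L) = k"
      by (intro multiset_eqI) (auto simp: not_in_iff)
    thus ?case using 1 tk by auto
  next
    case (2 tk)
    obtain t k where tk: "tk = (t, k)" by (cases tk)
    have "k + replicate_mset (t + j - m) L \<subseteq># a" unfolding a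
      using 2 tk by (intro subset_mset.add_mono) (auto simp: subseteq_mset_def)
    moreover have "size k + (t + j - m) = i" using 2 tk sj by auto
    ultimately show ?case using tk by auto
  next
    case (3 k)
    have c: "count k L \<le> j" using 3 by (simp add: j_def mset_subset_eq_count)
    have "filter_mset (\<lambda>x. x \<noteq> L) k \<subseteq># a'" using 3 by (simp add: a'_def multiset_filter_mono)
    hence "size (filter_mset (\<lambda>x. x \<noteq> L) k) \<le> s" unfolding s_def by (rule size_mset_mono)
    hence "s - size (filter_mset (\<lambda>x. x \<noteq> L) k) + j - m = count k L"
      using size_split_letter[of L k] 3 sj c by auto
    thus ?case by (simp add: mset_split_letter)
  next
    case (4 k)
    have c: "count k L \<le> j" using 4 by (simp add: j_def mset_subset_eq_count)
    have k': "filter_mset (\<lambda>x. x \<noteq> L) k \<subseteq># a'" using 4 by (simp add: a'_def multiset_filter_mono)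
    hence "size (filter_mset (\<lambda>x. x \<noteq> L) k) \<le> s" unfolding s_def by (rule size_mset_mono)
    thus ?case using k' size_split_letter[of L k] 4 sj c by auto
  next
    case (5 tk)
    obtain t k where tk: "tk = (t, k)" by (cases tk)
    have k: "k \<subseteq># a'" "size k + t = s" using 5 tk by auto
    have "L \<notin># k" using k a'L by (auto dest: mset_subset_eqD)
    hence f: "filter_mset (\<lambda>x. x \<noteq> L) (a - (k + replicate_mset (t + j - m) L)) = a' - k"
      by (intro multiset_eqI) (auto simp: a'_def not_in_iff)
    moreover have "size (a' - k) = t" using k by (simp add: size_Diff_submset s_def)
    ultimately show ?case using tk by simp
  qed
  finally show ?case .
qed

text \<open>A multiset of pairs is a matrix of natural numbers with margins \<open>a\<close> and
  \<open>b\<close>. The column of \<open>m\<close> is split off and recorded as the multiset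
  \<open>k\<close>.\<close>

lemma matrices_remove_letter:
  fixes a b :: "nat multiset"
  shows "card {A. image_mset fst A = a \<and> image_mset snd A = b} =
    (\<Sum>k | k \<subseteq># a \<and> size k = count b m.
       card {A. image_mset fst A = a - k \<and> image_mset snd A = filter_mset (\<lambda>x. x \<noteq> m) b})"
proof -
  let ?M = "\<lambda>a b. {A :: (nat \<times> nat) multiset. image_mset fst A = a \<and> image_mset snd A = b}"
  let ?K = "{k. k \<subseteq># a \<and> size k = count b m}"
  let ?b = "filter_mset (\<lambda>x. x \<noteq> m) b"
  have fin: "finite (?M x y)" for x y
  proof (rule finite_subset)
    show "?M x y \<subseteq> mset ` {xs. set xs \<subseteq> set_mset x \<times> set_mset y \<and> length xs \<le> size x}"
    proof
      fix A assume A: "A \<in> ?M x y"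
      obtain xs where xs: "mset xs = A" using ex_mset by blast
      have "length xs = size x" using A xs by (metis (mono_tags, lifting) mem_Collect_eq size_image_mset size_mset)
      moreover have "set xs \<subseteq> set_mset x \<times> set_mset y"
      proof
        fix z assume "z \<in> set xs"
        hence "z \<in># A" using xs by auto
        hence "fst z \<in># image_mset fst A" "snd z \<in># image_mset snd A" by auto
        thus "z \<in> set_mset x \<times> set_mset y" using A by (simp add: mem_Times_iff del: set_image_mset)
      qed
      ultimately show "A \<in> mset ` {xs. set xs \<subseteq> set_mset x \<times> set_mset y \<and> length xs \<le> size x}" using xs by auto
    qed
  qed (simp add: finite_lists_length_le)
  have "card (?M a b) = card (SIGMA k:?K. ?M (a - k) ?b)"
  proof (rule bij_betw_same_card, rule bij_betw_byWitness[where
      f = "\<lambda>A. (image_mset fst (filter_mset (\<lambda>x. snd x = m) A), filter_mset (\<lambda>x. snd x \<noteq> m) A)" and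
      f' = "\<lambda>(k, A). A + image_mset (\<lambda>x. (x, m)) k"], goal_cases)
    case 1
    show ?case
    proof
      fix A assume "A \<in> ?M a b"
      have "image_mset (\<lambda>x. (x, m)) (image_mset fst (filter_mset (\<lambda>x. snd x = m) A)) = filter_mset (\<lambda>x. snd x = m) A"
      proof (induction A)
        case (add x A) thus ?case by (cases x) auto
      qed simp
      thus "(case (image_mset fst (filter_mset (\<lambda>x. snd x = m) A), filter_mset (\<lambda>x. snd x \<noteq> m) A) of
            (k, A) \<Rightarrow> A + image_mset (\<lambda>x. (x, m)) k) = A"
        by (simp add: multiset_partition[of A "\<lambda>x. snd x \<noteq> m", symmetric])
    qed
  next
    case 2
    have "filter_mset (\<lambda>x. snd x = m) (A + image_mset (\<lambda>x. (x, m)) k) = image_mset (\<lambda>x. (x, m)) k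
        \<and> filter_mset (\<lambda>x. snd x \<noteq> m) (A + image_mset (\<lambda>x. (x, m)) k) = A" if "image_mset snd A = ?b"
      for A :: "(nat \<times> nat) multiset" and k :: "nat multiset"
    proof -
      have "snd x \<noteq> m" if "x \<in># A" for x
        using \<open>image_mset snd A = ?b\<close> that
        by (metis (mono_tags, lifting) filter_mset_eq_conv image_eqI mem_Collect_eq set_image_mset set_mset_filter)
      hence "filter_mset (\<lambda>x. snd x = m) A = {#}" "filter_mset (\<lambda>x. snd x \<noteq> m) A = A"
        by (fastforce simp: filter_mset_eq_conv multiset_eq_iff count_eq_zero_iff)+
      thus ?thesis by (simp add: filter_mset_image_mset filter_mset_eq_conv o_def)
    qed
    thus ?case by (auto simp: multiset.map_comp o_def)
  next
    case 3
    show ?case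
    proof (rule image_subsetI)
      fix A :: "(nat \<times> nat) multiset"
      assume A: "A \<in> ?M a b"
      let ?k = "image_mset fst (filter_mset (\<lambda>x. snd x = m) A)"
      have s: "A = filter_mset (\<lambda>x. snd x = m) A + filter_mset (\<lambda>x. snd x \<noteq> m) A" by simp
      have e: "image_mset fst A = ?k + image_mset fst (filter_mset (\<lambda>x. snd x \<noteq> m) A)"
        by (metis s image_mset_union)
      have "size ?k = count (image_mset snd A) m"
        by (induction A) auto
      moreover have "image_mset snd (filter_mset (\<lambda>x. snd x \<noteq> m) A) = filter_mset (\<lambda>x. x \<noteq> m) (image_mset snd A)"
        by (simp add: filter_mset_image_mset o_def)
      moreover have "image_mset fst A = a" "image_mset snd A = b" using A by auto
      ultimately show "(?k, filter_mset (\<lambda>x. snd x \<noteq> m) A) \<in> (SIGMA k:?K. ?M (a - k) ?b)"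
        using e by auto
    qed
  next
    case 4
    show ?case
    proof (rule image_subsetI)
      fix kA assume kA: "kA \<in> (SIGMA k:?K. ?M (a - k) ?b)"
      obtain k A where kA': "kA = (k, A)" by (cases kA)
      have k: "k \<subseteq># a" "size k = count b m" and A: "image_mset fst A = a - k" "image_mset snd A = ?b"
        using kA kA' by auto
      have "image_mset snd (A + image_mset (\<lambda>x. (x, m)) k) = b"
        using A k mset_split_letter[of m b] by (simp add: multiset.map_comp o_def image_mset_const_eq)
      moreover have "image_mset fst (A + image_mset (\<lambda>x. (x, m)) k) = a"
        using A k by (simp add: multiset.map_comp o_def)
      ultimately show "(case kA of (k, A) \<Rightarrow> A + image_mset (\<lambda>x. (x, m)) k) \<in> ?M a b"
        using kA' by simp
    qed
  qed
  also have "\<dots> = (\<Sum>k\<in>?K. card (?M (a - k) ?b))" using fin by (subst card_SigmaI) auto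
  finally show ?thesis .
qed

text \<open>Removing the last letter of \<open>b\<close> strips a horizontal strip from the shape in
  the second factor; \<open>kostka_add_strip\<close> turns this into the removal of letters from
  \<open>a\<close> in the first. Matrices obey the same recursion by
  \<open>matrices_remove_letter\<close>.\<close>

theorem kostka_cauchy:
  assumes "set_mset a \<subseteq> {..<L}" "set_mset b \<subseteq> {..<L'}" "size a = n" "size b = n"
  shows "(\<Sum>lam\<in>par n. kostka lam a L * kostka lam b L') =
         card {A. image_mset fst A = a \<and> image_mset snd A = b}"
  using assms
proof (induction L' arbitrary: a b n)
  case 0
  hence ab: "n = 0" "b = {#}" "a = {#}" by auto
  have "kostka (\<lambda>_. 0) {#} L = 1"
  proof (induction L)
    case (Suc L)
    have "{q \<in> par 0. hstrip (\<lambda>_. 0) q} = {\<lambda>_. 0}" by (auto simp: par_0 hstrip_def)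
    thus ?case using Suc by simp
  qed simp
  moreover have "{A :: (nat \<times> nat) multiset. A = {#}} = {{#}}" by auto
  ultimately show ?case using ab by (simp add: par_0)
next
  case (Suc L')
  define b' where "b' = filter_mset (\<lambda>x. x \<noteq> L') b"
  define i where "i = count b L'"
  define s where "s = size b'"
  have si: "n = s + i" using Suc.prems size_split_letter[of L' b] by (simp add: s_def b'_def i_def)
  have b': "set_mset b' \<subseteq> {..<L'}" using Suc.prems(2) unfolding b'_def by (rule filter_ne_Suc_subset)
  have "(\<Sum>lam\<in>par n. kostka lam a L * kostka lam b (Suc L')) =
        (\<Sum>lam\<in>par n. \<Sum>\<rho> | \<rho> \<in> par s \<and> hstrip lam \<rho>. kostka lam a L * kostka \<rho> b' L')"
    by (simp add: b'_def s_def sum_distrib_left)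
  also have "\<dots> = (\<Sum>\<rho>\<in>par s. \<Sum>lam | lam \<in> par n \<and> hstrip lam \<rho>. kostka lam a L * kostka \<rho> b' L')"
    by (rule sum.swap_restrict) auto
  also have "\<dots> = (\<Sum>\<rho>\<in>par s. \<Sum>k | k \<subseteq># a \<and> size k = i. kostka \<rho> (a - k) L * kostka \<rho> b' L')"
    using kostka_add_strip[OF Suc.prems(1)] Suc.prems(3)
    by (intro sum.cong refl) (simp add: sum_distrib_right[symmetric] si)
  also have "\<dots> = (\<Sum>k | k \<subseteq># a \<and> size k = i. \<Sum>\<rho>\<in>par s. kostka \<rho> (a - k) L * kostka \<rho> b' L')"
    by (rule sum.swap)
  also have "\<dots> = (\<Sum>k | k \<subseteq># a \<and> size k = i. card {A. image_mset fst A = a - k \<and> image_mset snd A = b'})"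
  proof (intro sum.cong refl Suc.IH)
    fix k assume "k \<in> {k. k \<subseteq># a \<and> size k = i}"
    thus "set_mset (a - k) \<subseteq> {..<L}" "size (a - k) = s"
      using Suc.prems si by (auto simp: size_Diff_submset dest: in_diffD)
  qed (use b' s_def in auto)
  also have "\<dots> = card {A. image_mset fst A = a \<and> image_mset snd A = b}"
    unfolding b'_def i_def by (rule matrices_remove_letter[symmetric])
  finally show ?case .
qed

section \<open>Semistandard tableaux\<close>

definition dia :: "(nat \<Rightarrow> nat) \<Rightarrow> (nat \<times> nat) set" where
  "dia p = {(i, j). j < p i}"

definition ssyt :: "(nat \<Rightarrow> nat) \<Rightarrow> nat multiset \<Rightarrow> (nat \<times> nat \<Rightarrow> nat) set" where
  "ssyt p a = {T \<in> extensional (dia p).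
     (\<forall>i j j'. j < j' \<longrightarrow> j' < p i \<longrightarrow> T (i, j) \<le> T (i, j')) \<and>
     (\<forall>i i' j. i < i' \<longrightarrow> j < p i' \<longrightarrow> T (i, j) < T (i', j)) \<and>
     image_mset T (mset_set (dia p)) = a}"

lemma dia_Sigma: "\<forall>i\<ge>N. p i = 0 \<Longrightarrow> dia p = Sigma {..<N} (\<lambda>i. {..<p i})"
  by (auto simp: dia_def) (metis leI not_less_zero)

lemma finite_dia: "p \<in> par n \<Longrightarrow> finite (dia p)"
  using dia_Sigma[of n p] by (auto simp: par_def)

lemma card_dia: "p \<in> par n \<Longrightarrow> card (dia p) = n"
  using dia_Sigma[of n p] by (auto simp: par_def)

text \<open>In a weakly increasing row the entries below \<open>L\<close> form an initial segment,
  so a row is known once these segments are counted.\<close>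

lemma dia_restrict_less:
  assumes "\<forall>j j'. j < j' \<longrightarrow> j' < p \<longrightarrow> f j \<le> (f j' :: nat)" "j < p"
  shows "f j < L \<longleftrightarrow> j < card {j. j < p \<and> f j < L}"
proof -
  let ?S = "{j. j < p \<and> f j < L}"
  have dc: "i \<in> ?S" if "j \<in> ?S" "i \<le> j" for i j
    using that assms(1) le_less_trans[of "f i" "f j" L] by (cases "i = j") auto
  show ?thesis
  proof
    assume "f j < L"
    hence "{..j} \<subseteq> ?S" using dc[of j] assms(2) by auto
    hence "card {..j} \<le> card ?S" by (intro card_mono) auto
    thus "j < card ?S" by simp
  next
    assume j: "j < card ?S"
    show "f j < L"
    proof (rule ccontr)
      assume "\<not> f j < L"
      hence "x < j" if "x \<in> ?S" for x using dc[OF that, of j] by (metis (mono_tags, lifting) leI mem_Collect_eq)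
      hence "?S \<subseteq> {..<j}" by auto
      hence "card ?S \<le> card {..<j}" by (intro card_mono) auto
      thus False using j by simp
    qed
  qed
qed

lemma finite_ssyt:
  assumes "p \<in> par n"
  shows "finite (ssyt p a)"
proof (rule finite_subset)
  show "ssyt p a \<subseteq> (\<Pi>\<^sub>E c\<in>dia p. set_mset a)"
    using finite_dia[OF assms] by (auto simp: ssyt_def PiE_def)
  show "finite (\<Pi>\<^sub>E c\<in>dia p. set_mset a)"
    using finite_dia[OF assms] by (intro finite_PiE) auto
qed

text \<open>The cells with entries below \<open>L\<close> form the diagram of \<open>sh T\<close>,
  and the cells with entry \<open>L\<close> a horizontal strip. A tableau thus amounts to the shape
  \<open>sh T\<close> together with its restriction to it, which is the recursion of
  \<open>kostka\<close>.\<close>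

theorem card_ssyt:
  assumes "set_mset a \<subseteq> {..<L}" "p \<in> par (size a)"
  shows "card (ssyt p a) = kostka p a L"
  using assms
proof (induction L arbitrary: a p)
  case 0
  hence "a = {#}" "p = (\<lambda>_. 0)" by (auto simp: par_0)
  moreover have "ssyt (\<lambda>_. 0) {#} = {\<lambda>_. undefined}" by (auto simp: ssyt_def dia_def)
  ultimately show ?case by simp
next
  case (Suc L)
  define n where "n = size a"
  define a' where "a' = filter_mset (\<lambda>x. x \<noteq> L) a"
  define s where "s = size a'"
  have p: "p \<in> par n" using Suc.prems by (simp add: n_def)
  have fp: "finite (dia p)" using p by (rule finite_dia)
  have a'L: "set_mset a' \<subseteq> {..<L}" using Suc.prems(1) unfolding a'_def by (rule filter_ne_Suc_subset)
  have ns: "n = s + count a L" unfolding n_def s_def a'_def by (simp add: size_split_letter)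
  have aL: "a = a' + replicate_mset (count a L) L" by (simp add: a'_def mset_split_letter)
  define sh where "sh T = (\<lambda>i. card {j. j < p i \<and> T (i, j) < L})" for T :: "nat \<times> nat \<Rightarrow> nat"
  let ?Q = "{q. q \<in> par s \<and> hstrip p q}"
  have shp: "(i, j) \<in> dia (sh T) \<longleftrightarrow> (i, j) \<in> dia p \<and> T (i, j) < L" if "T \<in> ssyt p a" for T i j
  proof -
    have le: "sh T i \<le> p i" unfolding sh_def using card_mono[of "{..<p i}" "{j. j < p i \<and> T (i, j) < L}"] by auto
    have "j < p i \<Longrightarrow> T (i, j) < L \<longleftrightarrow> j < sh T i"
      unfolding sh_def using that by (intro dia_restrict_less[of "p i" "\<lambda>j. T (i, j)"]) (auto simp: ssyt_def)
    thus ?thesis using le by (auto simp: dia_def)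
  qed
  have entry: "T c \<in># a" if "T \<in> ssyt p a" "c \<in> dia p" for T c
    using that fp by (auto simp: ssyt_def)
  have sh_sub: "dia (sh T) \<subseteq> dia p" if "T \<in> ssyt p a" for T
    using shp[OF that] by auto
  have content: "image_mset T (mset_set (dia (sh T))) = a'" if "T \<in> ssyt p a" for T
  proof -
    have "dia (sh T) = {c \<in> dia p. T c \<noteq> L}"
      using shp[OF that] entry[OF that] Suc.prems(1) by fastforce
    hence "mset_set (dia (sh T)) = filter_mset (\<lambda>c. T c \<noteq> L) (mset_set (dia p))"
      using fp by (simp add: filter_mset_mset_set)
    moreover have ai: "a = image_mset T (mset_set (dia p))" using that by (simp add: ssyt_def)
    ultimately show ?thesis unfolding a'_def ai by (simp add: filter_mset_image_mset o_def)
  qed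
  have str: "hstrip p (sh T)" if T: "T \<in> ssyt p a" for T
    unfolding hstrip_def
  proof (intro allI conjI)
    fix i
    show "sh T i \<le> p i" unfolding sh_def using card_mono[of "{..<p i}" "{j. j < p i \<and> T (i, j) < L}"] by auto
    show "p (Suc i) \<le> sh T i"
    proof (rule ccontr)
      \<comment> \<open>Otherwise the column \<open>sh T i\<close> would have an entry at least
        \<open>L\<close> in row \<open>i\<close> and a larger one, but at most \<open>L\<close>,
        directly below.\<close>
      assume "\<not> p (Suc i) \<le> sh T i"
      hence c: "sh T i < p (Suc i)" by simp
      hence c': "(i, sh T i) \<in> dia p" "(Suc i, sh T i) \<in> dia p"
        using par_antimono[OF p, of i "Suc i"] by (auto simp: dia_def)
      have "\<not> T (i, sh T i) < L" using shp[OF T, of i "sh T i"] c' by (auto simp: dia_def)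
      moreover have "T (i, sh T i) < T (Suc i, sh T i)" using T c by (auto simp: ssyt_def)
      moreover have "T (Suc i, sh T i) < Suc L" using entry[OF T c'(2)] Suc.prems(1) by auto
      ultimately show False by simp
    qed
  qed
  have shpar: "sh T \<in> par s" if T: "T \<in> ssyt p a" for T
  proof -
    have h: "\<forall>i. sh T i \<le> p i" "\<forall>i. p (Suc i) \<le> sh T i" using str[OF T] by (auto simp: hstrip_def)
    have am: "antimono (sh T)" unfolding decseq_Suc_iff using h by (meson order_trans)
    have z: "\<forall>i\<ge>n. sh T i = 0" using h par_zero[OF p] by (metis le_zero_eq)
    have "card (dia (sh T)) = s" using content[OF T] unfolding s_def by (metis size_image_mset size_mset_set)
    moreover have "card (dia (sh T)) = sum (sh T) {..<n}" using dia_Sigma[OF z] by simp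
    ultimately show ?thesis using par_iff[of s n "sh T"] am z ns by simp
  qed
  have "card (ssyt p a) = card (SIGMA q:?Q. ssyt q a')"
  proof (rule bij_betw_same_card, rule bij_betw_byWitness[where
        f = "\<lambda>T. (sh T, restrict T (dia (sh T)))" and
        f' = "\<lambda>(q, T). (\<lambda>c. if c \<in> dia q then T c else if c \<in> dia p then L else undefined)"], goal_cases)
    case 1
    show ?case
    proof
      fix T assume T: "T \<in> ssyt p a"
      have "(if c \<in> dia (sh T) then T c else if c \<in> dia p then L else undefined) = T c" for c
      proof (cases "c \<in> dia p")
        case True
        have "T c \<le> L" using entry[OF T True] Suc.prems(1) by auto
        thus ?thesis using shp[OF T, of "fst c" "snd c"] True by auto
      next
        case False
        thus ?thesis using T sh_sub[OF T] by (cases c) (auto simp: ssyt_def extensional_def)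
      qed
      hence "(\<lambda>c. if c \<in> dia (sh T) then T c else if c \<in> dia p then L else undefined) = T" by (rule ext)
      thus "(case (sh T, restrict T (dia (sh T))) of (q, T) \<Rightarrow>
          \<lambda>c. if c \<in> dia q then T c else if c \<in> dia p then L else undefined) = T"
        by (simp cong: if_cong)
    qed
  next
    case 2
    show ?case
    proof (rule ballI)
      fix qT assume qT0: "qT \<in> (SIGMA q:?Q. ssyt q a')"
      obtain q T where qT: "qT = (q, T)" by (cases qT)
      have q: "q \<in> par s" "hstrip p q" and T: "T \<in> ssyt q a'" using qT0 qT by auto
      define T' where "T' = (\<lambda>c. if c \<in> dia q then T c else if c \<in> dia p then L else undefined)"
      have TL: "T c < L" if "c \<in> dia q" for c
      proof -
        have "T c \<in># a'" using T that finite_dia[OF q(1)] by (auto simp: ssyt_def)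
        thus ?thesis using a'L by auto
      qed
      have sub: "dia q \<subseteq> dia p" using q(2) by (auto simp: dia_def hstrip_def intro: less_le_trans)
      have "sh T' = q"
      proof
        fix i
        have "{j. j < p i \<and> T' (i, j) < L} = {..<q i}"
          using sub TL q(2) by (auto simp: T'_def dia_def hstrip_def split: if_splits intro: less_le_trans)
        thus "sh T' i = q i" by (simp add: sh_def)
      qed
      moreover have "restrict T' (dia q) = T" using T by (auto simp: T'_def ssyt_def extensional_def restrict_def fun_eq_iff)
      ultimately have "(sh T', restrict T' (dia (sh T'))) = (q, T)" by simp
      thus "(\<lambda>T. (sh T, restrict T (dia (sh T)))) (case qT of (q, T) \<Rightarrow> \<lambda>c. if c \<in> dia q then T c else if c \<in> dia p then L else undefined) = qT"
        unfolding T'_def qT by (simp only: prod.case)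
    qed
  next
    case 3
    show ?case
    proof (rule image_subsetI)
      fix T assume T: "T \<in> ssyt p a"
      have in': "j < p i" if "j < sh T i" for i j using sh_sub[OF T] that by (auto simp: dia_def)
      have am: "sh T i' \<le> sh T i" if "i \<le> i'" for i i' using par_antimono[OF shpar[OF T] that] .
      have "restrict T (dia (sh T)) \<in> ssyt (sh T) a'"
        unfolding ssyt_def mem_Collect_eq
      proof (intro conjI allI impI)
        fix i j j' assume "j < j'" "j' < sh T i"
        thus "restrict T (dia (sh T)) (i, j) \<le> restrict T (dia (sh T)) (i, j')"
          using T in'[of j' i] by (auto simp: ssyt_def dia_def)
      next
        fix i i' j assume "i < i'" "j < sh T i'"
        thus "restrict T (dia (sh T)) (i, j) < restrict T (dia (sh T)) (i', j)"
          using T in'[of j i'] am[of i i'] by (auto simp: ssyt_def dia_def)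
      next
        have "image_mset (restrict T (dia (sh T))) (mset_set (dia (sh T))) = image_mset T (mset_set (dia (sh T)))"
          using finite_dia[OF shpar[OF T]] by (intro image_mset_cong) auto
        thus "image_mset (restrict T (dia (sh T))) (mset_set (dia (sh T))) = a'" using content[OF T] by simp
      qed simp
      thus "(sh T, restrict T (dia (sh T))) \<in> (SIGMA q:?Q. ssyt q a')"
        using shpar[OF T] str[OF T] by simp
    qed
  next
    case 4
    show ?case
    proof (rule image_subsetI)
      fix qT assume qT0: "qT \<in> (SIGMA q:?Q. ssyt q a')"
      obtain q T where qT: "qT = (q, T)" by (cases qT)
      have q: "q \<in> par s" "hstrip p q" and T: "T \<in> ssyt q a'" using qT0 qT by auto
      define T' where "T' = (\<lambda>c. if c \<in> dia q then T c else if c \<in> dia p then L else undefined)"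
      have fq: "finite (dia q)" using q(1) by (rule finite_dia)
      have TL: "T c < L" if "c \<in> dia q" for c
      proof -
        have "T c \<in># a'" using T that fq by (auto simp: ssyt_def)
        thus ?thesis using a'L by auto
      qed
      have sub: "dia q \<subseteq> dia p" using q(2) by (auto simp: dia_def hstrip_def intro: less_le_trans)
      have q_anti: "q i' \<le> q i" if "i \<le> i'" for i i' using par_antimono[OF q(1) that] .
      have p_anti: "p i' \<le> p i" if "i \<le> i'" for i i' using par_antimono[OF p that] .
      have "T' \<in> ssyt p a"
        unfolding ssyt_def mem_Collect_eq
      proof (intro conjI allI impI)
        show "T' \<in> extensional (dia p)" using sub by (auto simp: T'_def extensional_def)
      next
        fix i j j' assume j: "j < j'" "j' < p i"
        show "T' (i, j) \<le> T' (i, j')"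
        proof (cases "j' < q i")
          case True thus ?thesis using T j by (auto simp: T'_def ssyt_def dia_def)
        next
          case False
          thus ?thesis using j TL[of "(i, j)"] by (auto simp: T'_def dia_def)
        qed
      next
        fix i i' j assume i: "i < i'" "j < p i'"
        have "p i' \<le> p (Suc i)" using i by (intro p_anti) auto
        also have "\<dots> \<le> q i" using q(2) by (auto simp: hstrip_def)
        finally have ji: "j < q i" using i by simp
        show "T' (i, j) < T' (i', j)"
        proof (cases "j < q i'")
          case True thus ?thesis using T i ji by (auto simp: T'_def ssyt_def dia_def)
        next
          case False
          thus ?thesis using i ji TL[of "(i, j)"] by (auto simp: T'_def dia_def)
        qed
      next
        have "mset_set (dia p) = mset_set (dia q) + mset_set (dia p - dia q)"
          using sub fp by (metis Diff_partition Diff_disjoint fq finite_Diff mset_set_Union)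
        moreover have "image_mset T' (mset_set (dia q)) = a'"
        proof -
          have "image_mset T' (mset_set (dia q)) = image_mset T (mset_set (dia q))"
            using fq by (intro image_mset_cong) (auto simp: T'_def)
          thus ?thesis using T by (simp add: ssyt_def)
        qed
        moreover have "image_mset T' (mset_set (dia p - dia q)) = replicate_mset (count a L) L"
        proof -
          have "image_mset T' (mset_set (dia p - dia q)) = image_mset (\<lambda>_. L) (mset_set (dia p - dia q))"
            using fp by (intro image_mset_cong) (auto simp: T'_def)
          also have "\<dots> = replicate_mset (card (dia p - dia q)) L" by (simp add: image_mset_const_eq)
          also have "card (dia p - dia q) = count a L"
            using card_Diff_subset[OF fq sub] card_dia[OF p] card_dia[OF q(1)] ns by simp
          finally show ?thesis .
        qed
        ultimately show "image_mset T' (mset_set (dia p)) = a" using aL by simp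
      qed
      thus "(case qT of (q, T) \<Rightarrow> \<lambda>c. if c \<in> dia q then T c else if c \<in> dia p then L else undefined) \<in> ssyt p a"
        unfolding T'_def qT by simp
    qed
  qed
  also have "\<dots> = (\<Sum>q\<in>?Q. card (ssyt q a'))"
    using finite_ssyt by (subst card_SigmaI) auto
  also have "\<dots> = (\<Sum>q\<in>?Q. kostka q a' L)"
    using Suc.IH[OF a'L] by (intro sum.cong) (auto simp: s_def)
  finally show ?case by (simp add: a'_def s_def)
qed

section \<open>Young symmetrizers\<close>

text \<open>Composition is written additively because the product of polynomial mappings is
  convolution over an additive monoid of keys: \<open>sym \<Rightarrow>\<^sub>0 real\<close> is then
  the group algebra with its ring structure. Taking all permutations of the naturals with finite
  support puts every S_n into one type.\<close>

typedef sym = "{f :: nat \<Rightarrow> nat. permutation f}" morphisms app Sym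
  by (rule exI[of _ id]) simp

instantiation sym :: group_add
begin
definition "0 = Sym id"
definition "a + b = Sym (app a \<circ> app b)"
definition "- a = Sym (inv (app a))"
definition "a - b = a + - (b :: sym)"

lemma permutation_app [simp]: "permutation (app a)"
  using app by blast

lemma app_zero [simp]: "app 0 = id"
  by (simp add: zero_sym_def Sym_inverse)

lemma app_add: "app (a + b) = app a \<circ> app b"
  by (simp add: plus_sym_def Sym_inverse permutation_compose)

lemma app_uminus: "app (- a) = inv (app a)"
  by (simp add: uminus_sym_def Sym_inverse permutation_inverse)

instance
proof
  fix a b c :: sym
  show "a + b + c = a + (b + c)" by (simp add: app_inject[symmetric] app_add o_assoc)
  show "0 + a = a" by (simp add: app_inject[symmetric] app_add)
  show "a + 0 = a" by (simp add: app_inject[symmetric] app_add)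
  show "- a + a = 0" by (simp add: app_inject[symmetric] app_add app_uminus permutation_inverse_works)
  show "a + - b = a - b" by (simp add: minus_sym_def)
qed
end

lemma app_add_apply [simp]: "app (a + b) x = app a (app b x)"
  by (simp add: app_add)

lemma app_uminus_cancel [simp]: "app (- a) (app a x) = x" "app a (app (- a) x) = x"
  by (metis app_add_apply app_zero id_apply left_minus, metis app_add_apply app_zero id_apply right_minus)

lemma sym_eqI: "(\<And>x. app a x = app b x) \<Longrightarrow> a = b"
  by (auto simp: app_inject[symmetric])

lemma bij_app: "bij (app a)"
  by (simp add: permutation_bijective)

definition sgn_sym :: "sym \<Rightarrow> real" where
  "sgn_sym a = of_int (sign (app a))"

lemma sgn_sym_add: "sgn_sym (a + b) = sgn_sym a * sgn_sym b"
  by (simp add: sgn_sym_def app_add sign_compose)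

lemma sgn_sym_zero [simp]: "sgn_sym 0 = 1"
  by (simp add: sgn_sym_def)

lemma sgn_sym_uminus [simp]: "sgn_sym (- a) = sgn_sym a"
  by (simp add: sgn_sym_def app_uminus sign_inverse)

lemma sgn_sym_diff: "sgn_sym (a - b) = sgn_sym a * sgn_sym b"
  using sgn_sym_add[of a "- b"] by simp

lemma sgn_sym_square [simp]: "sgn_sym a * sgn_sym a = 1"
  by (simp add: sgn_sym_def flip: of_int_mult)

definition symm :: "nat \<Rightarrow> sym set" where
  "symm n = {g. app g permutes {..<n}}"

lemma symm_zero [simp]: "0 \<in> symm n"
  by (simp add: symm_def permutes_id)

lemma symm_add: "a \<in> symm n \<Longrightarrow> b \<in> symm n \<Longrightarrow> a + b \<in> symm n"
  by (simp add: symm_def app_add permutes_compose)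

lemma symm_uminus: "a \<in> symm n \<Longrightarrow> - a \<in> symm n"
  by (simp add: symm_def app_uminus permutes_inv)

lemma symm_lt [simp]: "a \<in> symm n \<Longrightarrow> app a x < n \<longleftrightarrow> x < n"
  using permutes_in_image[of "app a" "{..<n}" x] by (simp add: symm_def)

lemma symm_ge: "a \<in> symm n \<Longrightarrow> n \<le> x \<Longrightarrow> app a x = x"
  by (auto simp: symm_def permutes_def)

lemma app_image_symm: "app ` symm n = {f. f permutes {..<n}}"
proof
  show "{f. f permutes {..<n}} \<subseteq> app ` symm n"
  proof
    fix f assume f: "f \<in> {f. f permutes {..<n}}"
    hence "app (Sym f) = f" using permutes_imp_permutation[of "{..<n}" f] by (simp add: Sym_inverse)
    thus "f \<in> app ` symm n" using f by (metis imageI mem_Collect_eq symm_def)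
  qed
qed (auto simp: symm_def)

lemma inj_app: "inj_on app A"
  by (rule inj_onI) (simp add: app_inject)

lemma finite_symm [simp]: "finite (symm n)"
  by (rule finite_imageD[OF _ inj_app]) (simp add: app_image_symm finite_permutations)

lemma card_symm: "card (symm n) = fact n"
  using card_image[OF inj_app, of "symm n"] by (simp add: app_image_symm card_permutations)

lemma symI:
  assumes "inj_on f {..<n}" "f ` {..<n} \<subseteq> {..<n}"
  obtains g where "g \<in> symm n" "\<And>x. x < n \<Longrightarrow> app g x = f x"
proof -
  define h where "h x = (if x < n then f x else x)" for x
  have "f ` {..<n} = {..<n}" using assms by (simp add: endo_inj_surj)
  hence "bij_betw h {..<n} {..<n}" using assms(1) by (auto simp: bij_betw_def h_def inj_on_def)
  hence "h permutes {..<n}" by (rule bij_imp_permutes) (simp add: h_def)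
  then obtain g where "g \<in> symm n" "h = app g" using app_image_symm[of n] by blast
  thus thesis using that[of g] by (metis h_def)
qed

lemma sum_symm_translate:
  assumes "h \<in> symm n"
  shows "(\<Sum>g\<in>symm n. f (h + g)) = (\<Sum>g\<in>symm n. f g)" "(\<Sum>g\<in>symm n. f (g + h)) = (\<Sum>g\<in>symm n. f g)"
proof -
  show "(\<Sum>g\<in>symm n. f (h + g)) = (\<Sum>g\<in>symm n. f g)"
    by (rule sum.reindex_bij_witness[of _ "\<lambda>g. - h + g" "\<lambda>g. h + g"])
       (use assms in \<open>auto simp: symm_add symm_uminus add.assoc[symmetric]\<close>)
  show "(\<Sum>g\<in>symm n. f (g + h)) = (\<Sum>g\<in>symm n. f g)"
    by (rule sum.reindex_bij_witness[of _ "\<lambda>g. g + - h" "\<lambda>g. g + h"])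
       (use assms in \<open>auto simp: symm_add symm_uminus add.assoc simp del: add_uminus_conv_diff\<close>)
qed

lemma sum_symm_uminus: "(\<Sum>g\<in>symm n. f (- g)) = (\<Sum>g\<in>symm n. f g)"
  by (rule sum.reindex_bij_witness[of _ uminus uminus]) (auto simp: symm_uminus)

text \<open>With \<open>r\<close> the row or the column index of each entry, this is the row or the
  column stabilizer of a tableau.\<close>

definition stab :: "nat \<Rightarrow> (nat \<Rightarrow> nat) \<Rightarrow> sym set" where
  "stab n r = {g \<in> symm n. \<forall>x<n. r (app g x) = r x}"

lemma stab_subset: "stab n r \<subseteq> symm n"
  by (auto simp: stab_def)

lemma finite_stab [simp]: "finite (stab n r)"
  using finite_subset[OF stab_subset] by simp

lemma stab_zero [simp]: "0 \<in> stab n r"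
  by (simp add: stab_def)

lemma stab_add: "a \<in> stab n r \<Longrightarrow> b \<in> stab n r \<Longrightarrow> a + b \<in> stab n r"
  by (auto simp: stab_def symm_add)

lemma stab_uminus: "a \<in> stab n r \<Longrightarrow> - a \<in> stab n r"
  by (auto simp: stab_def symm_uminus) (metis app_uminus_cancel(2) symm_lt symm_uminus)

lemma stab_add_iff: "h \<in> stab n r \<Longrightarrow> h + g \<in> stab n r \<longleftrightarrow> g \<in> stab n r"
  by (metis add.assoc add_0 left_minus stab_add stab_uminus)

lemma stab_diff_iff: "h \<in> stab n r \<Longrightarrow> g - h \<in> stab n r \<longleftrightarrow> g \<in> stab n r"
  by (metis diff_add_cancel diff_conv_add_uminus stab_add stab_uminus)

section \<open>The real group algebra\<close>

abbreviation single :: "sym \<Rightarrow> real \<Rightarrow> sym \<Rightarrow>\<^sub>0 real" where "single \<equiv> Poly_Mapping.single"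
abbreviation lookup :: "(sym \<Rightarrow>\<^sub>0 real) \<Rightarrow> sym \<Rightarrow> real" where "lookup \<equiv> Poly_Mapping.lookup"
abbreviation keys :: "(sym \<Rightarrow>\<^sub>0 real) \<Rightarrow> sym set" where "keys \<equiv> Poly_Mapping.keys"

lemma algebra_expand:
  assumes "keys x \<subseteq> A" "finite A"
  shows "x = (\<Sum>g\<in>A. single g (lookup x g))"
proof (rule poly_mapping_eqI)
  fix k
  have "(\<Sum>g\<in>A. lookup (single g (lookup x g)) k) = (\<Sum>g\<in>A. if g = k then lookup x k else 0)"
    by (intro sum.cong) (auto simp: lookup_single when_def)
  also have "\<dots> = lookup x k" using assms by (auto simp: in_keys_iff)
  finally show "lookup x k = lookup (\<Sum>g\<in>A. single g (lookup x g)) k" by (simp add: lookup_sum)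
qed

lemma lookup_single_mult: "lookup (single h c * x) g = c * lookup x (- h + g)"
proof -
  have *: "h + k = g \<longleftrightarrow> k = - h + g" for k by (metis add.assoc add_0 left_minus right_minus)
  have "single h c * x = (\<Sum>k\<in>keys x. single (h + k) (c * lookup x k))"
    by (subst algebra_expand[of x "keys x"]) (auto simp: sum_distrib_left mult_single)
  hence "lookup (single h c * x) g = (\<Sum>k\<in>keys x. if k = - h + g then c * lookup x k else 0)"
    by (simp add: lookup_sum lookup_single when_def * cong: sum.cong)
  also have "\<dots> = c * lookup x (- h + g)" by (auto simp: in_keys_iff)
  finally show ?thesis .
qed

lemma lookup_mult_single: "lookup (x * single h c) g = lookup x (g - h) * c"
proof -
  have *: "k + h = g \<longleftrightarrow> k = g - h" for k by (metis add_diff_cancel diff_add_cancel)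
  have "x * single h c = (\<Sum>k\<in>keys x. single (k + h) (lookup x k * c))"
    by (subst algebra_expand[of x "keys x"]) (auto simp: sum_distrib_right mult_single)
  hence "lookup (x * single h c) g = (\<Sum>k\<in>keys x. if k = g - h then lookup x k * c else 0)"
    by (simp add: lookup_sum lookup_single when_def * cong: sum.cong)
  also have "\<dots> = lookup x (g - h) * c" by (auto simp: in_keys_iff)
  finally show ?thesis .
qed

abbreviation scal :: "real \<Rightarrow> sym \<Rightarrow>\<^sub>0 real" where "scal c \<equiv> single 0 c"

lemma scal_commute: "scal c * x = x * scal c"
  by (rule poly_mapping_eqI) (simp add: lookup_single_mult lookup_mult_single mult.commute)

lemma lookup_scal: "lookup (scal c * x) g = c * lookup x g"
  by (simp add: lookup_single_mult)

lemma mult_scal: "y * (scal c * z) = scal c * (y * z)"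
  by (metis mult.assoc scal_commute)

lemma scal_scal: "scal a * (scal b * x) = scal (a * b) * x"
  by (simp only: mult.assoc[symmetric] mult_single add_0)

lemma single_scal: "single g c = scal c * single g 1"
  by (simp add: mult_single)

lemma lookup_mult_sum:
  assumes "keys x \<subseteq> A" "finite A"
  shows "lookup (x * y) g = (\<Sum>h\<in>A. lookup x h * lookup y (- h + g))"
proof -
  have "x * y = (\<Sum>h\<in>A. single h (lookup x h) * y)"
    by (subst algebra_expand[OF assms]) (simp add: sum_distrib_right)
  thus ?thesis by (simp add: lookup_sum lookup_single_mult)
qed

lemma keys_subset_mult:
  assumes "keys x \<subseteq> symm n" "keys y \<subseteq> symm n"
  shows "keys (x * y) \<subseteq> symm n"
  using keys_mult[of x y] assms by (fastforce simp: symm_add)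

definition kap :: "nat \<Rightarrow> (nat \<Rightarrow> nat) \<Rightarrow> sym \<Rightarrow>\<^sub>0 real" where
  "kap n col = (\<Sum>g\<in>stab n col. single g (sgn_sym g))"

definition rho :: "nat \<Rightarrow> (nat \<Rightarrow> nat) \<Rightarrow> sym \<Rightarrow>\<^sub>0 real" where
  "rho n row = (\<Sum>g\<in>stab n row. single g 1)"

lemma lookup_elt_sum:
  assumes "finite S"
  shows "lookup (\<Sum>g\<in>S. single g (f g)) k = (if k \<in> S then f k else 0)"
proof -
  have "lookup (\<Sum>g\<in>S. single g (f g)) k = (\<Sum>g\<in>S. if g = k then f g else 0)"
    by (simp add: lookup_sum lookup_single when_def cong: if_cong)
  thus ?thesis using assms by simp
qed

lemma lookup_kap: "lookup (kap n col) g = (if g \<in> stab n col then sgn_sym g else 0)"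
  by (simp add: kap_def lookup_elt_sum)

lemma lookup_rho: "lookup (rho n row) g = (if g \<in> stab n row then 1 else 0)"
  by (simp add: rho_def lookup_elt_sum)

lemma keys_kap: "keys (kap n col) \<subseteq> stab n col"
  by (auto simp: in_keys_iff lookup_kap split: if_splits)

lemma keys_rho: "keys (rho n row) \<subseteq> stab n row"
  by (auto simp: in_keys_iff lookup_rho split: if_splits)

lemma keys_kap_symm: "keys (kap n col) \<subseteq> symm n" and keys_rho_symm: "keys (rho n row) \<subseteq> symm n"
  using keys_kap keys_rho stab_subset by blast+

lemma kap_mult_single: "g \<in> stab n col \<Longrightarrow> kap n col * single g 1 = scal (sgn_sym g) * kap n col"
  by (intro poly_mapping_eqI) (simp add: lookup_mult_single lookup_scal lookup_kap sgn_sym_diff stab_diff_iff)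

lemma single_mult_kap: "g \<in> stab n col \<Longrightarrow> single g 1 * kap n col = scal (sgn_sym g) * kap n col"
  using stab_add_iff[OF stab_uminus, of g n col]
  by (intro poly_mapping_eqI) (simp add: lookup_single_mult lookup_scal lookup_kap sgn_sym_add)

lemma single_mult_rho: "g \<in> stab n row \<Longrightarrow> single g 1 * rho n row = rho n row"
  using stab_add_iff[OF stab_uminus, of g n row]
  by (intro poly_mapping_eqI) (simp add: lookup_single_mult lookup_rho)

lemma kap_mult_kap: "kap n col * kap n col = scal (card (stab n col)) * kap n col"
proof -
  have "kap n col * kap n col = (\<Sum>g\<in>stab n col. scal (sgn_sym g) * (single g 1 * kap n col))"
    by (subst (1) kap_def) (simp only: sum_distrib_right mult.assoc[symmetric] mult_single add_0 mult_1_right)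
  also have "\<dots> = (\<Sum>g\<in>stab n col. kap n col)"
    by (intro sum.cong) (simp_all add: single_mult_kap scal_scal)
  also have "\<dots> = scal (card (stab n col)) * kap n col"
    by (intro poly_mapping_eqI) (simp add: lookup_sum lookup_scal)
  finally show ?thesis .
qed

lemma rho_mult_rho: "rho n row * rho n row = scal (card (stab n row)) * rho n row"
proof -
  have "rho n row * rho n row = (\<Sum>g\<in>stab n row. single g 1 * rho n row)"
    by (subst (1) rho_def) (simp add: sum_distrib_right)
  also have "\<dots> = (\<Sum>g\<in>stab n row. rho n row)"
    by (intro sum.cong) (simp_all add: single_mult_rho)
  also have "\<dots> = scal (card (stab n row)) * rho n row"
    by (intro poly_mapping_eqI) (simp add: lookup_sum lookup_scal)
  finally show ?thesis .
qed

text \<open>A tableau is given by the row and the column in which each entry stands.\<close>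

definition tabl :: "nat \<Rightarrow> (nat \<Rightarrow> nat) \<Rightarrow> (nat \<Rightarrow> nat) \<Rightarrow> (nat \<Rightarrow> nat) \<Rightarrow> bool" where
  "tabl n p row col \<longleftrightarrow> p \<in> par n \<and> bij_betw (\<lambda>x. (row x, col x)) {..<n} (dia p)"

lemma tabl_exists:
  assumes "p \<in> par n"
  obtains row col where "tabl n p row col"
proof -
  obtain f where f: "bij_betw f {..<n} (dia p)"
    using finite_same_card_bij[of "{..<n}" "dia p"] finite_dia[OF assms] card_dia[OF assms] by auto
  hence "tabl n p (fst \<circ> f) (snd \<circ> f)" using assms by (simp add: tabl_def)
  thus thesis using that by blast
qed

lemma tabl_inj: "tabl n p row col \<Longrightarrow> x < n \<Longrightarrow> y < n \<Longrightarrow> row x = row y \<Longrightarrow> col x = col y \<Longrightarrow> x = y"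
  by (auto simp: tabl_def bij_betw_def inj_on_def)

lemma tabl_cell: "tabl n p row col \<Longrightarrow> x < n \<Longrightarrow> col x < p (row x)"
  by (auto simp: tabl_def bij_betw_def dia_def)

lemma tabl_surj:
  assumes "tabl n p row col" "j < p i"
  obtains x where "x < n" "row x = i" "col x = j"
proof -
  have "(i, j) \<in> (\<lambda>x. (row x, col x)) ` {..<n}"
    using assms by (auto simp: tabl_def bij_betw_def dia_def)
  thus thesis using that by auto
qed

section \<open>Fillings with distinct values in each column\<close>

lemma card_rows:
  assumes "tabl n p row col"
  shows "card {x \<in> {..<n}. row x < i} = sum p {..<i}"
proof -
  have "card {x \<in> {..<n}. row x < i} = card (Sigma {..<i} (\<lambda>k. {..<p k}))"
  proof (rule bij_betw_same_card)
    show "bij_betw (\<lambda>x. (row x, col x)) {x \<in> {..<n}. row x < i} (Sigma {..<i} (\<lambda>k. {..<p k}))"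
      unfolding bij_betw_def
    proof
      show "inj_on (\<lambda>x. (row x, col x)) {x \<in> {..<n}. row x < i}"
        using assms by (auto simp: tabl_def bij_betw_def inj_on_def)
      show "(\<lambda>x. (row x, col x)) ` {x \<in> {..<n}. row x < i} = Sigma {..<i} (\<lambda>k. {..<p k})"
      proof
        show "Sigma {..<i} (\<lambda>k. {..<p k}) \<subseteq> (\<lambda>x. (row x, col x)) ` {x \<in> {..<n}. row x < i}"
        proof (rule subsetI)
          fix z assume z: "z \<in> Sigma {..<i} (\<lambda>k. {..<p k})"
          hence "snd z < p (fst z)" by auto
          then obtain x where "x < n" "row x = fst z" "col x = snd z" by (rule tabl_surj[OF assms])
          thus "z \<in> (\<lambda>x. (row x, col x)) ` {x \<in> {..<n}. row x < i}" using z by (intro image_eqI[of _ _ x]) auto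
        qed
      qed (use tabl_cell[OF assms] in auto)
    qed
  qed
  thus ?thesis by simp
qed

text \<open>For a column of length \<open>c\<close> the right-hand side is \<open>min i c\<close>.\<close>

lemma column_distinct:
  assumes t: "tabl n p row col"
    and X: "\<And>x y. x < n \<Longrightarrow> y < n \<Longrightarrow> x \<noteq> y \<Longrightarrow> col x = col y \<Longrightarrow> X x \<noteq> (X y :: nat)"
  shows "card {x \<in> {..<n}. col x = j \<and> X x < i} \<le> card {x \<in> {..<n}. col x = j \<and> row x < i}"
proof -
  let ?C = "{x \<in> {..<n}. col x = j}"
  let ?R = "{x \<in> {..<n}. col x = j \<and> row x < i}"
  have injr: "inj_on row ?C" using tabl_inj[OF t] by (auto simp: inj_on_def)
  have injX: "inj_on X ?C"
  proof (rule inj_onI)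
    fix x y assume "x \<in> ?C" "y \<in> ?C" "X x = X y"
    thus "x = y" using X[of x y] by auto
  qed
  show ?thesis
  proof (cases "?R = ?C")
    case True
    show ?thesis unfolding True by (intro card_mono) auto
  next
    case False
    then obtain y where y: "y < n" "col y = j" "\<not> row y < i" by auto
    have "{..<i} \<subseteq> row ` ?R"
    proof
      fix k assume k: "k \<in> {..<i}"
      have "j < p (row y)" using tabl_cell[OF t y(1)] y by simp
      also have "\<dots> \<le> p k" using t k y by (intro par_antimono[of p n]) (auto simp: tabl_def)
      finally obtain x where "x < n" "row x = k" "col x = j" by (rule tabl_surj[OF t])
      thus "k \<in> row ` ?R" using k by auto
    qed
    hence "card {..<i} \<le> card (row ` ?R)" by (intro card_mono) auto
    also have "\<dots> \<le> card ?R" by (rule card_image_le) simp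
    finally have "i \<le> card ?R" by simp
    moreover have "card {x \<in> {..<n}. col x = j \<and> X x < i} \<le> card {..<i}"
      by (intro card_inj_on_le[of X]) (auto intro: inj_on_subset[OF injX])
    ultimately show ?thesis by simp
  qed
qed

lemma card_by_columns:
  assumes "tabl n p row col"
  shows "card {x \<in> {..<n}. P x} = (\<Sum>j\<in>col ` {..<n}. card {x \<in> {..<n}. col x = j \<and> P x})"
proof -
  have "{x \<in> {..<n}. P x} = (\<Union>j\<in>col ` {..<n}. {x \<in> {..<n}. col x = j \<and> P x})" by auto
  moreover have "card \<dots> = (\<Sum>j\<in>col ` {..<n}. card {x \<in> {..<n}. col x = j \<and> P x})"
    by (intro card_UN_disjoint) auto
  ultimately show ?thesis by simp
qed

text \<open>The sum of \<open>column_distinct\<close> over all columns. With \<open>X\<close> the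
  row index in a second tableau it compares the two shapes in the dominance order.\<close>

lemma column_distinct_dominates:
  assumes "tabl n p row col"
    and "\<And>x y. x < n \<Longrightarrow> y < n \<Longrightarrow> x \<noteq> y \<Longrightarrow> col x = col y \<Longrightarrow> X x \<noteq> (X y :: nat)"
  shows "card {x \<in> {..<n}. X x < i} \<le> sum p {..<i}"
  unfolding card_rows[OF assms(1), symmetric]
  unfolding card_by_columns[OF assms(1), of "\<lambda>x. X x < i"] card_by_columns[OF assms(1), of "\<lambda>x. row x < i"]
  by (intro sum_mono column_distinct[OF assms])

text \<open>Equality of the sums forces equality in every column. If the column of \<open>x\<close>
  had no row \<open>X x\<close>, all its cells would have row index below \<open>X x\<close>, hence
  all its values would be below \<open>X x\<close>, which fails at \<open>x\<close>.\<close>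

lemma column_distinct_equality:
  assumes t: "tabl n p row col"
    and X: "\<And>x y. x < n \<Longrightarrow> y < n \<Longrightarrow> x \<noteq> y \<Longrightarrow> col x = col y \<Longrightarrow> X x \<noteq> (X y :: nat)"
    and eq: "\<And>i. card {x \<in> {..<n}. X x < i} = sum p {..<i}"
    and x: "x < n"
  shows "col x < p (X x)"
proof -
  have "card {y \<in> {..<n}. col y = j \<and> X y < i} = card {y \<in> {..<n}. col y = j \<and> row y < i}"
    if "j \<in> col ` {..<n}" for i j
  proof (rule sum_mono_inv[of "\<lambda>j. card {y \<in> {..<n}. col y = j \<and> X y < i}" "col ` {..<n}"
        "\<lambda>j. card {y \<in> {..<n}. col y = j \<and> row y < i}" j])
    show "(\<Sum>j\<in>col ` {..<n}. card {y \<in> {..<n}. col y = j \<and> X y < i}) =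
          (\<Sum>j\<in>col ` {..<n}. card {y \<in> {..<n}. col y = j \<and> row y < i})"
      using eq[of i] unfolding card_rows[OF t, symmetric]
      unfolding card_by_columns[OF t, of "\<lambda>x. X x < i"] card_by_columns[OF t, of "\<lambda>x. row x < i"] .
    show "card {y \<in> {..<n}. col y = j \<and> X y < i} \<le> card {y \<in> {..<n}. col y = j \<and> row y < i}" for j
      by (rule column_distinct[OF t X])
  qed (use that in auto)
  note e = this[of "col x"]
  define i where "i = Suc (X x)"
  have "\<exists>y<n. col y = col x \<and> X x \<le> row y"
  proof (rule ccontr)
    assume "\<not> ?thesis"
    hence r: "{y \<in> {..<n}. col y = col x \<and> row y < X x} = {y \<in> {..<n}. col y = col x}" by fastforce
    have "card {y \<in> {..<n}. col y = col x \<and> X y < X x} < card {y \<in> {..<n}. col y = col x}"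
      using x by (intro psubset_card_mono) auto
    moreover have "card {y \<in> {..<n}. col y = col x \<and> X y < X x} = card {y \<in> {..<n}. col y = col x}"
      unfolding r[symmetric] using x by (intro e) auto
    ultimately show False by (simp only: less_irrefl)
  qed
  then obtain y where y: "y < n" "col y = col x" "X x \<le> row y" by blast
  have "col x < p (row y)" using tabl_cell[OF t y(1)] y by simp
  also have "\<dots> \<le> p (X x)" using t y by (intro par_antimono[of p n]) (auto simp: tabl_def)
  finally show ?thesis .
qed

text \<open>Within a column the values of \<open>X\<close> are distinct and name rows which that
  column has, so sending each entry to the row named by \<open>X\<close> permutes the
  column.\<close>

lemma column_rearrangement:
  assumes t: "tabl n p row col"
    and X: "\<And>x y. x < n \<Longrightarrow> y < n \<Longrightarrow> x \<noteq> y \<Longrightarrow> col x = col y \<Longrightarrow> X x \<noteq> (X y :: nat)"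
    and eq: "\<And>i. card {x \<in> {..<n}. X x < i} = sum p {..<i}"
  obtains g where "g \<in> stab n col" "\<And>x. x < n \<Longrightarrow> row (app g x) = X x"
proof -
  have "\<exists>y<n. row y = X x \<and> col y = col x" if "x < n" for x
    using column_distinct_equality[OF assms that] tabl_surj[OF t] by blast
  then obtain f where f: "\<And>x. x < n \<Longrightarrow> f x < n \<and> row (f x) = X x \<and> col (f x) = col x" by metis
  have "inj_on f {..<n}"
  proof (rule inj_onI)
    fix x y assume "x \<in> {..<n}" "y \<in> {..<n}" "f x = f y"
    thus "x = y" using f[of x] f[of y] X[of x y] by (metis lessThan_iff)
  qed
  then obtain g where "g \<in> symm n" "\<And>x. x < n \<Longrightarrow> app g x = f x"
    using f by (elim symI) auto
  thus thesis using that[of g] f by (auto simp: stab_def)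
qed

definition dominates :: "(nat \<Rightarrow> nat) \<Rightarrow> (nat \<Rightarrow> nat) \<Rightarrow> bool" where
  "dominates p q \<longleftrightarrow> (\<forall>i. sum q {..<i} \<le> sum p {..<i})"

lemma dominates_antisym:
  assumes "dominates p q" "dominates q p"
  shows "p = q"
proof
  fix i
  have "sum p {..<k} = sum q {..<k}" for k using assms by (simp add: dominates_def le_antisym)
  from this[of i] this[of "Suc i"] show "p i = q i" by simp
qed

lemma card_rows_shift:
  assumes "g \<in> symm n"
  shows "card {x \<in> {..<n}. row (app g x) < i} = card {x \<in> {..<n}. row x < (i::nat)}"
proof (rule bij_betw_same_card[of "app g"], rule bij_betw_byWitness[of _ "app (- g)"])
  show "app (- g) ` {x \<in> {..<n}. row x < i} \<subseteq> {x \<in> {..<n}. row (app g x) < i}"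
    using assms symm_uminus[OF assms] by auto
qed (use assms in auto)

section \<open>Products of column and row symmetrizers\<close>

text \<open>The transposition \<open>u\<close> of \<open>x\<close> and \<open>y\<close> lies in the
  column stabilizer, where it produces the sign -1; its conjugate by \<open>g\<close> lies in the
  row stabilizer and is absorbed there. So the product equals its own negative.\<close>

lemma sandwich_zero:
  assumes g: "g \<in> symm n" and xy: "x < n" "y < n" "x \<noteq> y" "col x = col y" "row2 (app (- g) x) = row2 (app (- g) y)"
  shows "kap n col * single g 1 * rho n row2 = 0"
proof -
  define u where "u = Sym (transpose x y)"
  have u: "app u = transpose x y" by (simp add: u_def Sym_inverse permutation_swap_id)
  have us: "u \<in> symm n" using xy by (simp add: symm_def u permutes_swap_id)
  have uc: "u \<in> stab n col" using us xy by (auto simp: stab_def u transpose_def)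
  have "- g + u + g \<in> symm n" using g us by (simp add: symm_add symm_uminus)
  moreover have "row2 (app (- g + u + g) z) = row2 z" for z
  proof (cases "app g z = x \<or> app g z = y")
    case True
    thus ?thesis using xy(5) by (auto simp: u)
  qed (auto simp: u transpose_def)
  ultimately have ur: "- g + u + g \<in> stab n row2" by (simp add: stab_def)
  have "kap n col * single u 1 = scal (-1) * kap n col"
    using kap_mult_single[OF uc] xy by (simp add: sgn_sym_def u sign_swap_id)
  hence "scal (-1) * (kap n col * single g 1 * rho n row2) = kap n col * single u 1 * single g 1 * rho n row2"
    by (simp only: mult.assoc)
  also have "\<dots> = kap n col * single g 1 * (single (- g + u + g) 1 * rho n row2)"
  proof -
    have "single u 1 * single g 1 = single g 1 * single (- g + u + g) (1::real)"
      by (simp add: mult_single add.assoc[symmetric])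
    hence "kap n col * (single u 1 * single g 1) * rho n row2 = kap n col * (single g 1 * single (- g + u + g) 1) * rho n row2"
      by (simp only:)
    thus ?thesis by (simp only: mult.assoc)
  qed
  also have "\<dots> = kap n col * single g 1 * rho n row2" by (simp add: single_mult_rho[OF ur])
  finally have E: "scal (-1) * (kap n col * single g 1 * rho n row2) = kap n col * single g 1 * rho n row2" .
  show ?thesis
  proof (rule poly_mapping_eqI)
    fix k
    show "lookup (kap n col * single g 1 * rho n row2) k = lookup 0 k"
      using arg_cong[OF E, of "\<lambda>w. lookup w k"] by (simp only: lookup_scal) simp
  qed
qed

text \<open>If the product does not vanish, then by \<open>sandwich_zero\<close> the row indices of
  the second tableau, moved by \<open>g\<close>, are distinct in each column of the first.\<close>

lemma sandwich_dominates:
  assumes t: "tabl n p row col" and t2: "tabl n p2 row2 col2" and g: "g \<in> symm n"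
    and "kap n col * single g 1 * rho n row2 \<noteq> 0"
  shows "dominates p p2"
  unfolding dominates_def
proof
  fix i
  have "card {x \<in> {..<n}. row2 (app (- g) x) < i} \<le> sum p {..<i}"
    using sandwich_zero[OF g, of _ _ col row2] assms(4) by (intro column_distinct_dominates[OF t]) blast
  thus "sum p2 {..<i} \<le> sum p {..<i}"
    using card_rows_shift[OF symm_uminus[OF g], of row2 i] card_rows[OF t2] by simp
qed

text \<open>Unless \<open>sandwich_zero\<close> applies, the rows moved by \<open>g\<close> are
  column-distinct with the right sizes. By \<open>column_rearrangement\<close> g is then a column
  permutation times a row permutation, and both are absorbed up to a sign.\<close>

lemma sandwich_same:
  assumes t: "tabl n p row col" and g: "g \<in> symm n"
  shows "\<exists>c. kap n col * single g 1 * rho n row = scal c * (kap n col * rho n row)"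
proof (cases "kap n col * single g 1 * rho n row = 0")
  case True
  thus ?thesis by (intro exI[of _ 0]) simp
next
  case False
  let ?X = "\<lambda>x. row (app (- g) x)"
  have d: "?X x \<noteq> ?X y" if "x < n" "y < n" "x \<noteq> y" "col x = col y" for x y
    using sandwich_zero[OF g that, of row] False by blast
  have "card {x \<in> {..<n}. ?X x < i} = sum p {..<i}" for i
    using card_rows_shift[OF symm_uminus[OF g], of row i] card_rows[OF t] by simp
  from column_rearrangement[of n p row col ?X, OF t d this]
  obtain p' where p': "p' \<in> stab n col" "\<And>x. x < n \<Longrightarrow> row (app p' x) = ?X x" by blast
  have "row (app (p' + g) x) = row x" if "x < n" for x
    using p'(2)[of "app g x"] that g by simp
  hence q: "p' + g \<in> stab n row" using p'(1) g by (auto simp: stab_def symm_add)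
  have "single g 1 = single (- p') 1 * single (p' + g) (1::real)"
    by (simp add: mult_single add.assoc[symmetric])
  hence "kap n col * single g 1 * rho n row = (kap n col * single (- p') 1) * (single (p' + g) 1 * rho n row)"
    by (simp only: mult.assoc)
  also have "\<dots> = scal (sgn_sym p') * (kap n col * rho n row)"
    by (simp only: kap_mult_single[OF stab_uminus[OF p'(1)]] single_mult_rho[OF q] sgn_sym_uminus mult.assoc)
  finally show ?thesis by blast
qed

text \<open>Between \<open>kap\<close> and \<open>rho\<close> the whole algebra of S_n collapses to
  a line. It is applied to rho kap for the square of the symmetrizer, to rho g kap for the norm of
  the character, and to z rho kap for the action of a central element z.\<close>

lemma sandwich_same_algebra:
  assumes t: "tabl n p row col" and x: "keys x \<subseteq> symm n"
  shows "\<exists>c. kap n col * x * rho n row = scal c * (kap n col * rho n row)"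
proof -
  let ?e = "kap n col * rho n row"
  obtain c where c: "\<And>g. g \<in> symm n \<Longrightarrow> kap n col * single g 1 * rho n row = scal (c g) * ?e"
    using bchoice[of "symm n" "\<lambda>g c. kap n col * single g 1 * rho n row = scal c * ?e"] sandwich_same[OF t] by auto
  have "kap n col * x * rho n row = (\<Sum>g\<in>symm n. kap n col * single g (lookup x g) * rho n row)"
    by (subst algebra_expand[OF x]) (simp, simp only: sum_distrib_left sum_distrib_right)
  also have "\<dots> = (\<Sum>g\<in>symm n. scal (lookup x g) * (kap n col * single g 1 * rho n row))"
    by (intro sum.cong refl, subst single_scal) (simp only: mult.assoc mult_scal)
  also have "\<dots> = (\<Sum>g\<in>symm n. scal (lookup x g * c g) * ?e)"
    by (intro sum.cong refl) (simp only: c scal_scal)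
  also have "\<dots> = scal (\<Sum>g\<in>symm n. lookup x g * c g) * ?e"
    by (intro poly_mapping_eqI) (simp add: lookup_sum lookup_scal sum_distrib_right)
  finally show ?thesis by blast
qed

section \<open>The adjoint and positivity\<close>

text \<open>The adjoint for the inner product in which the permutations are orthonormal: the
  coefficient of \<open>star x * x\<close> at the identity is the sum of the squares of the
  coefficients of \<open>x\<close>.\<close>

definition star :: "(sym \<Rightarrow>\<^sub>0 real) \<Rightarrow> (sym \<Rightarrow>\<^sub>0 real)" where
  "star x = Poly_Mapping.map_key uminus x"

lemma lookup_star: "lookup (star x) g = lookup x (- g)"
proof -
  have "inj (uminus :: sym \<Rightarrow> sym)" by (rule injI) simp
  thus ?thesis by (simp add: star_def map_key.rep_eq)
qed

lemma star_star [simp]: "star (star x) = x"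
  by (rule poly_mapping_eqI) (simp add: lookup_star)

lemma keys_star: "keys x \<subseteq> symm n \<Longrightarrow> keys (star x) \<subseteq> symm n"
  by (intro subsetI) (metis in_keys_iff lookup_star minus_minus subsetD symm_uminus)

lemma lookup_outside: "keys x \<subseteq> symm n \<Longrightarrow> g \<notin> symm n \<Longrightarrow> lookup x g = 0"
  by (auto simp: in_keys_iff)

lemma lookup_mult_sum2:
  assumes "keys y \<subseteq> A" "finite A"
  shows "lookup (x * y) g = (\<Sum>h\<in>A. lookup x (g - h) * lookup y h)"
proof -
  have "x * y = (\<Sum>h\<in>A. x * single h (lookup y h))"
    by (subst algebra_expand[OF assms]) (simp add: sum_distrib_left)
  thus ?thesis by (simp add: lookup_sum lookup_mult_single)
qed

lemma star_mult:
  assumes "keys x \<subseteq> symm n" "keys y \<subseteq> symm n"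
  shows "star (x * y) = star y * star x"
proof (rule poly_mapping_eqI)
  fix g
  show "lookup (star (x * y)) g = lookup (star y * star x) g"
  proof (cases "g \<in> symm n")
    case True
    have "lookup (star y * star x) g = (\<Sum>h\<in>symm n. lookup y (- h) * lookup x (- (- h + g)))"
      using lookup_mult_sum[OF keys_star[OF assms(2)], of "star x" g] by (simp add: lookup_star)
    also have "\<dots> = (\<Sum>h\<in>symm n. lookup y (- (g + h)) * lookup x (- (- (g + h) + g)))"
      by (rule sum_symm_translate(1)[OF True, of "\<lambda>h. lookup y (- h) * lookup x (- (- h + g))", symmetric])
    also have "\<dots> = (\<Sum>h\<in>symm n. lookup x h * lookup y (- h + - g))"
      by (intro sum.cong refl) (simp only: minus_add minus_minus minus_add_cancel mult.commute)
    also have "\<dots> = lookup (star (x * y)) g"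
      using lookup_mult_sum[OF assms(1), of y "- g"] by (simp add: lookup_star)
    finally show ?thesis by simp
  next
    case False
    have "- g \<notin> symm n" using False by (metis minus_minus symm_uminus)
    thus ?thesis using False lookup_outside[OF keys_subset_mult[OF assms]]
        lookup_outside[OF keys_subset_mult[OF keys_star[OF assms(2)] keys_star[OF assms(1)]]]
      by (simp add: lookup_star)
  qed
qed

lemma stab_uminus_iff [simp]: "- g \<in> stab n r \<longleftrightarrow> g \<in> stab n r"
  by (metis minus_minus stab_uminus)

lemma star_kap [simp]: "star (kap n col) = kap n col"
  by (rule poly_mapping_eqI) (simp add: lookup_star lookup_kap)

lemma star_rho [simp]: "star (rho n row) = rho n row"
  by (rule poly_mapping_eqI) (simp add: lookup_star lookup_rho)

lemma lookup_star_mult_zero: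
  assumes "keys x \<subseteq> symm n"
  shows "lookup (star x * x) 0 = (\<Sum>g\<in>symm n. (lookup x g)\<^sup>2)"
proof -
  have "lookup (star x * x) 0 = (\<Sum>g\<in>symm n. lookup x (- g) * lookup x (- g))"
    using lookup_mult_sum[OF keys_star[OF assms], of x 0] by (simp add: lookup_star)
  also have "\<dots> = (\<Sum>g\<in>symm n. lookup x g * lookup x g)"
    by (rule sum_symm_uminus[of "\<lambda>g. lookup x g * lookup x g"])
  finally show ?thesis by (simp add: power2_eq_square)
qed

lemma lookup_star_mult_zero_ge:
  assumes "keys x \<subseteq> symm n"
  shows "(lookup x 0)\<^sup>2 \<le> lookup (star x * x) 0"
  unfolding lookup_star_mult_zero[OF assms] by (intro member_le_sum) auto

definition young :: "nat \<Rightarrow> (nat \<Rightarrow> nat) \<Rightarrow> (nat \<Rightarrow> nat) \<Rightarrow> sym \<Rightarrow>\<^sub>0 real" where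
  "young n row col = kap n col * rho n row"

text \<open>The scalar h with e e = h e, read off at the identity, where e has coefficient 1. By
  \<open>chi_zero\<close> it is n! divided by the value of the character at the identity, in other
  words the product of the hook lengths.\<close>

definition hookprod :: "nat \<Rightarrow> (nat \<Rightarrow> nat) \<Rightarrow> (nat \<Rightarrow> nat) \<Rightarrow> real" where
  "hookprod n row col = lookup (young n row col * young n row col) 0"

lemma keys_young: "keys (young n row col) \<subseteq> symm n"
  unfolding young_def by (intro keys_subset_mult keys_kap_symm keys_rho_symm)

lemma lookup_young:
  "lookup (young n row col) g = (\<Sum>p\<in>stab n col. if - p + g \<in> stab n row then sgn_sym p else 0)"
  unfolding young_def by (subst lookup_mult_sum[OF keys_kap]) (auto simp: lookup_kap lookup_rho intro!: sum.cong)

lemma stab_row_col: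
  assumes t: "tabl n p row col" and "g \<in> stab n row" "g \<in> stab n col"
  shows "g = 0"
proof (rule sym_eqI)
  fix x show "app g x = app 0 x"
    using assms(2,3) tabl_inj[OF t, of "app g x" x] symm_ge[of g n x]
    by (cases "x < n") (auto simp: stab_def)
qed

lemma lookup_young_0:
  assumes t: "tabl n p row col"
  shows "lookup (young n row col) 0 = 1"
proof -
  have "lookup (young n row col) 0 = (\<Sum>p\<in>stab n col. if p = 0 then 1 else 0)"
    unfolding lookup_young using stab_row_col[OF t] by (intro sum.cong) auto
  thus ?thesis by simp
qed

lemma young_square:
  assumes t: "tabl n p row col"
  shows "young n row col * young n row col = scal (hookprod n row col) * young n row col"
proof -
  have "keys (rho n row * kap n col) \<subseteq> symm n" by (intro keys_subset_mult keys_kap_symm keys_rho_symm)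
  from sandwich_same_algebra[OF t this] obtain c where
    c: "kap n col * (rho n row * kap n col) * rho n row = scal c * young n row col"
    unfolding young_def by blast
  hence e: "young n row col * young n row col = scal c * young n row col"
    unfolding young_def by (simp only: mult.assoc)
  hence "hookprod n row col = c" using lookup_young_0[OF t] by (simp add: hookprod_def lookup_scal)
  thus ?thesis using e by simp
qed

text \<open>Positivity of the square \<open>y\<^sup>* y\<close> at \<open>0\<close>, applied first to the Young symmetrizer and then to
  \<open>rho * kap * rho\<close>, excludes a nilpotent Young symmetrizer.\<close>

lemma hookprod_pos:
  assumes t: "tabl n p row col"
  shows "hookprod n row col > 0"
proof -
  let ?k = "kap n col" and ?r = "rho n row"
  let ?y = "?r * (?k * ?r)"
  have ky: "keys ?y \<subseteq> symm n" by (intro keys_subset_mult keys_kap_symm keys_rho_symm)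
  have sr: "star (young n row col) = ?r * ?k"
    unfolding young_def by (subst star_mult[OF keys_kap_symm keys_rho_symm]) simp
  have sy: "star ?y = ?y"
    using star_mult[OF keys_rho_symm[of n row] keys_young[of n row col]] sr by (simp only: young_def mult.assoc star_rho)
  have "star (young n row col) * young n row col = ?r * (?k * ?k * ?r)"
    unfolding sr by (simp only: young_def mult.assoc)
  also have "\<dots> = scal (card (stab n col)) * ?y"
    by (simp only: kap_mult_kap mult.assoc mult_scal)
  finally have "card (stab n col) * lookup ?y 0 = lookup (star (young n row col) * young n row col) 0"
    by (simp only: lookup_scal)
  also have "\<dots> \<ge> 1" using lookup_star_mult_zero_ge[OF keys_young, of n row col] lookup_young_0[OF t] by simp
  finally have "0 < real (card (stab n col)) * lookup ?y 0" by linarith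
  hence y0: "lookup ?y 0 > 0" by (simp add: zero_less_mult_iff)
  have "?y * ?y = ?r * (?k * ((?r * ?r) * (?k * ?r)))" by (simp only: mult.assoc)
  also have "\<dots> = scal (card (stab n row)) * (?r * (young n row col * young n row col))"
    by (simp only: rho_mult_rho mult.assoc mult_scal young_def)
  also have "\<dots> = scal (card (stab n row)) * (scal (hookprod n row col) * ?y)"
  proof -
    have "?r * (young n row col * young n row col) = scal (hookprod n row col) * (?r * young n row col)"
      by (simp only: young_square[OF t] mult_scal)
    thus ?thesis by (simp only: young_def)
  qed
  finally have "lookup (?y * ?y) 0 = card (stab n row) * (hookprod n row col * lookup ?y 0)"
    by (simp only: lookup_scal)
  moreover have "lookup (?y * ?y) 0 > 0"
  proof -
    have "(lookup ?y 0)\<^sup>2 \<le> lookup (star ?y * ?y) 0" by (rule lookup_star_mult_zero_ge[OF ky])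
    moreover have "(lookup ?y 0)\<^sup>2 > 0" using y0 by simp
    ultimately show ?thesis unfolding sy by linarith
  qed
  ultimately have "0 < real (card (stab n row)) * (hookprod n row col * lookup ?y 0)" by simp
  hence "0 < hookprod n row col * lookup ?y 0" by (simp add: zero_less_mult_iff)
  thus ?thesis using y0 by (simp add: zero_less_mult_iff)
qed

definition chi :: "nat \<Rightarrow> (nat \<Rightarrow> nat) \<Rightarrow> (nat \<Rightarrow> nat) \<Rightarrow> sym \<Rightarrow> real" where
  "chi n row col s = (\<Sum>g\<in>symm n. lookup (young n row col) (- g + s + g)) / hookprod n row col"

text \<open>A sum over conjugates behaves like a trace: replacing \<open>g\<close> by
  \<open>g + - h\<close> moves the factor \<open>x\<close> from the left to the right.\<close>

lemma class_sum_commute: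
  assumes "keys x \<subseteq> symm n" "keys y \<subseteq> symm n"
  shows "(\<Sum>g\<in>symm n. lookup (x * y) (- g + s + g)) = (\<Sum>g\<in>symm n. lookup (y * x) (- g + s + g))"
proof -
  have "(\<Sum>g\<in>symm n. lookup (x * y) (- g + s + g)) = (\<Sum>h\<in>symm n. \<Sum>g\<in>symm n. lookup x h * lookup y (- h + (- g + s + g)))"
    unfolding lookup_mult_sum[OF assms(1) finite_symm] by (rule sum.swap)
  also have "\<dots> = (\<Sum>h\<in>symm n. \<Sum>g\<in>symm n. lookup x h * lookup y (- h + (- (g + - h) + s + (g + - h))))"
    by (intro sum.cong refl sum_symm_translate(2)[symmetric] symm_uminus)
  also have "\<dots> = (\<Sum>h\<in>symm n. \<Sum>g\<in>symm n. lookup y ((- g + s + g) - h) * lookup x h)"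
  proof (intro sum.cong refl)
    fix h g
    have "- h + (- (g + - h) + s + (g + - h)) = (- g + s + g) - h"
      by (simp only: minus_add minus_minus diff_conv_add_uminus add.assoc[symmetric] left_minus add_0)
    thus "lookup x h * lookup y (- h + (- (g + - h) + s + (g + - h))) = lookup y ((- g + s + g) - h) * lookup x h"
      by (simp only: mult.commute)
  qed
  also have "\<dots> = (\<Sum>g\<in>symm n. lookup (y * x) (- g + s + g))"
    unfolding lookup_mult_sum2[OF assms(1) finite_symm] by (rule sum.swap)
  finally show ?thesis .
qed

lemma conj_uminus: "- g + - s + g = - (- g + s + (g::sym))"
  by (simp only: minus_add minus_minus add.assoc)

text \<open>\<open>star\<close> reverses the order of the two factors of the symmetrizer, and a
  class sum does not see this order.\<close>

lemma chi_uminus: "chi n row col (- s) = chi n row col s"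
proof -
  have "(\<Sum>g\<in>symm n. lookup (young n row col) (- g + - s + g)) = (\<Sum>g\<in>symm n. lookup (star (young n row col)) (- g + s + g))"
    unfolding conj_uminus by (simp only: lookup_star)
  also have "\<dots> = (\<Sum>g\<in>symm n. lookup (rho n row * kap n col) (- g + s + g))"
    unfolding young_def by (subst star_mult[OF keys_kap_symm keys_rho_symm]) simp
  also have "\<dots> = (\<Sum>g\<in>symm n. lookup (young n row col) (- g + s + g))"
    unfolding young_def by (rule class_sum_commute[OF keys_rho_symm keys_kap_symm])
  finally show ?thesis by (simp add: chi_def)
qed

lemma chi_conj:
  assumes "h \<in> symm n"
  shows "chi n row col (h + s - h) = chi n row col s"
proof -
  have "(\<Sum>g\<in>symm n. lookup (young n row col) (- g + (h + s - h) + g)) =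
        (\<Sum>g\<in>symm n. lookup (young n row col) (- (h + g) + (h + s - h) + (h + g)))"
    by (rule sum_symm_translate(1)[OF assms, symmetric])
  also have "\<dots> = (\<Sum>g\<in>symm n. lookup (young n row col) (- g + s + g))"
  proof (intro sum.cong refl)
    fix g
    have "- (h + g) + (h + s - h) + (h + g) = - g + s + g"
      by (simp only: minus_add diff_conv_add_uminus add.assoc minus_add_cancel)
    thus "lookup (young n row col) (- (h + g) + (h + s - h) + (h + g)) = lookup (young n row col) (- g + s + g)" by simp
  qed
  finally show ?thesis by (simp add: chi_def)
qed

text \<open>Here \<open>f x\<close> is the image of the point mass at \<open>x\<close> under a
  projection F onto \<open>V\<close>. The trace of \<open>T\<close> on \<open>V\<close> is the
  matrix trace of T F, whichever basis the choice operator picks. The second claim is the case T =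
  id: the trace of a projection is the dimension of its image.\<close>

lemma trace_on_projection:
  fixes f :: "'a \<Rightarrow> 'a \<Rightarrow> complex"
  assumes V: "cfun.subspace V" and X: "finite X"
    and f: "\<And>x. x \<in> X \<Longrightarrow> f x \<in> V"
    and F: "\<And>v. v \<in> V \<Longrightarrow> v = (\<Sum>x\<in>X. cscale (v x) (f x))"
    and T: "\<And>v w. T (v + w) = T v + T w" "\<And>c v. T (cscale c v) = cscale c (T v)" "\<And>v. v \<in> V \<Longrightarrow> T v \<in> V"
    and S: "cfun.independent S" "S \<subseteq> V"
  shows "trace_on V T = (\<Sum>x\<in>X. T (f x) x)"
    and "\<exists>d. (\<Sum>x\<in>X. f x x) = of_nat d \<and> card S \<le> d"
proof -
  define B where "B = (SOME B. cfun.independent B \<and> cfun.span B = V)"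
  obtain B0 where B0: "B0 \<subseteq> V" "cfun.independent B0" "V \<subseteq> cfun.span B0"
    using cfun.maximal_independent_subset[of V] by blast
  have "cfun.span B0 = V" using B0 V by (metis cfun.span_minimal subset_antisym)
  hence B: "cfun.independent B" "cfun.span B = V"
    unfolding B_def using someI[of "\<lambda>B. cfun.independent B \<and> cfun.span B = V"] B0 by auto
  have Vf: "V \<subseteq> cfun.span (f ` X)"
  proof
    fix v assume v: "v \<in> V"
    have "(\<Sum>x\<in>X. cscale (v x) (f x)) \<in> cfun.span (f ` X)"
      by (intro cfun.span_sum cfun.span_scale cfun.span_base) auto
    thus "v \<in> cfun.span (f ` X)" using F[OF v] by simp
  qed
  have "B \<subseteq> V" using B cfun.span_superset by blast
  hence fB: "finite B" using cfun.independent_span_bound[of "f ` X" B] X B Vf by auto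
  have S': "card S \<le> card B" using cfun.independent_span_bound[OF fB S(1)] S(2) B by auto
  \<comment> \<open>Expanding \<open>f x\<close> in the basis \<open>B\<close>, or a basis vector in
    the \<open>f x\<close>, leads to the same double sum. This is tr(A B) = tr(B A) for the two
    changes between \<open>B\<close> and \<open>X\<close>.\<close>
  have gen: "(\<Sum>b\<in>B. cfun.representation B (U b) b) = (\<Sum>x\<in>X. U (f x) x)"
    if U: "\<And>v w. U (v + w) = U v + U w" "\<And>c v. U (cscale c v) = cscale c (U v)" "\<And>v. v \<in> V \<Longrightarrow> U v \<in> V"
    for U :: "('a \<Rightarrow> complex) \<Rightarrow> ('a \<Rightarrow> complex)"
  proof -
    have U0: "U 0 = 0" using U(1)[of 0 0] by (simp add: fun_eq_iff)
    have Usum: "U (\<Sum>i\<in>I. g i) = (\<Sum>i\<in>I. U (g i))" for g and I :: "('a \<Rightarrow> complex) set"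
      by (induction I rule: infinite_finite_induct) (simp_all only: sum.infinite sum.empty sum.insert not_False_eq_True U0 U(1))
    have ev: "(\<Sum>i\<in>I. g i) x = (\<Sum>i\<in>I. g i x)" for g :: "'i \<Rightarrow> 'a \<Rightarrow> complex" and I x
      by (induction I rule: infinite_finite_induct) auto
    have "(\<Sum>x\<in>X. U (f x) x) = (\<Sum>x\<in>X. \<Sum>b\<in>B. cfun.representation B (f x) b * U b x)"
    proof (intro sum.cong refl)
      fix x assume x: "x \<in> X"
      have "f x = (\<Sum>b\<in>B. cscale (cfun.representation B (f x) b) b)"
        using cfun.sum_representation_eq[OF B(1) _ fB subset_refl, of "f x"] f[OF x] B(2) by simp
      hence "U (f x) = (\<Sum>b\<in>B. cscale (cfun.representation B (f x) b) (U b))"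
        by (metis (mono_tags, lifting) U(2) Usum sum.cong)
      thus "U (f x) x = (\<Sum>b\<in>B. cfun.representation B (f x) b * U b x)"
        by (simp add: ev cscale_def)
    qed
    also have "\<dots> = (\<Sum>b\<in>B. \<Sum>x\<in>X. U b x * cfun.representation B (f x) b)"
      by (subst sum.swap) (simp add: mult.commute)
    also have "\<dots> = (\<Sum>b\<in>B. cfun.representation B (U b) b)"
    proof (intro sum.cong refl)
      fix b assume b: "b \<in> B"
      have UV: "U b \<in> V" using b \<open>B \<subseteq> V\<close> U(3) by blast
      have "cfun.representation B (U b) = cfun.representation B (\<Sum>x\<in>X. cscale (U b x) (f x))"
        using F[OF UV] by simp
      also have "\<dots> = (\<lambda>c. \<Sum>x\<in>X. cfun.representation B (cscale (U b x) (f x)) c)"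
        using f B(2) by (intro cfun.representation_sum[OF B(1)]) (metis V cfun.subspace_scale)
      finally have "cfun.representation B (U b) b = (\<Sum>x\<in>X. cfun.representation B (cscale (U b x) (f x)) b)" by simp
      also have "\<dots> = (\<Sum>x\<in>X. U b x * cfun.representation B (f x) b)"
        using f B(2) by (intro sum.cong refl) (simp add: cfun.representation_scale[OF B(1)])
      finally show "(\<Sum>x\<in>X. U b x * cfun.representation B (f x) b) = cfun.representation B (U b) b" by simp
    qed
    finally show ?thesis by simp
  qed
  show "trace_on V T = (\<Sum>x\<in>X. T (f x) x)"
    using gen[OF T] by (simp add: trace_on_def B_def Let_def)
  have "(\<Sum>x\<in>X. f x x) = (\<Sum>b\<in>B. cfun.representation B b b)" using gen[of "\<lambda>v. v"] by simp
  also have "\<dots> = of_nat (card B)" using cfun.representation_basis[OF B(1)] by simp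
  finally show "\<exists>d. (\<Sum>x\<in>X. f x x) = of_nat d \<and> card S \<le> d" using S' by blast
qed

section \<open>Characters of Specht modules\<close>

lemma sum_symm_conj:
  assumes "g \<in> symm n"
  shows "(\<Sum>s\<in>symm n. f (g + s - g)) = (\<Sum>s\<in>symm n. f s)"
proof -
  have "(\<Sum>s\<in>symm n. f (g + s - g)) = (\<Sum>s\<in>symm n. f (g + s + - g))" by simp
  also have "\<dots> = (\<Sum>s\<in>symm n. f (s + - g))"
    by (rule sum_symm_translate(1)[OF assms, of "\<lambda>s. f (s + - g)"])
  also have "\<dots> = (\<Sum>s\<in>symm n. f s)"
    by (rule sum_symm_translate(2)[OF symm_uminus[OF assms]])
  finally show ?thesis .
qed

lemma conj_cancel: "- g + (g + s - g) + g = (s :: sym)"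
  by (simp only: diff_conv_add_uminus add.assoc minus_add_cancel left_minus add_0_right)

text \<open>A class function does not notice the average over conjugates in \<open>chi\<close>, so
  pairing with the character is pairing with the symmetrizer itself.\<close>

lemma chi_pairing:
  assumes "\<And>g s. g \<in> symm n \<Longrightarrow> s \<in> symm n \<Longrightarrow> \<phi> (g + s - g) = \<phi> s"
  shows "(\<Sum>s\<in>symm n. chi n row col s * \<phi> s) = fact n * (\<Sum>s\<in>symm n. lookup (young n row col) s * \<phi> s) / hookprod n row col"
proof -
  let ?e = "young n row col"
  have "(\<Sum>s\<in>symm n. (\<Sum>g\<in>symm n. lookup ?e (- g + s + g)) * \<phi> s) =
        (\<Sum>g\<in>symm n. \<Sum>s\<in>symm n. lookup ?e (- g + s + g) * \<phi> s)"
    by (subst sum.swap) (simp add: sum_distrib_right)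
  also have "\<dots> = (\<Sum>g\<in>symm n. \<Sum>s\<in>symm n. lookup ?e (- g + (g + s - g) + g) * \<phi> (g + s - g))"
    by (intro sum.cong refl sum_symm_conj[symmetric])
  also have "\<dots> = (\<Sum>g\<in>symm n. \<Sum>s\<in>symm n. lookup ?e s * \<phi> s)"
    using assms by (intro sum.cong refl) (simp only: conj_cancel)
  finally have "(\<Sum>s\<in>symm n. (\<Sum>g\<in>symm n. lookup ?e (- g + s + g)) * \<phi> s) = fact n * (\<Sum>s\<in>symm n. lookup ?e s * \<phi> s)"
    by (simp add: card_symm)
  thus ?thesis by (simp add: chi_def sum_divide_distrib[symmetric])
qed

text \<open>\<open>chi_pairing\<close> removes the average from the first factor, and the remaining
  sum over \<open>s\<close> is a coefficient of a product. Orthogonality and norm thus become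
  statements about the products e g e2 of two symmetrizers with a permutation between them.\<close>

lemma sum_chi_chi:
  "(\<Sum>s\<in>symm n. chi n row col s * chi n row2 col2 s) =
   fact n / (hookprod n row col * hookprod n row2 col2) *
   (\<Sum>g\<in>symm n. lookup (young n row col * single g 1 * young n row2 col2) g)"
proof -
  let ?e = "young n row col" and ?e2 = "young n row2 col2"
  have "(\<Sum>s\<in>symm n. lookup ?e s * chi n row2 col2 s) = (\<Sum>s\<in>symm n. lookup ?e s * chi n row2 col2 (- s))"
    by (simp add: chi_uminus)
  also have "\<dots> = (\<Sum>g\<in>symm n. \<Sum>s\<in>symm n. lookup ?e s * lookup ?e2 (- g + - s + g)) / hookprod n row2 col2"
    by (subst sum.swap) (simp add: chi_def sum_divide_distrib sum_distrib_left)
  also have "(\<Sum>g\<in>symm n. \<Sum>s\<in>symm n. lookup ?e s * lookup ?e2 (- g + - s + g)) =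
             (\<Sum>g\<in>symm n. lookup (?e * single g 1 * ?e2) g)"
  proof (intro sum.cong refl)
    fix g
    have "lookup (?e * single g 1 * ?e2) g = lookup (?e * (single g 1 * ?e2 * single (- g) 1)) 0"
      by (simp only: mult.assoc[symmetric] lookup_mult_single) simp
    also have "\<dots> = (\<Sum>s\<in>symm n. lookup ?e s * lookup (single g 1 * ?e2 * single (- g) 1) (- s + 0))"
      by (rule lookup_mult_sum[OF keys_young finite_symm])
    also have "\<dots> = (\<Sum>s\<in>symm n. lookup ?e s * lookup ?e2 (- g + - s + g))"
      by (simp only: lookup_mult_single lookup_single_mult add_0_right diff_minus_eq_add add.assoc mult_1 mult_1_right)
    finally show "(\<Sum>s\<in>symm n. lookup ?e s * lookup ?e2 (- g + - s + g)) = lookup (?e * single g 1 * ?e2) g" by simp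
  qed
  finally show ?thesis
    by (subst chi_pairing) (auto simp: chi_conj)
qed

text \<open>By antisymmetry of dominance, one shape fails to dominate the other. If it is
  \<open>p\<close>, the outer factors \<open>kap n col\<close> and \<open>rho n row2\<close>
  annihilate everything between them; otherwise the adjoint of the inner factor rho g kap vanishes,
  being a sandwich for the opposite pair.\<close>

lemma young_orthogonal:
  assumes t: "tabl n p row col" and t2: "tabl n p2 row2 col2" and ne: "p \<noteq> p2" and g: "g \<in> symm n"
  shows "young n row col * single g 1 * young n row2 col2 = 0"
proof (cases "dominates p p2")
  case True
  hence nd: "\<not> dominates p2 p" using ne dominates_antisym by blast
  have "kap n col2 * single (- g) 1 * rho n row = 0"
    using sandwich_dominates[OF t2 t symm_uminus[OF g]] nd by blast
  moreover have "star (single h 1) = single (- h) 1" for h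
    by (rule poly_mapping_eqI) (auto simp: lookup_star lookup_single when_def)
  moreover have "keys (single h 1) \<subseteq> symm n" if "h \<in> symm n" for h using that by simp
  ultimately have "star (rho n row * single g 1 * kap n col2) = 0"
    using star_mult[OF keys_subset_mult[OF keys_rho_symm] keys_kap_symm, of "single g 1" n row col2]
      star_mult[OF keys_rho_symm, of "single g 1" n row] g by (simp add: mult.assoc)
  hence "star (star (rho n row * single g 1 * kap n col2)) = star 0" by simp
  hence "rho n row * single g 1 * kap n col2 = 0"
    by (simp add: poly_mapping_eqI[of "star 0" 0] lookup_star)
  hence "kap n col * (rho n row * single g 1 * kap n col2) * rho n row2 = 0" by simp
  thus ?thesis by (simp add: young_def mult.assoc)
next
  case False
  have z: "kap n col * single h 1 * rho n row2 = 0" if "h \<in> symm n" for h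
    using sandwich_dominates[OF t t2 that] False by blast
  have k: "keys (rho n row * single g 1 * kap n col2) \<subseteq> symm n" (is "keys ?x \<subseteq> _")
    using g by (intro keys_subset_mult keys_kap_symm keys_rho_symm) auto
  have "kap n col * ?x * rho n row2 = (\<Sum>h\<in>symm n. kap n col * single h (lookup ?x h) * rho n row2)"
    by (subst algebra_expand[OF k]) (simp, simp only: sum_distrib_left sum_distrib_right)
  also have "\<dots> = (\<Sum>h\<in>symm n. scal (lookup ?x h) * (kap n col * single h 1 * rho n row2))"
    by (intro sum.cong refl, subst single_scal) (simp only: mult.assoc mult_scal)
  also have "\<dots> = 0" by (simp add: z)
  finally show ?thesis by (simp only: young_def mult.assoc)
qed

lemma chi_orthogonal:
  assumes "tabl n p row col" "tabl n p2 row2 col2" "p \<noteq> p2"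
  shows "(\<Sum>s\<in>symm n. chi n row col s * chi n row2 col2 s) = 0"
  unfolding sum_chi_chi by (simp add: young_orthogonal[OF assms])

text \<open>Since e g e = c(g) e, where c(g) is the coefficient of e g e at 0, its coefficient at g
  is e(g) c(g). The sum over g is the coefficient of e e e at 0, that is, the square of the hook
  product.\<close>

lemma chi_norm:
  assumes t: "tabl n p row col"
  shows "(\<Sum>s\<in>symm n. chi n row col s * chi n row col s) = fact n"
proof -
  let ?e = "young n row col" and ?h = "hookprod n row col"
  have sw: "?e * single g 1 * ?e = scal (lookup (?e * single g 1 * ?e) 0) * ?e" if "g \<in> symm n" for g
  proof -
    have "keys (rho n row * single g 1 * kap n col) \<subseteq> symm n"
      using that by (intro keys_subset_mult keys_kap_symm keys_rho_symm) auto
    from sandwich_same_algebra[OF t this] obtain c where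
      "kap n col * (rho n row * single g 1 * kap n col) * rho n row = scal c * ?e" unfolding young_def by blast
    hence e: "?e * single g 1 * ?e = scal c * ?e" unfolding young_def by (simp only: mult.assoc)
    thus ?thesis using lookup_young_0[OF t] by (simp add: lookup_scal)
  qed
  have "(\<Sum>g\<in>symm n. lookup (?e * single g 1 * ?e) g) = (\<Sum>g\<in>symm n. lookup ?e g * lookup (?e * single g 1 * ?e) 0)"
  proof (intro sum.cong refl)
    fix g assume "g \<in> symm n"
    thus "lookup (?e * single g 1 * ?e) g = lookup ?e g * lookup (?e * single g 1 * ?e) 0"
      using arg_cong[OF sw, of g "\<lambda>z. lookup z g"] by (simp add: lookup_scal)
  qed
  also have "\<dots> = lookup (\<Sum>g\<in>symm n. scal (lookup ?e g) * (?e * single g 1 * ?e)) 0"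
    by (simp add: lookup_sum lookup_scal)
  also have "(\<Sum>g\<in>symm n. scal (lookup ?e g) * (?e * single g 1 * ?e)) = ?e * ?e * ?e"
  proof -
    have "?e * ?e * ?e = ?e * (\<Sum>g\<in>symm n. single g (lookup ?e g)) * ?e"
      using algebra_expand[OF keys_young finite_symm, of n row col] by simp
    also have "\<dots> = (\<Sum>g\<in>symm n. ?e * single g (lookup ?e g) * ?e)"
      by (simp only: sum_distrib_left sum_distrib_right)
    also have "\<dots> = (\<Sum>g\<in>symm n. scal (lookup ?e g) * (?e * single g 1 * ?e))"
      by (intro sum.cong refl, subst single_scal) (simp only: mult.assoc mult_scal)
    finally show ?thesis ..
  qed
  also have "?e * ?e * ?e = scal (?h * ?h) * ?e"
    by (simp only: young_square[OF t] mult.assoc scal_scal)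
  finally have "(\<Sum>g\<in>symm n. lookup (?e * single g 1 * ?e) g) = ?h * ?h"
    by (simp add: lookup_scal lookup_young_0[OF t])
  thus ?thesis unfolding sum_chi_chi using hookprod_pos[OF t] by simp
qed

text \<open>A common interface for the actions on tabloids, on words and on pairs of words. The
  complex functions on the set acted upon form a module over the group algebra.\<close>

locale sym_action =
  fixes act :: "sym \<Rightarrow> 'x \<Rightarrow> 'x"
  assumes act_zero [simp]: "act 0 y = y" and act_add: "act (g + h) y = act g (act h y)"
begin

lemma act_uminus_cancel [simp]: "act (- g) (act g y) = y" "act g (act (- g) y) = y"
  using act_add[of "- g" g y] act_add[of g "- g" y] by simp_all

definition alg_act :: "nat \<Rightarrow> (sym \<Rightarrow>\<^sub>0 real) \<Rightarrow> ('x \<Rightarrow> complex) \<Rightarrow> ('x \<Rightarrow> complex)" where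
  "alg_act n x v = (\<lambda>y. \<Sum>g\<in>symm n. of_real (lookup x g) * v (act (- g) y))"

lemma alg_act_mult:
  assumes "keys x \<subseteq> symm n"
  shows "alg_act n (x * z) v = alg_act n x (alg_act n z v)"
proof
  fix y
  have "alg_act n (x * z) v y = (\<Sum>g\<in>symm n. \<Sum>h\<in>symm n. of_real (lookup x h) * of_real (lookup z (- h + g)) * v (act (- g) y))"
    by (simp add: alg_act_def lookup_mult_sum[OF assms] sum_distrib_right)
  also have "\<dots> = (\<Sum>h\<in>symm n. \<Sum>g\<in>symm n. of_real (lookup x h) * of_real (lookup z (- h + g)) * v (act (- g) y))"
    by (rule sum.swap)
  also have "\<dots> = (\<Sum>h\<in>symm n. \<Sum>g\<in>symm n. of_real (lookup x h) * of_real (lookup z (- h + (h + g))) * v (act (- (h + g)) y))"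
    by (intro sum.cong refl sum_symm_translate(1)[symmetric])
  also have "\<dots> = alg_act n x (alg_act n z v) y"
    by (simp only: alg_act_def sum_distrib_left mult.assoc minus_add_cancel minus_add act_add)
  finally show "alg_act n (x * z) v y = alg_act n x (alg_act n z v) y" .
qed

lemma alg_act_scal: "alg_act n (scal c * x) v = cscale (of_real c) (alg_act n x v)"
  by (simp add: alg_act_def lookup_scal cscale_def sum_distrib_left mult.assoc)

lemma alg_act_plus: "alg_act n x (v + w) = alg_act n x v + alg_act n x w"
  by (rule ext) (simp add: alg_act_def plus_fun_def distrib_left sum.distrib)

lemma alg_act_cscale: "alg_act n x (cscale c v) = cscale c (alg_act n x v)"
  by (rule ext) (simp add: alg_act_def cscale_def sum_distrib_left algebra_simps)

end

interpretation tabloid_act: sym_action "\<lambda>g (x :: nat \<Rightarrow> nat set). \<lambda>i. app g ` x i"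
  by unfold_locales (auto simp: fun_eq_iff image_image)

lemma tabloid_action_app: "tabloid_action (app g) v = (\<lambda>x. v (\<lambda>i. app (- g) ` x i))"
  by (simp add: tabloid_action_def app_uminus)

section \<open>Partitions as lists and as functions\<close>

definition shape :: "nat list \<Rightarrow> nat \<Rightarrow> nat" where
  "shape lam i = (if i < length lam then lam ! i else 0)"

lemma diagram_dia: "diagram lam = dia (shape lam)"
  by (auto simp: diagram_def dia_def shape_def split: if_splits)

lemma shape_par:
  assumes "lam \<in> partitions n"
  shows "shape lam \<in> par n"
proof -
  have pos: "\<And>x. x \<in> set lam \<Longrightarrow> 1 \<le> x" and s: "sum_list lam = n" and so: "sorted_wrt (\<ge>) lam"
    using assms by (auto simp: partitions_def Suc_le_eq)
  have len: "length lam \<le> n"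
    using sum_list_mono[of lam "\<lambda>_. 1" "\<lambda>x. x"] pos s by (simp add: sum_list_triv)
  have am: "antimono (shape lam)"
    unfolding decseq_Suc_iff using so by (auto simp: shape_def sorted_wrt_iff_nth_less)
  have "sum (shape lam) {..<n} = sum (shape lam) {..<length lam}"
    using len by (intro sum_extend_zero) (auto simp: shape_def)
  also have "\<dots> = n" using s by (simp add: shape_def sum_list_sum_nth atLeast0LessThan)
  finally show ?thesis using am len by (auto simp: par_def shape_def)
qed

lemma shape_bij: "bij_betw shape (partitions n) (par n)"
  unfolding bij_betw_def
proof
  show "inj_on shape (partitions n)"
  proof (rule inj_onI)
    fix a b assume ab: "a \<in> partitions n" "b \<in> partitions n" "shape a = shape b"
    have len: "length l = card {i. shape l i \<noteq> 0}" if "l \<in> partitions n" for l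
    proof -
      have "{i. shape l i \<noteq> 0} = {..<length l}" using that by (auto simp: shape_def partitions_def)
      thus ?thesis by simp
    qed
    have "length a = length b" by (simp only: len[OF ab(1)] len[OF ab(2)] ab(3))
    thus "a = b"
    proof (rule nth_equalityI)
      fix i assume "i < length a"
      thus "a ! i = b ! i" using fun_cong[OF ab(3), of i] \<open>length a = length b\<close> by (simp add: shape_def)
    qed
  qed
  show "shape ` partitions n = par n"
  proof (rule subset_antisym[rotated])
    show "par n \<subseteq> shape ` partitions n"
    proof (rule subsetI)
      fix p assume p: "p \<in> par n"
      define l where "l = card {i. p i \<noteq> 0}"
      have fin: "finite {i. p i \<noteq> 0}"
      proof (rule finite_subset)
        have "i < n" if "p i \<noteq> 0" for i using that par_zero[OF p, of i] by (cases "i < n") auto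
        thus "{i. p i \<noteq> 0} \<subseteq> {..<n}" by blast
      qed simp
      have il: "p i \<noteq> 0 \<longleftrightarrow> i < l" for i
      proof
        assume "p i \<noteq> 0"
        hence "p j \<noteq> 0" if "j \<le> i" for j using par_antimono[OF p that] by linarith
        hence "{..i} \<subseteq> {i. p i \<noteq> 0}" by blast
        hence "card {..i} \<le> l" unfolding l_def using fin by (intro card_mono)
        thus "i < l" by simp
      next
        assume "i < l"
        show "p i \<noteq> 0"
        proof
          assume "p i = 0"
          hence "p j = 0" if "i \<le> j" for j using par_antimono[OF p that] by linarith
          hence "j < i" if "p j \<noteq> 0" for j using that not_less by blast
          hence "{i. p i \<noteq> 0} \<subseteq> {..<i}" by blast
          hence "l \<le> card {..<i}" unfolding l_def by (intro card_mono) auto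
          thus False using \<open>i < l\<close> by simp
        qed
      qed
      have sh: "shape (map p [0..<l]) = p"
      proof
        fix i show "shape (map p [0..<l]) i = p i" using il[of i] by (cases "i < l") (auto simp: shape_def)
      qed
      have "\<not> n < l" using il[of n] par_zero[OF p order_refl] by simp
      hence "l \<le> n" by simp
      have "map p [0..<l] \<in> partitions n"
        unfolding partitions_def
      proof (intro CollectI conjI)
        show "sorted_wrt (\<ge>) (map p [0..<l])"
          using par_antimono[OF p] by (auto simp: sorted_wrt_iff_nth_less)
        show "\<forall>x\<in>set (map p [0..<l]). 0 < x"
        proof
          fix x assume "x \<in> set (map p [0..<l])"
          then obtain i where "i < l" "x = p i" by auto
          thus "0 < x" using il[of i] by simp
        qed
        have "sum p {..<n} = sum p {..<l}" proof (intro sum_extend_zero allI impI \<open>l \<le> n\<close>)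
          fix i assume "l \<le> i" thus "p i = 0" using il[of i] by simp
        qed
        thus "sum_list (map p [0..<l]) = n" using p by (simp add: par_def interv_sum_list_conv_sum_set_nat atLeast0LessThan)
      qed
      from imageI[OF this, of shape] show "p \<in> shape ` partitions n" unfolding sh .
    qed
    show "shape ` partitions n \<subseteq> par n" by (intro image_subsetI shape_par)
  qed
qed

section \<open>Polytabloids and the Specht module\<close>

definition rowof :: "nat list \<Rightarrow> (nat \<times> nat \<Rightarrow> nat) \<Rightarrow> nat \<Rightarrow> nat" where
  "rowof lam T = fst \<circ> inv_into (diagram lam) T"

definition colof :: "nat list \<Rightarrow> (nat \<times> nat \<Rightarrow> nat) \<Rightarrow> nat \<Rightarrow> nat" where
  "colof lam T = snd \<circ> inv_into (diagram lam) T"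

lemma tableau_inv:
  assumes "lam \<in> partitions n" "T \<in> tableaux lam"
  shows "bij_betw (\<lambda>x. (rowof lam T x, colof lam T x)) {..<n} (diagram lam)"
    and "\<And>c. c \<in> diagram lam \<Longrightarrow> rowof lam T (T c) = fst c \<and> colof lam T (T c) = snd c"
    and "\<And>c. c \<in> diagram lam \<Longrightarrow> T c < n"
    and "\<And>x. x < n \<Longrightarrow> T (rowof lam T x, colof lam T x) = x"
    and "\<And>x. x < n \<Longrightarrow> (rowof lam T x, colof lam T x) \<in> diagram lam"
proof -
  have T: "bij_betw T (diagram lam) {..<n}" using assms by (auto simp: tableaux_def partitions_def)
  have e: "(\<lambda>x. (rowof lam T x, colof lam T x)) = inv_into (diagram lam) T"
    by (auto simp: rowof_def colof_def)
  show b: "bij_betw (\<lambda>x. (rowof lam T x, colof lam T x)) {..<n} (diagram lam)"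
    unfolding e using bij_betw_inv_into[OF T] .
  show "rowof lam T (T c) = fst c \<and> colof lam T (T c) = snd c" if "c \<in> diagram lam" for c
    using T that by (simp add: rowof_def colof_def bij_betw_def)
  show "T c < n" if "c \<in> diagram lam" for c using T that by (auto simp: bij_betw_def)
  show "T (rowof lam T x, colof lam T x) = x" if "x < n" for x
    using T that fun_cong[OF e, of x] by (simp add: bij_betw_inv_into_right)
  show "(rowof lam T x, colof lam T x) \<in> diagram lam" if "x < n" for x
    using b that by (auto simp: bij_betw_def)
qed

lemma tabl_tableau:
  assumes "lam \<in> partitions n" "T \<in> tableaux lam"
  shows "tabl n (shape lam) (rowof lam T) (colof lam T)"
  using tableau_inv(1)[OF assms] shape_par[OF assms(1)] by (simp add: tabl_def diagram_dia)

lemma column_stabilizer_eq: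
  assumes "lam \<in> partitions n" "T \<in> tableaux lam"
  shows "column_stabilizer lam T = app ` stab n (colof lam T)"
proof -
  note inv = tableau_inv[OF assms]
  have n: "sum_list lam = n" using assms by (auto simp: partitions_def)
  have C: "{T (i, j) |i. (i, j) \<in> diagram lam} = {x. x < n \<and> colof lam T x = j}" for j
  proof (intro set_eqI iffI)
    fix x assume "x \<in> {T (i, j) |i. (i, j) \<in> diagram lam}"
    then obtain i where "x = T (i, j)" "(i, j) \<in> diagram lam" by blast
    thus "x \<in> {x. x < n \<and> colof lam T x = j}" using inv(2)[of "(i, j)"] inv(3)[of "(i, j)"] by simp
  next
    fix x assume "x \<in> {x. x < n \<and> colof lam T x = j}"
    thus "x \<in> {T (i, j) |i. (i, j) \<in> diagram lam}" using inv(4)[of x] inv(5)[of x] by force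
  qed
  have key: "(\<forall>j. app g ` {x. x < n \<and> colof lam T x = j} = {x. x < n \<and> colof lam T x = j}) \<longleftrightarrow>
             g \<in> stab n (colof lam T)" if g: "g \<in> symm n" for g
  proof
    assume a: "\<forall>j. app g ` {x. x < n \<and> colof lam T x = j} = {x. x < n \<and> colof lam T x = j}"
    have "colof lam T (app g x) = colof lam T x" if "x < n" for x
      using a[rule_format, of "colof lam T x"] that by blast
    thus "g \<in> stab n (colof lam T)" using g by (simp add: stab_def)
  next
    assume "g \<in> stab n (colof lam T)"
    show "\<forall>j. app g ` {x. x < n \<and> colof lam T x = j} = {x. x < n \<and> colof lam T x = j}"
    proof
      fix j
      show "app g ` {x. x < n \<and> colof lam T x = j} = {x. x < n \<and> colof lam T x = j}"
        by (rule endo_inj_surj) (use g \<open>g \<in> stab n (colof lam T)\<close> bij_app[of g] in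
            \<open>auto simp: stab_def intro: inj_on_subset[OF bij_is_inj]\<close>)
    qed
  qed
  show ?thesis
  proof (intro set_eqI iffI)
    fix \<pi> assume p: "\<pi> \<in> column_stabilizer lam T"
    hence "\<pi> \<in> app ` symm n" by (simp add: column_stabilizer_def n app_image_symm)
    then obtain g where g: "g \<in> symm n" "\<pi> = app g" by blast
    thus "\<pi> \<in> app ` stab n (colof lam T)" using p key[OF g(1)] by (simp add: column_stabilizer_def C)
  next
    fix \<pi> assume "\<pi> \<in> app ` stab n (colof lam T)"
    then obtain g where g: "g \<in> stab n (colof lam T)" "\<pi> = app g" by blast
    hence gs: "g \<in> symm n" using stab_subset by blast
    hence "app g permutes {..<n}" by (simp add: symm_def)
    thus "\<pi> \<in> column_stabilizer lam T" using g key[OF gs] by (simp add: column_stabilizer_def C n)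
  qed
qed

lemma tabloid_app: "tabloid lam (app g \<circ> T) = (\<lambda>i. app g ` tabloid lam T i)"
  by (auto simp: tabloid_def fun_eq_iff)

lemma polytabloid_eq:
  assumes "lam \<in> partitions n" "T \<in> tableaux lam"
  shows "polytabloid lam T =
    (\<lambda>t. \<Sum>g\<in>stab n (colof lam T). if (\<lambda>i. app g ` tabloid lam T i) = t then of_real (sgn_sym g) else 0)"
  unfolding polytabloid_def column_stabilizer_eq[OF assms]
  by (intro ext sum.reindex_cong[OF inj_app refl]) (simp add: tabloid_app sgn_sym_def)

text \<open>Conjugation by \<open>g\<close> carries the column stabilizer of \<open>T\<close> to
  that of \<open>T'\<close> and preserves signs.\<close>

lemma polytabloid_translate:
  assumes lam: "lam \<in> partitions n" and T: "T \<in> tableaux lam" "T' \<in> tableaux lam"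
    and g: "g \<in> symm n" and e: "\<And>c. c \<in> diagram lam \<Longrightarrow> T' c = app g (T c)"
  shows "polytabloid lam T' = tabloid_action (app g) (polytabloid lam T)"
proof
  fix t
  have tb: "tabloid lam T' = (\<lambda>i. app g ` tabloid lam T i)"
  proof
    fix i
    show "tabloid lam T' i = app g ` tabloid lam T i"
      unfolding tabloid_def setcompr_eq_image image_image by (intro image_cong refl) (simp add: e)
  qed
  have col: "colof lam T' (app g y) = colof lam T y" if "y < n" for y
  proof -
    have "T' (rowof lam T y, colof lam T y) = app g y"
      using e tableau_inv(4,5)[OF lam T(1) that] by simp
    thus ?thesis using tableau_inv(2)[OF lam T(2) tableau_inv(5)[OF lam T(1) that]] by simp
  qed
  have col': "colof lam T' x = colof lam T (app (- g) x)" if "x < n" for x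
    using col[of "app (- g) x"] that symm_uminus[OF g] by simp
  have "polytabloid lam T' t = (\<Sum>h\<in>stab n (colof lam T'). if (\<lambda>i. app h ` tabloid lam T' i) = t then of_real (sgn_sym h) else 0)"
    by (simp add: polytabloid_eq[OF lam T(2)])
  also have "\<dots> = (\<Sum>h\<in>stab n (colof lam T). if (\<lambda>i. app h ` tabloid lam T i) = (\<lambda>i. app (- g) ` t i) then of_real (sgn_sym h) else 0)"
  proof (rule sum.reindex_bij_witness[of _ "\<lambda>h. g + h + - g" "\<lambda>h. - g + h + g"], goal_cases)
    case (1 h) thus ?case by (simp only: add.assoc add_minus_cancel minus_add_cancel right_minus left_minus add_0_right)
  next
    case (2 h)
    thus ?case using g symm_uminus[OF g] col col' by (auto simp: stab_def symm_add)
  next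
    case (3 h) thus ?case by (simp only: add.assoc add_minus_cancel minus_add_cancel right_minus left_minus add_0_right)
  next
    case (4 h)
    have "app (g + h + - g) x < n" if "x < n" for x
    proof -
      have "h \<in> symm n" using 4 stab_subset by blast
      hence "g + h + - g \<in> symm n" using g by (intro symm_add symm_uminus)
      thus ?thesis using that by (simp only: symm_lt)
    qed
    thus ?case using 4 g symm_uminus[OF g] col' by (auto simp: stab_def symm_add simp del: add_uminus_conv_diff)
  next
    case (5 h)
    have "(\<lambda>i. app (- g + h + g) ` tabloid lam T i) = (\<lambda>i. app (- g) ` t i) \<longleftrightarrow> (\<lambda>i. app h ` tabloid lam T' i) = t"
    proof
      assume a: "(\<lambda>i. app (- g + h + g) ` tabloid lam T i) = (\<lambda>i. app (- g) ` t i)"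
      have "app g ` (app (- g + h + g) ` tabloid lam T i) = app g ` (app (- g) ` t i)" for i
        using fun_cong[OF a, of i] by simp
      thus "(\<lambda>i. app h ` tabloid lam T' i) = t" by (simp add: tb image_image)
    next
      assume "(\<lambda>i. app h ` tabloid lam T' i) = t"
      thus "(\<lambda>i. app (- g + h + g) ` tabloid lam T i) = (\<lambda>i. app (- g) ` t i)" by (auto simp: tb image_image)
    qed
    moreover have "sgn_sym (- g + h + g) = sgn_sym h" by (simp add: sgn_sym_add)
    ultimately show ?case by simp
  qed
  also have "\<dots> = tabloid_action (app g) (polytabloid lam T) t"
    by (simp add: tabloid_action_app polytabloid_eq[OF lam T(1)])
  finally show "polytabloid lam T' t = tabloid_action (app g) (polytabloid lam T) t" .
qed

text \<open>A tableau numbers the cells, so any two of the same shape differ by a permutation of the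
  entries. The Specht module is therefore generated by a single polytabloid.\<close>

lemma polytabloids_orbit:
  assumes lam: "lam \<in> partitions n" and T: "T \<in> tableaux lam"
  shows "polytabloid lam ` tableaux lam = (\<lambda>g. tabloid_action (app g) (polytabloid lam T)) ` symm n"
proof (intro subset_antisym image_subsetI)
  fix T' assume T': "T' \<in> tableaux lam"
  let ?f = "\<lambda>x. T' (rowof lam T x, colof lam T x)"
  have b: "bij_betw T' (diagram lam) {..<n}" using T' lam by (auto simp: tableaux_def partitions_def)
  have "bij_betw ?f {..<n} {..<n}"
    using bij_betw_trans[OF tableau_inv(1)[OF lam T] b] by (simp add: o_def)
  hence "inj_on ?f {..<n}" "?f ` {..<n} \<subseteq> {..<n}" by (simp_all add: bij_betw_def)
  from symI[OF this] obtain g where g: "g \<in> symm n" "\<And>x. x < n \<Longrightarrow> app g x = ?f x" by blast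
  have "T' c = app g (T c)" if "c \<in> diagram lam" for c
    using g(2)[OF tableau_inv(3)[OF lam T that]] tableau_inv(2)[OF lam T that] by simp
  thus "polytabloid lam T' \<in> (\<lambda>g. tabloid_action (app g) (polytabloid lam T)) ` symm n"
    using polytabloid_translate[OF lam T T' g(1)] g(1) by blast
next
  fix g assume g: "g \<in> symm n"
  have "bij_betw (app g) {..<n} {..<n}" using g by (simp add: symm_def permutes_imp_bij)
  moreover have "bij_betw T (diagram lam) {..<n}" using T lam by (auto simp: tableaux_def partitions_def)
  ultimately have mem: "app g \<circ> T \<in> tableaux lam"
    using bij_betw_trans lam by (auto simp: tableaux_def partitions_def)
  have "tabloid_action (app g) (polytabloid lam T) = polytabloid lam (app g \<circ> T)"
    by (rule polytabloid_translate[OF lam T mem g, symmetric]) simp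
  thus "tabloid_action (app g) (polytabloid lam T) \<in> polytabloid lam ` tableaux lam"
    using mem by simp
qed

text \<open>The coefficient of the polytabloid at the tabloid g x0 is the coefficient of the Young
  symmetrizer at g. Hence the relation e e = h e says that every vector v of the Specht module is
  the sum of the translates \<open>E g\<close> with the weights v(g x0) / h. This projection makes
  the trace computable.\<close>

theorem irr_char_chi:
  assumes lam: "lam \<in> partitions n" and T: "T \<in> tableaux lam" and s: "s \<in> symm n"
  shows "irr_char lam (app s) = of_real (chi n (rowof lam T) (colof lam T) s)"
proof -
  define row col where "row = rowof lam T" and "col = colof lam T"
  define x0 where "x0 = tabloid lam T"
  define e where "e = polytabloid lam T"
  define act where "act g x = (\<lambda>i. app g ` x i)" for g and x :: "nat \<Rightarrow> nat set"
  define E where "E g = tabloid_action (app g) e" for g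
  define h where "h = hookprod n row col"
  \<comment> \<open>The basis vector of the tabloid of \<open>T\<close>; the column antisymmetrizer
    sends it to the polytabloid.\<close>
  define \<delta> where "\<delta> y = (if y = x0 then 1 else 0 :: complex)" for y
  let ?V = "specht lam" and ?X = "(\<lambda>g. act g x0) ` symm n" and ?e = "young n row col"
  interpret sym_action act by unfold_locales (auto simp: act_def fun_eq_iff image_image)
  have t: "tabl n (shape lam) row col" unfolding row_def col_def by (rule tabl_tableau[OF lam T])
  have h: "h > 0" unfolding h_def by (rule hookprod_pos[OF t])
  have V: "?V = cfun.span (E ` symm n)"
    unfolding specht_def polytabloids_orbit[OF lam T] E_def e_def ..
  have E_eq: "E g y = e (act (- g) y)" for g y by (simp add: E_def tabloid_action_app act_def)
  have x0: "x0 i = {x. x < n \<and> row x = i}" for i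
    unfolding x0_def tabloid_def row_def
  proof (intro set_eqI iffI)
    fix x assume "x \<in> {T (i, j) |j. (i, j) \<in> diagram lam}"
    then obtain j where "x = T (i, j)" "(i, j) \<in> diagram lam" by blast
    thus "x \<in> {x. x < n \<and> rowof lam T x = i}"
      using tableau_inv(2)[OF lam T, of "(i, j)"] tableau_inv(3)[OF lam T, of "(i, j)"] by simp
  next
    fix x assume "x \<in> {x. x < n \<and> rowof lam T x = i}"
    thus "x \<in> {T (i, j) |j. (i, j) \<in> diagram lam}"
      using tableau_inv(4)[OF lam T, of x] tableau_inv(5)[OF lam T, of x] by force
  qed
  have stab_x0: "act g x0 = x0 \<longleftrightarrow> g \<in> stab n row" if g: "g \<in> symm n" for g
  proof
    assume a: "act g x0 = x0"
    have "row (app g x) = row x" if "x < n" for x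
    proof -
      have "app g x \<in> act g x0 (row x)" using that by (simp add: act_def x0)
      thus ?thesis using a by (simp add: x0)
    qed
    thus "g \<in> stab n row" using g by (simp add: stab_def)
  next
    assume "g \<in> stab n row"
    show "act g x0 = x0"
    proof
      fix i
      show "act g x0 i = x0 i" unfolding act_def x0
        by (rule endo_inj_surj) (use g \<open>g \<in> stab n row\<close> bij_app[of g] in
            \<open>auto simp: stab_def intro: inj_on_subset[OF bij_is_inj]\<close>)
    qed
  qed
  have e_sum: "e y = (\<Sum>g\<in>stab n col. if act g x0 = y then of_real (sgn_sym g) else 0)" for y
    by (simp add: e_def polytabloid_eq[OF lam T] act_def x0_def col_def)
  have eq_iff: "act g x = y \<longleftrightarrow> x = act (- g) y" for g x y by auto
  have e_young: "e (act g x0) = of_real (lookup ?e g)" if g: "g \<in> symm n" for g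
  proof -
    have "e (act g x0) = (\<Sum>p\<in>stab n col. if - p + g \<in> stab n row then of_real (sgn_sym p) else 0)"
      unfolding e_sum
    proof (intro sum.cong refl)
      fix p assume p: "p \<in> stab n col"
      hence ps: "p \<in> symm n" using stab_subset by blast
      have "act p x0 = act g x0 \<longleftrightarrow> act (- p + g) x0 = x0"
        unfolding act_add by (metis act_uminus_cancel)
      also have "\<dots> \<longleftrightarrow> - p + g \<in> stab n row" using ps g by (intro stab_x0) (simp add: symm_add symm_uminus)
      finally show "(if act p x0 = act g x0 then complex_of_real (sgn_sym p) else 0) =
          (if - p + g \<in> stab n row then of_real (sgn_sym p) else 0)" by simp
    qed
    also have "\<dots> = of_real (lookup ?e g)" unfolding lookup_young by (simp add: of_real_sum if_distrib cong: if_cong)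
    finally show ?thesis .
  qed
  have d_rho: "alg_act n (rho n row) \<delta> = cscale (of_nat (card (stab n row))) \<delta>"
  proof
    fix y
    have "alg_act n (rho n row) \<delta> y = (\<Sum>g\<in>symm n. if g \<in> stab n row then \<delta> y else 0)"
      unfolding alg_act_def
    proof (intro sum.cong refl)
      fix g assume g: "g \<in> symm n"
      show "complex_of_real (lookup (rho n row) g) * \<delta> (act (- g) y) = (if g \<in> stab n row then \<delta> y else 0)"
      proof (cases "g \<in> stab n row")
        case True
        hence "act g x0 = x0" using stab_x0[OF g] by simp
        hence "act (- g) y = x0 \<longleftrightarrow> y = x0" by (metis act_uminus_cancel)
        thus ?thesis using True by (simp add: lookup_rho \<delta>_def)
      qed (simp add: lookup_rho)
    qed
    also have "\<dots> = of_nat (card (stab n row)) * \<delta> y"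
      using stab_subset[of n row] by (simp add: sum.If_cases Int_absorb1)
    finally show "alg_act n (rho n row) \<delta> y = cscale (of_nat (card (stab n row))) \<delta> y" by (simp add: cscale_def)
  qed
  have e_kap: "alg_act n (kap n col) \<delta> = e"
  proof
    fix y
    have "alg_act n (kap n col) \<delta> y = (\<Sum>g\<in>symm n. if g \<in> stab n col then (if act g x0 = y then of_real (sgn_sym g) else 0) else 0)"
      unfolding alg_act_def by (intro sum.cong refl) (auto simp: lookup_kap \<delta>_def)
    also have "\<dots> = e y" unfolding e_sum
      by (rule sum.mono_neutral_cong_right) (use stab_subset[of n col] in auto)
    finally show "alg_act n (kap n col) \<delta> y = e y" .
  qed
  have young_d: "alg_act n ?e \<delta> = cscale (of_nat (card (stab n row))) e"
    unfolding young_def alg_act_mult[OF keys_kap_symm] d_rho alg_act_cscale e_kap ..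
  have cR: "card (stab n row) \<noteq> 0" by (metis card_0_eq empty_iff finite_stab stab_zero)
  \<comment> \<open>Both sides of e e = h e are applied to \<open>\<delta>\<close>, on which the
    symmetrizer yields the polytabloid times the order of the row stabilizer. That factor is nonzero
    and cancels.\<close>
  have young_e: "alg_act n ?e e = cscale (of_real h) e"
  proof -
    have "cscale (of_nat (card (stab n row))) (alg_act n ?e e) = alg_act n (?e * ?e) \<delta>"
      unfolding alg_act_mult[OF keys_young] young_d alg_act_cscale ..
    also have "\<dots> = cscale (of_real h) (cscale (of_nat (card (stab n row))) e)"
      unfolding young_square[OF t] alg_act_scal young_d h_def ..
    finally show ?thesis using cR by (auto simp: cscale_def fun_eq_iff)
  qed
  \<comment> \<open>The sum over group elements is grouped by the tabloid g x0, because
    \<open>trace_on_projection\<close> sums over points.\<close>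
  define f where "f y = (\<lambda>z. (\<Sum>g\<in>{g \<in> symm n. act g x0 = y}. E g z) / of_real h)" for y
  have ev: "(\<Sum>i\<in>I. g i) x = (\<Sum>i\<in>I. g i x)" for g :: "'i \<Rightarrow> (nat \<Rightarrow> nat set) \<Rightarrow> complex" and I x
    by (induction I rule: infinite_finite_induct) auto
  have f_alt: "f y = cscale (1 / of_real h) (\<Sum>g\<in>{g \<in> symm n. act g x0 = y}. E g)" for y
    by (rule ext) (simp add: f_def cscale_def ev)
  have Fsum: "(\<Sum>y\<in>?X. cscale (v y) (f y)) z = (\<Sum>g\<in>symm n. v (act g x0) * E g z) / of_real h" for v z
  proof -
    have "(\<Sum>y\<in>?X. cscale (v y) (f y)) z = (\<Sum>y\<in>?X. \<Sum>g\<in>{g \<in> symm n. act g x0 = y}. v (act g x0) * E g z) / of_real h"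
      unfolding ev by (simp add: cscale_def f_def sum_distrib_left sum_divide_distrib)
    also have "(\<Sum>y\<in>?X. \<Sum>g\<in>{g \<in> symm n. act g x0 = y}. v (act g x0) * E g z) = (\<Sum>g\<in>symm n. v (act g x0) * E g z)"
      by (rule sum.image_gen[symmetric]) simp
    finally show ?thesis .
  qed
  have FE: "(\<Sum>g\<in>symm n. E k (act g x0) * E g z) = of_real h * E k z" if k: "k \<in> symm n" for k z
  proof -
    have "(\<Sum>g\<in>symm n. E k (act g x0) * E g z) = (\<Sum>g\<in>symm n. E k (act (k + g) x0) * E (k + g) z)"
      by (rule sum_symm_translate(1)[OF k, symmetric])
    also have "\<dots> = (\<Sum>g\<in>symm n. of_real (lookup ?e g) * e (act (- g) (act (- k) z)))"
      by (intro sum.cong refl) (simp add: E_eq act_add e_young minus_add del: add_uminus_conv_diff)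
    also have "\<dots> = alg_act n ?e e (act (- k) z)" by (simp add: alg_act_def)
    also have "\<dots> = of_real h * E k z" by (simp add: young_e cscale_def E_eq)
    finally show ?thesis .
  qed
  have Fid: "v = (\<Sum>y\<in>?X. cscale (v y) (f y))" if "v \<in> ?V" for v
  proof -
    have "v \<in> cfun.span (E ` symm n)" using that V by simp
    hence "\<forall>z. (\<Sum>g\<in>symm n. v (act g x0) * E g z) = of_real h * v z"
    proof (induction rule: cfun.span_induct_alt)
      case base show ?case by simp
    next
      case (step c x y)
      then obtain k where k: "k \<in> symm n" "x = E k" by blast
      have "(\<Sum>g\<in>symm n. (cscale c x + y) (act g x0) * E g z) =
            c * (\<Sum>g\<in>symm n. E k (act g x0) * E g z) + (\<Sum>g\<in>symm n. y (act g x0) * E g z)" for z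
        by (simp add: k cscale_def plus_fun_def distrib_right sum.distrib sum_distrib_left mult.assoc)
      thus ?case using step FE[OF k(1)] k by (simp add: cscale_def plus_fun_def distrib_left mult.left_commute)
    qed
    thus ?thesis using h by (intro ext) (simp add: Fsum)
  qed
  have fV: "f y \<in> ?V" for y
    unfolding f_alt V by (intro cfun.span_scale cfun.span_sum cfun.span_base) auto
  have act_E: "tabloid_action (app k) (E g) = E (k + g)" for k g
    by (rule ext) (simp add: E_eq tabloid_action_app act_add minus_add act_def[symmetric] del: add_uminus_conv_diff)
  have T1: "tabloid_action (app s) (v + w) = tabloid_action (app s) v + tabloid_action (app s) w" for v w
    by (rule ext) (simp add: tabloid_action_def)
  have T2: "tabloid_action (app s) (cscale c v) = cscale c (tabloid_action (app s) v)" for c v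
    by (rule ext) (simp add: tabloid_action_def cscale_def)
  have T3: "tabloid_action (app s) v \<in> ?V" if "v \<in> ?V" for v
  proof -
    have "v \<in> cfun.span (E ` symm n)" using that V by simp
    thus ?thesis unfolding V
    proof (induction rule: cfun.span_induct_alt)
      case base
      have "tabloid_action (app s) 0 = 0" by (rule ext) (simp add: tabloid_action_def)
      thus ?case by (simp only: cfun.span_zero)
    next
      case (step c x y)
      then obtain k where k: "k \<in> symm n" "x = E k" by blast
      show ?case unfolding T1 T2 k(2) act_E
        by (intro cfun.span_add cfun.span_scale cfun.span_base step) (use k s in \<open>auto simp: symm_add\<close>)
    qed
  qed
  have "irr_char lam (app s) = (\<Sum>y\<in>?X. tabloid_action (app s) (f y) y)"
    unfolding irr_char_def
  proof (rule trace_on_projection(1)[where S = "{}"])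
    show "cfun.subspace ?V" unfolding V by (rule cfun.subspace_span)
  qed (use fV Fid T1 T2 T3 cfun.independent_empty in auto)
  also have "\<dots> = (\<Sum>y\<in>?X. \<Sum>g\<in>{g \<in> symm n. act g x0 = y}. E (s + g) (act g x0)) / of_real h"
    unfolding sum_divide_distrib
  proof (intro sum.cong refl)
    fix y
    have "tabloid_action (app s) (f y) y = (\<Sum>g\<in>{g \<in> symm n. act g x0 = y}. tabloid_action (app s) (E g) y) / of_real h"
      by (simp add: f_def tabloid_action_app)
    thus "tabloid_action (app s) (f y) y = (\<Sum>g\<in>{g \<in> symm n. act g x0 = y}. E (s + g) (act g x0) / of_real h)"
      unfolding act_E by (simp add: sum_divide_distrib)
  qed
  also have "(\<Sum>y\<in>?X. \<Sum>g\<in>{g \<in> symm n. act g x0 = y}. E (s + g) (act g x0)) = (\<Sum>g\<in>symm n. E (s + g) (act g x0))"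
    by (rule sum.image_gen[symmetric]) simp
  \<comment> \<open>The inverse of \<open>s\<close> enters because permutations act on coefficients
    through their inverses; \<open>chi_uminus\<close> removes it at the end.\<close>
  also have "\<dots> = (\<Sum>g\<in>symm n. of_real (lookup ?e (- g + - s + g)))"
  proof (intro sum.cong refl)
    fix g assume g: "g \<in> symm n"
    have "E (s + g) (act g x0) = e (act (- g + - s + g) x0)"
      by (simp only: E_eq act_add minus_add)
    also have "\<dots> = of_real (lookup ?e (- g + - s + g))" by (rule e_young) (intro symm_add symm_uminus g s)
    finally show "E (s + g) (act g x0) = of_real (lookup ?e (- g + - s + g))" .
  qed
  also have "\<dots> / of_real h = of_real (chi n row col (- s))" by (simp add: chi_def h_def)
  finally show ?thesis by (simp add: chi_uminus row_def col_def)
qed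

section \<open>Multiplicities in permutation modules\<close>

definition content :: "nat \<Rightarrow> (nat \<Rightarrow> 'b) \<Rightarrow> 'b multiset" where
  "content n f = image_mset f (mset_set {..<n})"

text \<open>The value 0 from n on is a mere default, which makes each word of length n exactly one
  function.\<close>

definition words :: "nat \<Rightarrow> nat multiset \<Rightarrow> (nat \<Rightarrow> nat) set" where
  "words n a = {f. (\<forall>x\<ge>n. f x = 0) \<and> content n f = a}"

definition word_act :: "sym \<Rightarrow> (nat \<Rightarrow> 'b) \<Rightarrow> (nat \<Rightarrow> 'b)" where
  "word_act g f = f \<circ> app (- g)"

interpretation word_act: sym_action "word_act :: sym \<Rightarrow> (nat \<Rightarrow> nat) \<Rightarrow> _"
  by unfold_locales (auto simp: word_act_def fun_eq_iff minus_add simp del: add_uminus_conv_diff)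

text \<open>The character of the module on words of content \<open>a\<close>. For \<open>a\<close>
  of size n this is the module induced from the trivial representation of a Young subgroup.\<close>

definition perm_char :: "nat \<Rightarrow> nat multiset \<Rightarrow> sym \<Rightarrow> nat" where
  "perm_char n a s = card {f \<in> words n a. word_act s f = f}"

lemma content_shift: "g \<in> symm n \<Longrightarrow> content n (f \<circ> app g) = content n f"
  unfolding content_def by (rule permutes_implies_image_mset_eq[symmetric]) (auto simp: symm_def)

lemma content_word_act: "g \<in> symm n \<Longrightarrow> content n (word_act g f) = content n f"
  unfolding word_act_def by (intro content_shift symm_uminus)

lemma word_act_words:
  assumes "g \<in> symm n"
  shows "word_act g f \<in> words n a \<longleftrightarrow> f \<in> words n a"
proof -
  have "word_act g f \<in> words n a" if "g \<in> symm n" "f \<in> words n a" for g f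
    using that content_word_act[OF that(1), of f] symm_ge[OF symm_uminus[OF that(1)]]
    by (auto simp: words_def word_act_def)
  from this[of g f] this[of "- g" "word_act g f"] show ?thesis
    using assms symm_uminus[OF assms] by (simp only: word_act.act_uminus_cancel) blast
qed

lemma finite_words [simp]: "finite (words n a)"
proof (rule finite_subset)
  show "words n a \<subseteq> {f. \<forall>x. (x \<in> {..<n} \<longrightarrow> f x \<in> set_mset a) \<and> (x \<notin> {..<n} \<longrightarrow> f x = 0)}"
    by (auto simp: words_def content_def)
qed (rule finite_set_of_finite_funs, auto)

lemma words_size: "f \<in> words n a \<Longrightarrow> size a = n"
  by (auto simp: words_def content_def)

lemma perm_char_conj:
  assumes g: "g \<in> symm n"
  shows "perm_char n a (g + s - g) = perm_char n a s"
  unfolding perm_char_def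
proof (rule bij_betw_same_card[of "word_act (- g)"], rule bij_betw_byWitness[of _ "word_act g"])
  show "word_act (- g) ` {f \<in> words n a. word_act (g + s - g) f = f} \<subseteq> {f \<in> words n a. word_act s f = f}"
  proof (rule image_subsetI)
    fix f assume "f \<in> {f \<in> words n a. word_act (g + s - g) f = f}"
    hence f: "f \<in> words n a" "word_act (g + s - g) f = f" by auto
    have "word_act s (word_act (- g) f) = word_act (- g) (word_act (g + s - g) f)"
      by (simp only: diff_conv_add_uminus word_act.act_add word_act.act_uminus_cancel)
    thus "word_act (- g) f \<in> {f \<in> words n a. word_act s f = f}"
      using f word_act_words[OF symm_uminus[OF g]] by simp
  qed
  show "word_act g ` {f \<in> words n a. word_act s f = f} \<subseteq> {f \<in> words n a. word_act (g + s - g) f = f}"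
  proof (rule image_subsetI)
    fix f assume "f \<in> {f \<in> words n a. word_act s f = f}"
    hence f: "f \<in> words n a" "word_act s f = f" by auto
    have "word_act (g + s - g) (word_act g f) = word_act g (word_act s f)"
      by (simp only: diff_conv_add_uminus word_act.act_add word_act.act_uminus_cancel)
    thus "word_act g f \<in> {f \<in> words n a. word_act (g + s - g) f = f}"
      using f word_act_words[OF g] by simp
  qed
qed auto

context sym_action
begin

lemma alg_act_kap: "alg_act n (kap n col) v y = (\<Sum>p\<in>stab n col. of_real (sgn_sym p) * v (act (- p) y))"
  unfolding alg_act_def
  by (rule sum.mono_neutral_cong_right) (use stab_subset[of n col] in \<open>auto simp: lookup_kap\<close>)

lemma alg_act_rho: "alg_act n (rho n row) v y = (\<Sum>q\<in>stab n row. v (act (- q) y))"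
  unfolding alg_act_def
  by (rule sum.mono_neutral_cong_right) (use stab_subset[of n row] in \<open>auto simp: lookup_rho\<close>)

lemma alg_act_young:
  "alg_act n (young n row col) v y =
     (\<Sum>p\<in>stab n col. \<Sum>q\<in>stab n row. of_real (sgn_sym p) * v (act (- q) (act (- p) y)))"
  unfolding young_def alg_act_mult[OF keys_kap_symm] alg_act_kap alg_act_rho
  by (simp add: sum_distrib_left)

end

section \<open>The lower bound for multiplicities\<close>

text \<open>In a vanishing combination let j have least weight among the indices with nonzero
  coefficient. At the point \<open>w j\<close> only the term of j survives.\<close>

lemma triangular_independent:
  fixes u :: "'i \<Rightarrow> 'x \<Rightarrow> complex" and wt :: "'i \<Rightarrow> nat"
  assumes I: "finite I" and diag: "\<And>i. i \<in> I \<Longrightarrow> u i (w i) \<noteq> 0"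
    and tri: "\<And>i j. i \<in> I \<Longrightarrow> j \<in> I \<Longrightarrow> u i (w j) \<noteq> 0 \<Longrightarrow> i = j \<or> wt i < wt j"
  shows "inj_on u I" "cfun.independent (u ` I)"
proof -
  show inj: "inj_on u I"
  proof (rule inj_onI, rule ccontr)
    fix i j assume ij: "i \<in> I" "j \<in> I" "u i = u j" "i \<noteq> j"
    have "u i (w j) \<noteq> 0" "u j (w i) \<noteq> 0" using diag[OF ij(1)] diag[OF ij(2)] ij(3) by auto
    hence "wt i < wt j" "wt j < wt i" using tri[OF ij(1,2)] tri[OF ij(2,1)] ij(4) by auto
    thus False by simp
  qed
  show "cfun.independent (u ` I)"
  proof
    assume "cfun.dependent (u ` I)"
    then obtain c where c: "\<exists>v\<in>u ` I. c v \<noteq> 0" "(\<Sum>v\<in>u ` I. cscale (c v) v) = 0"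
      using cfun.dependent_finite[of "u ` I"] I by auto
    have ev: "(\<Sum>i\<in>J. g i) x = (\<Sum>i\<in>J. g i x)" for g :: "'i \<Rightarrow> 'x \<Rightarrow> complex" and J x
      by (induction J rule: infinite_finite_induct) auto
    have z: "(\<Sum>i\<in>I. c (u i) * u i x) = 0" for x
    proof -
      have "(\<Sum>i\<in>I. cscale (c (u i)) (u i)) = 0"
        using c(2) by (simp only: sum.reindex[OF inj] o_def)
      hence "(\<Sum>i\<in>I. cscale (c (u i)) (u i)) x = 0" by simp
      thus ?thesis by (simp only: ev cscale_def)
    qed
    let ?J = "{i \<in> I. c (u i) \<noteq> 0}"
    obtain k where "k \<in> ?J" using c(1) by blast
    from ex_has_least_nat[of "\<lambda>i. i \<in> ?J", OF this, of wt]
    obtain j where j: "j \<in> ?J" "\<And>i. i \<in> ?J \<Longrightarrow> wt j \<le> wt i" by blast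
    have jI: "j \<in> I" "c (u j) \<noteq> 0" using j(1) by auto
    have "c (u i) * u i (w j) = 0" if i: "i \<in> I - {j}" for i
    proof (cases "c (u i) = 0")
      case False
      hence "\<not> wt i < wt j" using j(2)[of i] i by simp
      hence "u i (w j) = 0" using tri[of i j] i jI by blast
      thus ?thesis by simp
    qed simp
    hence "(\<Sum>i\<in>I - {j}. c (u i) * u i (w j)) = 0" by (intro sum.neutral) blast
    hence "(\<Sum>i\<in>I. c (u i) * u i (w j)) = c (u j) * u j (w j)"
      using sum.remove[OF I jI(1), of "\<lambda>i. c (u i) * u i (w j)"] by simp
    thus False using z[of "w j"] jI diag[OF jI(1)] by simp
  qed
qed

text \<open>The numbers that define the dominance order on fillings: larger values mean that small
  entries stand further up.\<close>

definition corner :: "nat \<Rightarrow> (nat \<Rightarrow> nat) \<Rightarrow> nat \<Rightarrow> nat \<Rightarrow> (nat \<Rightarrow> nat) \<Rightarrow> nat" where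
  "corner n row i k X = card {x \<in> {..<n}. row x < i \<and> X x < k}"

definition tab_word :: "nat \<Rightarrow> (nat \<Rightarrow> nat) \<Rightarrow> (nat \<Rightarrow> nat) \<Rightarrow> (nat \<times> nat \<Rightarrow> nat) \<Rightarrow> (nat \<Rightarrow> nat)" where
  "tab_word n row col T = (\<lambda>x. if x < n then T (row x, col x) else 0)"

lemma tab_word_content:
  assumes t: "tabl n p row col" and T: "T \<in> ssyt p a"
  shows "tab_word n row col T \<in> words n a"
proof -
  have b: "bij_betw (\<lambda>x. (row x, col x)) {..<n} (dia p)" using t by (simp add: tabl_def)
  have "content n (tab_word n row col T) = image_mset (\<lambda>x. T (row x, col x)) (mset_set {..<n})"
    unfolding content_def by (intro image_mset_cong) (auto simp: tab_word_def)
  also have "\<dots> = image_mset T (image_mset (\<lambda>x. (row x, col x)) (mset_set {..<n}))"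
    by (simp add: multiset.map_comp o_def)
  also have "image_mset (\<lambda>x. (row x, col x)) (mset_set {..<n}) = mset_set (dia p)"
    using image_mset_mset_set[of "\<lambda>x. (row x, col x)" "{..<n}"] b by (simp add: bij_betw_def)
  finally show ?thesis using T by (simp add: words_def ssyt_def tab_word_def)
qed

lemma corner_row_shift:
  assumes q: "q \<in> stab n row"
  shows "corner n row i k (X \<circ> app q) = corner n row i k X"
  unfolding corner_def
proof (rule bij_betw_same_card[of "app q"], rule bij_betw_byWitness[of _ "app (- q)"])
  have qs: "q \<in> symm n" "- q \<in> symm n" using q stab_subset symm_uminus by blast+
  have q': "- q \<in> stab n row" using q by simp
  show "app q ` {x \<in> {..<n}. row x < i \<and> (X \<circ> app q) x < k} \<subseteq> {x \<in> {..<n}. row x < i \<and> X x < k}"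
    using q qs by (auto simp: stab_def)
  show "app (- q) ` {x \<in> {..<n}. row x < i \<and> X x < k} \<subseteq> {x \<in> {..<n}. row x < i \<and> (X \<circ> app q) x < k}"
    using q' qs by (auto simp: stab_def)
qed auto

text \<open>In a column-strict filling the entries below \<open>k\<close> sit on top of each column, so permuting
  the columns can only move such entries out of the first \<open>i\<close> rows.\<close>

lemma corner_column:
  assumes t: "tabl n p row col" and U: "U \<in> ssyt p a" and q: "q \<in> stab n col"
  shows "card {x \<in> {..<n}. col x = j \<and> row x < i \<and> tab_word n row col U (app q x) < k} \<le>
         card {x \<in> {..<n}. col x = j \<and> row x < i \<and> tab_word n row col U x < k}"
proof (cases "\<forall>x\<in>{..<n}. col x = j \<and> row x < i \<longrightarrow> tab_word n row col U x < k")
  case True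
  thus ?thesis by (intro card_mono) auto
next
  case False
  then obtain y where y: "y < n" "col y = j" "row y < i" "\<not> U (row y, col y) < k"
    by (auto simp: tab_word_def)
  have qs: "q \<in> symm n" using q stab_subset by blast
  have top: "row z < i" if z: "z < n" "col z = j" "tab_word n row col U z < k" for z
  proof (rule ccontr)
    assume "\<not> row z < i"
    hence "row y < row z" using y by simp
    moreover have "j < p (row z)" using tabl_cell[OF t z(1)] z by simp
    ultimately have "U (row y, j) < U (row z, j)" using U by (auto simp: ssyt_def)
    thus False using y z by (simp add: tab_word_def)
  qed
  have "card {x \<in> {..<n}. col x = j \<and> row x < i \<and> tab_word n row col U (app q x) < k} \<le>
        card {x \<in> {..<n}. col x = j \<and> tab_word n row col U (app q x) < k}"
    by (intro card_mono) auto
  also have "\<dots> \<le> card {x \<in> {..<n}. col x = j \<and> row x < i \<and> tab_word n row col U x < k}"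
  proof (rule card_inj_on_le[of "app q"])
    show "inj_on (app q) {x \<in> {..<n}. col x = j \<and> tab_word n row col U (app q x) < k}"
      by (rule inj_on_subset[OF bij_is_inj[OF bij_app]]) simp
    show "app q ` {x \<in> {..<n}. col x = j \<and> tab_word n row col U (app q x) < k}
        \<subseteq> {x \<in> {..<n}. col x = j \<and> row x < i \<and> tab_word n row col U x < k}"
    proof (rule image_subsetI)
      fix x assume x: "x \<in> {x \<in> {..<n}. col x = j \<and> tab_word n row col U (app q x) < k}"
      hence "col (app q x) = j" "app q x < n" using q qs by (auto simp: stab_def)
      thus "app q x \<in> {x \<in> {..<n}. col x = j \<and> row x < i \<and> tab_word n row col U x < k}"
        using x top[of "app q x"] by simp
    qed
  qed simp
  finally show ?thesis .
qed

lemma corner_column_le: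
  assumes t: "tabl n p row col" and U: "U \<in> ssyt p a" and q: "q \<in> stab n col"
  shows "corner n row i k (tab_word n row col U \<circ> app q) \<le> corner n row i k (tab_word n row col U)"
  unfolding corner_def card_by_columns[OF t, of "\<lambda>x. row x < i \<and> _ x"]
  unfolding card_by_columns[OF t, of "\<lambda>x. row x < i \<and> (tab_word n row col U \<circ> app q) x < k"]
    card_by_columns[OF t, of "\<lambda>x. row x < i \<and> tab_word n row col U x < k"]
  by (intro sum_mono) (use corner_column[OF t U q] in simp)

text \<open>Equality in the sum over columns is equality in each column. Differences in
  \<open>i\<close> and all thresholds \<open>k\<close> show that every cell keeps its entry, and
  entries of a column are distinct, so nothing has moved.\<close>

lemma corner_column_eq:
  assumes t: "tabl n p row col" and U: "U \<in> ssyt p a" and q: "q \<in> stab n col"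
    and eq: "\<And>i k. corner n row i k (tab_word n row col U \<circ> app q) = corner n row i k (tab_word n row col U)"
  shows "q = 0"
proof (rule sym_eqI)
  let ?w = "tab_word n row col U"
  have qs: "q \<in> symm n" using q stab_subset by blast
  have colwise: "card {x \<in> {..<n}. col x = j \<and> row x < i \<and> (?w \<circ> app q) x < k} =
                 card {x \<in> {..<n}. col x = j \<and> row x < i \<and> ?w x < k}" if j: "j \<in> col ` {..<n}" for i j k
  proof (rule sum_mono_inv[of "\<lambda>j. card {x \<in> {..<n}. col x = j \<and> row x < i \<and> (?w \<circ> app q) x < k}" "col ` {..<n}"
        "\<lambda>j. card {x \<in> {..<n}. col x = j \<and> row x < i \<and> ?w x < k}" j])
    show "(\<Sum>j\<in>col ` {..<n}. card {x \<in> {..<n}. col x = j \<and> row x < i \<and> (?w \<circ> app q) x < k}) =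
          (\<Sum>j\<in>col ` {..<n}. card {x \<in> {..<n}. col x = j \<and> row x < i \<and> ?w x < k})"
      using eq[of i k] unfolding corner_def
      unfolding card_by_columns[OF t, of "\<lambda>x. row x < i \<and> (?w \<circ> app q) x < k"]
        card_by_columns[OF t, of "\<lambda>x. row x < i \<and> ?w x < k"] .
    show "card {x \<in> {..<n}. col x = j \<and> row x < i \<and> (?w \<circ> app q) x < k} \<le>
          card {x \<in> {..<n}. col x = j \<and> row x < i \<and> ?w x < k}" for j
      using corner_column[OF t U q] by simp
  qed (use j in auto)
  fix x
  show "app q x = app 0 x"
  proof (cases "x < n")
    case x: True
    have cell: "{y \<in> {..<n}. col y = col x \<and> row y < Suc (row x) \<and> P y} =
          {y \<in> {..<n}. col y = col x \<and> row y < row x \<and> P y} \<union> (if P x then {x} else {})" for P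
      using tabl_inj[OF t _ x] x by (auto simp: less_Suc_eq)
    have cc: "card {y \<in> {..<n}. col y = col x \<and> row y < Suc (row x) \<and> P y} =
          card {y \<in> {..<n}. col y = col x \<and> row y < row x \<and> P y} + (if P x then 1 else 0)" for P
      unfolding cell by (subst card_Un_disjoint) auto
    have "?w (app q x) < k \<longleftrightarrow> ?w x < k" for k
      using colwise[of "col x" "Suc (row x)" k] colwise[of "col x" "row x" k] x
      unfolding cc[of "\<lambda>y. (?w \<circ> app q) y < k"] cc[of "\<lambda>y. ?w y < k"] by (auto split: if_splits)
    hence w: "?w (app q x) = ?w x" by (metis nat_neq_iff)
    have y: "app q x < n" "col (app q x) = col x" using q qs x by (auto simp: stab_def)
    have "row (app q x) = row x"
    proof (rule ccontr)
      assume "row (app q x) \<noteq> row x"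
      hence "U (row (app q x), col x) < U (row x, col x) \<or> U (row x, col x) < U (row (app q x), col x)"
        using U tabl_cell[OF t x] tabl_cell[OF t y(1)] y(2) by (auto simp: ssyt_def nat_neq_iff)
      thus False using w x y by (auto simp: tab_word_def)
    qed
    thus ?thesis using tabl_inj[OF t y(1) x] y by simp
  next
    case False
    thus ?thesis using symm_ge[OF qs] by simp
  qed
qed

text \<open>Differences in \<open>i\<close> count the entries below \<open>k\<close> in a single
  row, and an increasing row is determined by these counts. Only finitely many pairs of
  \<open>i\<close> and \<open>k\<close> are compared, so that they can be added up to a
  weight.\<close>

lemma corner_determines:
  assumes t: "tabl n p row col" and T: "T \<in> ssyt p a" and U: "U \<in> ssyt p a" and L: "set_mset a \<subseteq> {..<L}"
    and eq: "\<And>i k. i \<le> n \<Longrightarrow> k \<le> L \<Longrightarrow> corner n row i k (tab_word n row col T) = corner n row i k (tab_word n row col U)"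
  shows "T = U"
proof
  fix c :: "nat \<times> nat"
  obtain i j where c: "c = (i, j)" by (cases c)
  have p: "p \<in> par n" using t by (simp add: tabl_def)
  show "T c = U c"
  proof (cases "j < p i")
    case False
    thus ?thesis using T U by (auto simp: ssyt_def extensional_def dia_def c)
  next
    case True
    have i: "i < n" using par_zero[OF p, of i] True by (cases "i < n") auto
    have rowcount: "corner n row (Suc i) k (tab_word n row col S) = corner n row i k (tab_word n row col S) + card {j. j < p i \<and> S (i, j) < k}" for S k
    proof -
      have "{x \<in> {..<n}. row x < Suc i \<and> tab_word n row col S x < k} =
            {x \<in> {..<n}. row x < i \<and> tab_word n row col S x < k} \<union> {x \<in> {..<n}. row x = i \<and> tab_word n row col S x < k}"
        by auto
      hence "corner n row (Suc i) k (tab_word n row col S) =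
            corner n row i k (tab_word n row col S) + card {x \<in> {..<n}. row x = i \<and> tab_word n row col S x < k}"
        unfolding corner_def by (subst card_Un_disjoint[symmetric]) auto
      also have "card {x \<in> {..<n}. row x = i \<and> tab_word n row col S x < k} = card {j. j < p i \<and> S (i, j) < k}"
      proof (rule bij_betw_same_card[of col])
        show "bij_betw col {x \<in> {..<n}. row x = i \<and> tab_word n row col S x < k} {j. j < p i \<and> S (i, j) < k}"
          unfolding bij_betw_def
        proof
          show "inj_on col {x \<in> {..<n}. row x = i \<and> tab_word n row col S x < k}"
          proof (rule inj_onI)
            fix x y
            assume "x \<in> {x \<in> {..<n}. row x = i \<and> tab_word n row col S x < k}"
              "y \<in> {x \<in> {..<n}. row x = i \<and> tab_word n row col S x < k}" "col x = col y"
            thus "x = y" using tabl_inj[OF t, of x y] by simp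
          qed
          show "col ` {x \<in> {..<n}. row x = i \<and> tab_word n row col S x < k} = {j. j < p i \<and> S (i, j) < k}"
          proof (intro subset_antisym subsetI)
            fix j assume "j \<in> {j. j < p i \<and> S (i, j) < k}"
            moreover from this obtain x where "x < n" "row x = i" "col x = j" using tabl_surj[OF t, of j i] by blast
            ultimately show "j \<in> col ` {x \<in> {..<n}. row x = i \<and> tab_word n row col S x < k}"
              by (intro image_eqI[of _ _ x]) (auto simp: tab_word_def)
          next
            fix j assume "j \<in> col ` {x \<in> {..<n}. row x = i \<and> tab_word n row col S x < k}"
            then obtain x where "x < n" "row x = i" "tab_word n row col S x < k" "j = col x" by auto
            thus "j \<in> {j. j < p i \<and> S (i, j) < k}" using tabl_cell[OF t, of x] by (simp add: tab_word_def)
          qed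
        qed
      qed
      finally show ?thesis .
    qed
    have lt: "T (i, j) < k \<longleftrightarrow> U (i, j) < k" if k: "k \<le> L" for k
    proof -
      have "card {j. j < p i \<and> T (i, j) < k} = card {j. j < p i \<and> U (i, j) < k}"
        using eq[of "Suc i" k] eq[of i k] rowcount[of k T] rowcount[of k U] i k by simp
      moreover have "S (i, j) < k \<longleftrightarrow> j < card {j. j < p i \<and> S (i, j) < k}" if "S \<in> ssyt p a" for S
        using that True by (intro dia_restrict_less[of "p i" "\<lambda>j. S (i, j)"]) (auto simp: ssyt_def)
      ultimately show ?thesis using T U by simp
    qed
    have bnd: "S (i, j) < L" if "S \<in> ssyt p a" for S
    proof -
      have "(i, j) \<in> dia p" using True by (simp add: dia_def)
      hence "S (i, j) \<in># a" using that finite_dia[OF p] by (auto simp: ssyt_def)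
      thus ?thesis using L by auto
    qed
    show ?thesis unfolding c
      using lt[of "Suc (T (i, j))"] lt[of "Suc (U (i, j))"] bnd[OF T] bnd[OF U] by auto
  qed
qed

lemma multiplicity_ge:
  assumes t: "tabl n p row col"
  shows "real (card (ssyt p a)) \<le> (\<Sum>s\<in>symm n. chi n row col s * perm_char n a s) / fact n"
proof -
  let ?e = "young n row col" and ?X = "words n a" and ?w = "tab_word n row col" and ?A = "word_act.alg_act n (young n row col)"
  define h where "h = hookprod n row col"
  have h: "h > 0" unfolding h_def by (rule hookprod_pos[OF t])
  have p: "p \<in> par n" using t by (simp add: tabl_def)
  define \<delta> :: "(nat \<Rightarrow> nat) \<Rightarrow> (nat \<Rightarrow> nat) \<Rightarrow> complex" where "\<delta> f y = (if y = f then 1 else 0)" for f y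
  define u where "u T = ?A (\<delta> (?w T))" for T
  define f where "f y = cscale (1 / of_real h) (?A (\<delta> y))" for y
  define V where "V = cfun.span ((\<lambda>y. ?A (\<delta> y)) ` ?X)"
  obtain L where L: "set_mset a \<subseteq> {..<L}" using finite_nat_set_iff_bounded[of "set_mset a"] by auto
  \<comment> \<open>A linear extension of the dominance order: the sum is strictly monotone because
    the corner numbers in this range determine the tableau.\<close>
  define wt where "wt T = (\<Sum>(i, k)\<in>{..n} \<times> {..L}. corner n row i k (?w T))" for T
  have act: "word_act (- q) (word_act (- r) f) = f \<circ> app r \<circ> app q" for q r and f :: "nat \<Rightarrow> nat"
    by (simp add: word_act_def)
  have u_eq: "u T y = (\<Sum>r\<in>stab n col. \<Sum>q\<in>stab n row. of_real (sgn_sym r) * \<delta> (?w T) (y \<circ> app r \<circ> app q))" for T y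
    unfolding u_def word_act.alg_act_young act ..
  have corner_le: "corner n row i k (?w T) = corner n row i k (?w U \<circ> app r)"
    if "?w U \<circ> app r \<circ> app q = ?w T" "q \<in> stab n row" for T U r q i k
    using corner_row_shift[OF that(2), of i k "?w U \<circ> app r"] that(1) by simp
  \<comment> \<open>A nonzero value at the word of \<open>U\<close> means that the word of
    \<open>T\<close> arises from it by a column permutation, which can only lower the corner
    numbers, followed by a row permutation, which preserves them.\<close>
  have tri: "T = U \<or> wt T < wt U" if T: "T \<in> ssyt p a" and U: "U \<in> ssyt p a" and nz: "u T (?w U) \<noteq> 0" for T U
  proof -
    obtain r where r: "r \<in> stab n col" "(\<Sum>q\<in>stab n row. of_real (sgn_sym r) * \<delta> (?w T) (?w U \<circ> app r \<circ> app q)) \<noteq> 0"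
      using nz unfolding u_eq by (meson sum.neutral)
    then obtain q where q: "q \<in> stab n row" "of_real (sgn_sym r) * \<delta> (?w T) (?w U \<circ> app r \<circ> app q) \<noteq> 0"
      by (meson sum.neutral)
    have e: "?w U \<circ> app r \<circ> app q = ?w T" using q(2) by (auto simp: \<delta>_def split: if_splits)
    have le: "corner n row i k (?w T) \<le> corner n row i k (?w U)" for i k
      using corner_le[OF e q(1)] corner_column_le[OF t U r(1)] by simp
    show ?thesis
    proof (cases "T = U")
      case False
      then obtain i k where ik: "i \<le> n" "k \<le> L" "corner n row i k (?w T) \<noteq> corner n row i k (?w U)"
        using corner_determines[OF t T U L] by blast
      have "wt T < wt U" unfolding wt_def
      proof (rule sum_strict_mono_ex1)
        show "\<forall>x\<in>{..n} \<times> {..L}. (case x of (i, k) \<Rightarrow> corner n row i k (?w T)) \<le> (case x of (i, k) \<Rightarrow> corner n row i k (?w U))"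
          using le by auto
        have "corner n row i k (?w T) < corner n row i k (?w U)" using le[of i k] ik(3) by simp
        thus "\<exists>x\<in>{..n} \<times> {..L}. (case x of (i, k) \<Rightarrow> corner n row i k (?w T)) < (case x of (i, k) \<Rightarrow> corner n row i k (?w U))"
          using ik(1,2) by (intro bexI[of _ "(i, k)"]) auto
      qed simp
      thus ?thesis by simp
    qed simp
  qed
  \<comment> \<open>There is no cancellation on the diagonal: by \<open>corner_column_eq\<close>
    only the trivial column permutation contributes, and its sign is +1.\<close>
  have diag: "u T (?w T) \<noteq> 0" if T: "T \<in> ssyt p a" for T
  proof -
    have "r = 0" if "r \<in> stab n col" "q \<in> stab n row" "?w T \<circ> app r \<circ> app q = ?w T" for r q
      using corner_le[OF that(3,2)] by (intro corner_column_eq[OF t T that(1)]) simp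
    hence z: "\<delta> (?w T) (?w T \<circ> app r \<circ> app q) = 0" if "r \<in> stab n col - {0}" "q \<in> stab n row" for r q
      using that by (auto simp: \<delta>_def)
    have "u T (?w T) = (\<Sum>r\<in>{0}. \<Sum>q\<in>stab n row. of_real (sgn_sym r) * \<delta> (?w T) (?w T \<circ> app r \<circ> app q))"
      unfolding u_eq by (rule sum.mono_neutral_right) (use z in auto)
    also have "\<dots> = of_nat (card {q \<in> stab n row. ?w T \<circ> app q = ?w T})"
      by (simp add: \<delta>_def sum.If_cases Int_def)
    also have "\<dots> \<noteq> 0"
    proof -
      have "0 \<in> {q \<in> stab n row. ?w T \<circ> app q = ?w T}" by simp
      moreover have "finite {q \<in> stab n row. ?w T \<circ> app q = ?w T}" by simp
      ultimately have "card {q \<in> stab n row. ?w T \<circ> app q = ?w T} \<noteq> 0" using card_0_eq by blast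
      thus ?thesis by simp
    qed
    finally show ?thesis .
  qed
  note fin = finite_ssyt[OF p, of a]
  note ind = triangular_independent[of "ssyt p a" u ?w wt, OF fin diag tri]
  have VD: "v \<in> V \<Longrightarrow> ?A v = cscale (of_real h) v \<and> (\<forall>y. y \<notin> ?X \<longrightarrow> v y = 0)" for v
    unfolding V_def
  proof (induction rule: cfun.span_induct_alt)
    case base
    show ?case by (auto simp: word_act.alg_act_def cscale_def fun_eq_iff)
  next
    case (step c x y)
    then obtain y0 where y0: "y0 \<in> ?X" "x = ?A (\<delta> y0)" by blast
    have x1: "?A x = cscale (of_real h) x"
      unfolding y0(2) word_act.alg_act_mult[OF keys_young, symmetric] young_square[OF t] word_act.alg_act_scal h_def ..
    have x2: "x z = 0" if "z \<notin> ?X" for z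
    proof -
      have "\<delta> y0 (word_act (- g) z) = 0" if "g \<in> symm n" for g
        using word_act_words[OF symm_uminus[OF that], of z a] \<open>z \<notin> ?X\<close> y0(1) by (auto simp: \<delta>_def)
      thus ?thesis by (simp add: y0(2) word_act.alg_act_def)
    qed
    have "?A (cscale c x + y) = cscale c (cscale (of_real h) x) + cscale (of_real h) y"
      by (simp only: word_act.alg_act_plus word_act.alg_act_cscale x1 conjunct1[OF step(2)])
    also have "\<dots> = cscale (of_real h) (cscale c x + y)"
      by (simp only: cfun.scale_right_distrib cfun.scale_left_commute[of c])
    finally have "?A (cscale c x + y) = cscale (of_real h) (cscale c x + y)" .
    moreover have "(cscale c x + y) z = 0" if "z \<notin> ?X" for z
      using x2[OF that] step(2) that by (simp add: cscale_def)
    ultimately show ?case by blast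
  qed
  have ev: "(\<Sum>i\<in>I. g i) x = (\<Sum>i\<in>I. g i x)" for g :: "'i \<Rightarrow> (nat \<Rightarrow> nat) \<Rightarrow> complex" and I x
    by (induction I rule: infinite_finite_induct) auto
  have F: "v = (\<Sum>y\<in>?X. cscale (v y) (f y))" if v: "v \<in> V" for v
  proof
    fix z
    have dv: "(\<Sum>y\<in>?X. v y * \<delta> y x) = v x" for x
    proof (cases "x \<in> ?X")
      case True
      have "(\<Sum>y\<in>?X. v y * \<delta> y x) = (\<Sum>y\<in>?X. if y = x then v x else 0)"
        by (intro sum.cong) (auto simp: \<delta>_def)
      thus ?thesis using True by simp
    next
      case False
      hence "(\<Sum>y\<in>?X. v y * \<delta> y x) = 0" by (intro sum.neutral) (auto simp: \<delta>_def)
      thus ?thesis using False VD[OF v] by simp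
    qed
    have "(\<Sum>y\<in>?X. cscale (v y) (f y)) z = (\<Sum>y\<in>?X. \<Sum>g\<in>symm n. of_real (lookup ?e g) * (v y * \<delta> y (word_act (- g) z))) / of_real h"
      unfolding ev by (simp add: f_def cscale_def word_act.alg_act_def sum_distrib_left sum_divide_distrib mult.left_commute)
    also have "(\<Sum>y\<in>?X. \<Sum>g\<in>symm n. of_real (lookup ?e g) * (v y * \<delta> y (word_act (- g) z))) = ?A v z"
      unfolding word_act.alg_act_def by (subst sum.swap) (simp add: sum_distrib_left[symmetric] dv)
    also have "\<dots> / of_real h = v z" using VD[OF v] h by (simp add: cscale_def)
    finally show "v z = (\<Sum>y\<in>?X. cscale (v y) (f y)) z" by simp
  qed
  have S: "u ` ssyt p a \<subseteq> V"
    unfolding u_def V_def using tab_word_content[OF t] by (intro image_subsetI cfun.span_base) auto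
  have fV: "f y \<in> V" if "y \<in> ?X" for y
    unfolding f_def V_def using that by (intro cfun.span_scale cfun.span_base) auto
  have "cfun.subspace V" unfolding V_def by (rule cfun.subspace_span)
  from trace_on_projection(2)[of V ?X f "\<lambda>v. v", OF this finite_words fV F _ _ _ ind(2) S]
  obtain d where d: "(\<Sum>y\<in>?X. f y y) = of_nat d" "card (u ` ssyt p a) \<le> d" by auto
  \<comment> \<open>A permutation contributes to the diagonal entry at \<open>y\<close> exactly if
    it fixes the word \<open>y\<close>, which brings in the permutation character.\<close>
  have "(\<Sum>y\<in>?X. f y y) = (\<Sum>y\<in>?X. \<Sum>g\<in>symm n. of_real (lookup ?e g) * (if word_act g y = y then 1 else 0)) / of_real h"
    unfolding sum_divide_distrib
  proof (intro sum.cong refl)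
    fix y :: "nat \<Rightarrow> nat"
    have "word_act (- g) y = y \<longleftrightarrow> word_act g y = y" for g
    proof
      assume a: "word_act (- g) y = y"
      show "word_act g y = y" using word_act.act_uminus_cancel(2)[of g y] unfolding a .
    next
      assume a: "word_act g y = y"
      show "word_act (- g) y = y" using word_act.act_uminus_cancel(1)[of g y] unfolding a .
    qed
    thus "f y y = (\<Sum>g\<in>symm n. of_real (lookup ?e g) * (if word_act g y = y then 1 else 0) / of_real h)"
      by (simp add: f_def cscale_def word_act.alg_act_def \<delta>_def sum_divide_distrib)
  qed
  also have "\<dots> = of_real ((\<Sum>g\<in>symm n. lookup ?e g * perm_char n a g) / h)"
    by (subst sum.swap) (simp add: sum_distrib_left[symmetric] perm_char_def sum.If_cases Int_def)
  also have "(\<Sum>g\<in>symm n. lookup ?e g * perm_char n a g) / h = (\<Sum>s\<in>symm n. chi n row col s * perm_char n a s) / fact n"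
    using chi_pairing[of n "\<lambda>s. real (perm_char n a s)" row col] by (simp add: perm_char_conj h_def)
  finally have "(of_nat d :: complex) = of_real ((\<Sum>s\<in>symm n. chi n row col s * perm_char n a s) / fact n)"
    using d(1) by simp
  hence "real d = (\<Sum>s\<in>symm n. chi n row col s * perm_char n a s) / fact n"
    by (metis of_real_eq_iff of_real_of_nat_eq)
  thus ?thesis using d(2) card_image[OF ind(1)] by simp
qed

section \<open>Counting orbits\<close>

text \<open>Burnside's count for a single orbit. Each point y is fixed by as many elements as send
  \<open>y0\<close> to y, and the latter sets partition the group.\<close>

lemma (in sym_action) transitive_burnside:
  assumes O: "finite O'" "y0 \<in> O'" "\<And>y. y \<in> O' \<Longrightarrow> \<exists>g\<in>symm n. act g y0 = y" "\<And>g. g \<in> symm n \<Longrightarrow> act g y0 \<in> O'"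
  shows "(\<Sum>s\<in>symm n. card {y \<in> O'. act s y = y}) = fact n"
proof -
  have "(\<Sum>s\<in>symm n. card {y \<in> O'. act s y = y}) = (\<Sum>s\<in>symm n. \<Sum>y\<in>O'. if act s y = y then 1 else 0)"
    using O(1) by (simp add: sum.If_cases Int_def)
  also have "\<dots> = (\<Sum>y\<in>O'. card {s \<in> symm n. act s y = y})"
    by (subst sum.swap) (simp add: sum.If_cases Int_def)
  also have "\<dots> = (\<Sum>y\<in>O'. card {s \<in> symm n. act s y0 = y})"
  proof (intro sum.cong refl)
    fix y assume "y \<in> O'"
    then obtain g where g: "g \<in> symm n" "act g y0 = y" using O(3) by blast
    have g': "act (- g) y = y0" using g(2) by auto
    show "card {s \<in> symm n. act s y = y} = card {s \<in> symm n. act s y0 = y}"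
    proof (rule bij_betw_same_card[of "\<lambda>s. s + g"], rule bij_betw_byWitness[of _ "\<lambda>s. s + - g"])
      show "(\<lambda>s. s + g) ` {s \<in> symm n. act s y = y} \<subseteq> {s \<in> symm n. act s y0 = y}"
        using g by (auto simp: act_add symm_add)
      show "(\<lambda>s. s + - g) ` {s \<in> symm n. act s y0 = y} \<subseteq> {s \<in> symm n. act s y = y}"
        using g g' by (auto simp: act_add symm_add symm_uminus simp del: add_uminus_conv_diff)
    qed (auto simp: add.assoc)
  qed
  also have "\<dots> = (\<Sum>y\<in>O'. \<Sum>s\<in>{s \<in> symm n. act s y0 = y}. 1)" by simp
  also have "\<dots> = (\<Sum>s\<in>symm n. 1)" using O by (intro sum.group) auto
  finally show ?thesis by (simp add: card_symm)
qed

definition pair_act :: "sym \<Rightarrow> (nat \<Rightarrow> nat) \<times> (nat \<Rightarrow> nat) \<Rightarrow> (nat \<Rightarrow> nat) \<times> (nat \<Rightarrow> nat)" where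
  "pair_act g y = (word_act g (fst y), word_act g (snd y))"

interpretation pair_act: sym_action pair_act
  by unfold_locales (auto simp: pair_act_def word_act.act_add)

text \<open>The product of the characters counts fixed pairs of words. Two pairs lie in one orbit
  exactly if their joint contents agree, so the orbits are the matrices with margins
  \<open>a\<close> and \<open>b\<close>.\<close>

lemma sum_perm_char_perm_char:
  assumes a: "size a = n" and b: "size b = n"
  shows "(\<Sum>s\<in>symm n. perm_char n a s * perm_char n b s) =
         fact n * card {A. image_mset fst A = a \<and> image_mset snd A = b}"
proof -
  let ?M = "{A :: (nat \<times> nat) multiset. image_mset fst A = a \<and> image_mset snd A = b}"
  let ?W = "words n a \<times> words n b"
  define ct where "ct y = content n (\<lambda>x. (fst y x, snd y x))" for y :: "(nat \<Rightarrow> nat) \<times> (nat \<Rightarrow> nat)"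
  have ct_fst: "image_mset fst (ct y) = content n (fst y)" "image_mset snd (ct y) = content n (snd y)" for y
    by (simp_all add: ct_def content_def multiset.map_comp o_def)
  have real: "\<exists>y\<in>?W. ct y = A" if A: "A \<in> ?M" for A
  proof -
    obtain xs where xs: "mset xs = A" using ex_mset by blast
    have sA: "size A = n" using A a by auto
    hence len: "length xs = n" using xs by auto
    define y where "y = (\<lambda>x. if x < n then fst (xs ! x) else 0, \<lambda>x. if x < n then snd (xs ! x) else 0)"
    have "ct y = image_mset (\<lambda>x. xs ! x) (mset_set {..<n})"
      unfolding ct_def content_def y_def by (intro image_mset_cong) auto
    also have "\<dots> = mset (map (\<lambda>x. xs ! x) [0..<n])" by (simp add: atLeast0LessThan)
    also have "\<dots> = A" using len xs by (metis map_nth)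
    finally have c: "ct y = A" .
    have "y \<in> ?W" using ct_fst[of y] c A by (auto simp: words_def y_def)
    thus ?thesis using c by blast
  qed
  have ctM: "ct y \<in> ?M" if "y \<in> ?W" for y
    using that ct_fst[of y] by (auto simp: words_def)
  have "?M = ct ` ?W"
  proof
    show "?M \<subseteq> ct ` ?W"
    proof
      fix A assume "A \<in> ?M"
      from real[OF this] show "A \<in> ct ` ?W" by blast
    qed
    show "ct ` ?W \<subseteq> ?M" by (rule image_subsetI) (rule ctM)
  qed
  hence finM: "finite ?M" by (metis finite_SigmaI finite_imageI finite_words)
  have orbit: "(\<Sum>s\<in>symm n. card {y \<in> {y \<in> ?W. ct y = A}. pair_act s y = y}) = fact n" if A: "A \<in> ?M" for A
  proof -
    obtain y0 where y0: "y0 \<in> ?W" "ct y0 = A" using real[OF A] by blast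
    show ?thesis
    proof (rule pair_act.transitive_burnside[of _ y0])
      show "finite {y \<in> ?W. ct y = A}" by simp
      show "y0 \<in> {y \<in> ?W. ct y = A}" using y0 by simp
      show "pair_act g y0 \<in> {y \<in> ?W. ct y = A}" if g: "g \<in> symm n" for g
      proof -
        have "ct (pair_act g y0) = content n (word_act g (\<lambda>x. (fst y0 x, snd y0 x)))"
          by (simp add: ct_def pair_act_def word_act_def o_def)
        also have "\<dots> = A" using content_word_act[OF g, of "\<lambda>x. (fst y0 x, snd y0 x)"] y0(2) by (simp add: ct_def)
        finally show ?thesis using y0 word_act_words[OF g] by (auto simp: pair_act_def)
      qed
      show "\<exists>g\<in>symm n. pair_act g y0 = y" if y: "y \<in> {y \<in> ?W. ct y = A}" for y
      proof -
        have "image_mset (\<lambda>x. (fst y x, snd y x)) (mset_set {..<n}) = image_mset (\<lambda>x. (fst y0 x, snd y0 x)) (mset_set {..<n})"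
          using y y0(2) by (simp add: ct_def content_def)
        from image_mset_eq_implies_permutes[OF _ this] obtain \<pi> where
          pi: "\<pi> permutes {..<n}" "\<forall>x\<in>{..<n}. (fst y x, snd y x) = (fst y0 (\<pi> x), snd y0 (\<pi> x))" by auto
        have "\<pi> \<in> app ` symm n" using pi(1) by (simp add: app_image_symm)
        then obtain k where k: "k \<in> symm n" "\<pi> = app k" by blast
        have "word_act (- k) (fst y0) = fst y"
        proof
          fix x show "word_act (- k) (fst y0) x = fst y x"
            using pi(2) k y y0(1) symm_ge[OF k(1), of x] by (cases "x < n") (auto simp: word_act_def words_def)
        qed
        moreover have "word_act (- k) (snd y0) = snd y"
        proof
          fix x show "word_act (- k) (snd y0) x = snd y x"
            using pi(2) k y y0(1) symm_ge[OF k(1), of x] by (cases "x < n") (auto simp: word_act_def words_def)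
        qed
        ultimately show ?thesis using symm_uminus[OF k(1)] by (intro bexI[of _ "- k"]) (auto simp: pair_act_def)
      qed
    qed
  qed
  have "perm_char n a s * perm_char n b s = (\<Sum>A\<in>?M. card {y \<in> {y \<in> ?W. ct y = A}. pair_act s y = y})" for s
  proof -
    have "perm_char n a s * perm_char n b s = card {y \<in> ?W. pair_act s y = y}"
      unfolding perm_char_def card_cartesian_product[symmetric]
      by (rule arg_cong[of _ _ card]) (auto simp: pair_act_def)
    also have "\<dots> = (\<Sum>y\<in>{y \<in> ?W. pair_act s y = y}. 1)" by simp
    also have "\<dots> = (\<Sum>A\<in>?M. \<Sum>y\<in>{y \<in> {y \<in> ?W. pair_act s y = y}. ct y = A}. 1)"
      by (rule sum.group[symmetric]) (use finM ctM in auto)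
    also have "\<dots> = (\<Sum>A\<in>?M. card {y \<in> {y \<in> ?W. ct y = A}. pair_act s y = y})"
      by (intro sum.cong refl) (simp, rule arg_cong[of _ _ card], auto)
    finally show ?thesis .
  qed
  hence "(\<Sum>s\<in>symm n. perm_char n a s * perm_char n b s) =
        (\<Sum>A\<in>?M. \<Sum>s\<in>symm n. card {y \<in> {y \<in> ?W. ct y = A}. pair_act s y = y})"
    by (simp only:) (rule sum.swap)
  also have "\<dots> = (\<Sum>A\<in>?M. fact n)" by (intro sum.cong refl orbit)
  finally show ?thesis by simp
qed

section \<open>Young's rule and completeness\<close>

text \<open>The character is taken from an arbitrary tableau of the shape. Independence of this
  choice is a consequence of completeness; see \<open>chi_eq_pchar\<close>.\<close>

definition pchar :: "nat \<Rightarrow> (nat \<Rightarrow> nat) \<Rightarrow> sym \<Rightarrow> real" where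
  "pchar n p = (let rc = SOME rc. tabl n p (fst rc) (snd rc) in chi n (fst rc) (snd rc))"

lemma pchar_tabl:
  assumes "p \<in> par n"
  obtains row col where "tabl n p row col" "pchar n p = chi n row col"
proof -
  obtain row col where "tabl n p row col" using tabl_exists[OF assms] .
  hence "tabl n p (fst (row, col)) (snd (row, col))" by simp
  from someI[of "\<lambda>rc. tabl n p (fst rc) (snd rc)", OF this]
  show thesis using that unfolding pchar_def Let_def by blast
qed

lemma pchar_orthonormal:
  assumes "p \<in> par n" "q \<in> par n"
  shows "(\<Sum>s\<in>symm n. pchar n p s * pchar n q s) = (if p = q then fact n else 0)"
proof -
  obtain row col where t: "tabl n p row col" "pchar n p = chi n row col" using pchar_tabl[OF assms(1)] .
  obtain row2 col2 where t2: "tabl n q row2 col2" "pchar n q = chi n row2 col2" using pchar_tabl[OF assms(2)] .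
  show ?thesis
  proof (cases "p = q")
    case True
    have "(\<Sum>s\<in>symm n. pchar n p s * pchar n p s) = fact n" unfolding t(2) by (rule chi_norm[OF t(1)])
    thus ?thesis using True by simp
  next
    case False
    thus ?thesis using chi_orthogonal[OF t(1) t2(1)] by (simp add: t(2) t2(2))
  qed
qed

lemma pchar_conj: "g \<in> symm n \<Longrightarrow> pchar n p (g + s - g) = pchar n p s"
  by (simp add: pchar_def Let_def chi_conj)

lemma pchar_expansion_coeff:
  assumes "\<And>s. s \<in> symm n \<Longrightarrow> \<phi> s = (\<Sum>p\<in>par n. c p * pchar n p s)" "q \<in> par n"
  shows "(\<Sum>s\<in>symm n. pchar n q s * \<phi> s) = fact n * c q"
proof -
  have "(\<Sum>s\<in>symm n. pchar n q s * \<phi> s) = (\<Sum>s\<in>symm n. \<Sum>p\<in>par n. c p * (pchar n q s * pchar n p s))"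
    using assms(1) by (intro sum.cong refl) (simp add: sum_distrib_left mult.left_commute)
  also have "\<dots> = (\<Sum>p\<in>par n. c p * (if q = p then fact n else 0))"
    by (subst sum.swap) (simp add: sum_distrib_left[symmetric] pchar_orthonormal assms(2))
  also have "\<dots> = (\<Sum>p\<in>par n. if p = q then fact n * c q else 0)"
    by (intro sum.cong) auto
  finally show ?thesis using assms(2) by simp
qed

text \<open>Bessel's inequality for the permutation character against the lower bound for its
  multiplicities; the Cauchy identity forces equality.\<close>

lemma young_rule:
  assumes a: "size a = n"
  shows "\<And>s. s \<in> symm n \<Longrightarrow> real (perm_char n a s) = (\<Sum>p\<in>par n. card (ssyt p a) * pchar n p s)"
    and "\<And>p. p \<in> par n \<Longrightarrow> (\<Sum>s\<in>symm n. pchar n p s * perm_char n a s) = fact n * card (ssyt p a)"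
proof -
  define N where "N p = (\<Sum>s\<in>symm n. pchar n p s * perm_char n a s) / fact n" for p
  define k where "k p = real (card (ssyt p a))" for p
  have kN: "k p \<le> N p" if p: "p \<in> par n" for p
  proof -
    obtain row col where "tabl n p row col" "pchar n p = chi n row col" using pchar_tabl[OF p] .
    thus ?thesis using multiplicity_ge[of n p row col a] by (simp add: k_def N_def)
  qed
  obtain L where L: "set_mset a \<subseteq> {..<L}" using finite_nat_set_iff_bounded[of "set_mset a"] by auto
  have "(\<Sum>p\<in>par n. kostka p a L * kostka p a L) = card {A. image_mset fst A = a \<and> image_mset snd A = a}"
    by (rule kostka_cauchy[OF L L a a])
  moreover have "kostka p a L = card (ssyt p a)" if "p \<in> par n" for p
    using card_ssyt[OF L, of p] that a by simp
  ultimately have "(\<Sum>p\<in>par n. card (ssyt p a) * card (ssyt p a)) = card {A. image_mset fst A = a \<and> image_mset snd A = a}"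
    by simp
  hence "(\<Sum>s\<in>symm n. perm_char n a s * perm_char n a s) = fact n * (\<Sum>p\<in>par n. card (ssyt p a) * card (ssyt p a))"
    using sum_perm_char_perm_char[OF a a] by simp
  hence "real (\<Sum>s\<in>symm n. perm_char n a s * perm_char n a s) = real (fact n * (\<Sum>p\<in>par n. card (ssyt p a) * card (ssyt p a)))"
    by (simp only:)
  hence PP: "(\<Sum>s\<in>symm n. (real (perm_char n a s))\<^sup>2) = fact n * (\<Sum>p\<in>par n. (k p)\<^sup>2)"
    by (simp add: k_def power2_eq_square)
  \<comment> \<open>The orthogonal projection of the permutation character to the span of the
    irreducible ones. That its distance from the permutation character is 0 is the first
    claim.\<close>
  define R where "R s = (\<Sum>p\<in>par n. N p * pchar n p s)" for s
  have PR: "(\<Sum>s\<in>symm n. R s * perm_char n a s) = fact n * (\<Sum>p\<in>par n. (N p)\<^sup>2)"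
  proof -
    have "(\<Sum>s\<in>symm n. R s * perm_char n a s) = (\<Sum>p\<in>par n. N p * (\<Sum>s\<in>symm n. pchar n p s * perm_char n a s))"
      unfolding R_def sum_distrib_right sum_distrib_left by (subst sum.swap) (simp add: mult.assoc)
    also have "\<dots> = (\<Sum>p\<in>par n. fact n * (N p)\<^sup>2)"
      by (intro sum.cong refl) (simp add: N_def power2_eq_square)
    finally show ?thesis by (simp add: sum_distrib_left)
  qed
  have RR: "(\<Sum>s\<in>symm n. R s * R s) = fact n * (\<Sum>p\<in>par n. (N p)\<^sup>2)"
  proof -
    have "R s * R s = (\<Sum>p\<in>par n. N p * (pchar n p s * R s))" for s
      by (subst (1) R_def) (simp add: sum_distrib_right mult.assoc)
    hence "(\<Sum>s\<in>symm n. R s * R s) = (\<Sum>p\<in>par n. N p * (\<Sum>s\<in>symm n. pchar n p s * R s))"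
      unfolding sum_distrib_left by (subst sum.swap) simp
    also have "\<dots> = (\<Sum>p\<in>par n. N p * (fact n * N p))"
      by (intro sum.cong refl arg_cong2[of _ _ _ _ times] pchar_expansion_coeff) (simp_all add: R_def)
    finally show ?thesis by (simp add: sum_distrib_left power2_eq_square mult.left_commute)
  qed
  have sq: "(\<Sum>s\<in>symm n. (perm_char n a s - R s)\<^sup>2) = fact n * ((\<Sum>p\<in>par n. (k p)\<^sup>2) - (\<Sum>p\<in>par n. (N p)\<^sup>2))"
  proof -
    have "(\<Sum>s\<in>symm n. (perm_char n a s - R s)\<^sup>2) =
          (\<Sum>s\<in>symm n. (real (perm_char n a s))\<^sup>2) - 2 * (\<Sum>s\<in>symm n. R s * perm_char n a s) + (\<Sum>s\<in>symm n. R s * R s)"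
      by (simp add: power2_diff sum.distrib sum_subtractf sum_distrib_left power2_eq_square algebra_simps)
    thus ?thesis unfolding PP PR RR by (simp add: algebra_simps)
  qed
  have kN2: "(k p)\<^sup>2 \<le> (N p)\<^sup>2" if "p \<in> par n" for p
    using kN[OF that] by (intro power_mono) (auto simp: k_def)
  hence le: "(\<Sum>p\<in>par n. (k p)\<^sup>2) \<le> (\<Sum>p\<in>par n. (N p)\<^sup>2)" by (intro sum_mono)
  have ge: "0 \<le> (\<Sum>s\<in>symm n. (perm_char n a s - R s)\<^sup>2)" by (intro sum_nonneg) auto
  have "0 \<le> (\<Sum>p\<in>par n. (k p)\<^sup>2) - (\<Sum>p\<in>par n. (N p)\<^sup>2)"
  proof (rule ccontr)
    assume "\<not> ?thesis"
    hence "fact n * ((\<Sum>p\<in>par n. (k p)\<^sup>2) - (\<Sum>p\<in>par n. (N p)\<^sup>2)) < 0"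
      by (intro mult_pos_neg) auto
    thus False using ge unfolding sq by linarith
  qed
  hence e: "(\<Sum>p\<in>par n. (k p)\<^sup>2) = (\<Sum>p\<in>par n. (N p)\<^sup>2)" using le by simp
  have kN': "k p = N p" if p: "p \<in> par n" for p
  proof -
    have "(k p)\<^sup>2 = (N p)\<^sup>2"
      by (rule sum_mono_inv[of "\<lambda>p. (k p)\<^sup>2" "par n" "\<lambda>p. (N p)\<^sup>2", OF e kN2 p]) auto
    moreover have k0: "0 \<le> k p" by (simp add: k_def)
    ultimately show ?thesis using order_trans[OF k0 kN[OF p]] by (rule power2_eq_imp_eq)
  qed
  show "(\<Sum>s\<in>symm n. pchar n p s * perm_char n a s) = fact n * card (ssyt p a)" if "p \<in> par n" for p
    using kN'[OF that] by (simp add: k_def N_def field_simps)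
  have "(\<Sum>s\<in>symm n. (perm_char n a s - R s)\<^sup>2) = 0" unfolding sq e by simp
  hence "\<forall>s\<in>symm n. (perm_char n a s - R s)\<^sup>2 = 0" by (subst (asm) sum_nonneg_eq_0_iff) auto
  thus "real (perm_char n a s) = (\<Sum>p\<in>par n. card (ssyt p a) * pchar n p s)" if "s \<in> symm n" for s
    using that kN' by (simp add: R_def k_def cong: sum.cong)
qed

text \<open>On words with distinct letters the group acts freely, so the character is a multiple of
  the regular one.\<close>

lemma perm_char_regular:
  assumes "s \<in> symm n"
  shows "perm_char n (mset_set {..<n}) s = (if s = 0 then card (words n (mset_set {..<n})) else 0)"
    and "card (words n (mset_set {..<n})) \<noteq> 0"
proof -
  have inj: "inj_on f {..<n}" if "f \<in> words n (mset_set {..<n})" for f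
  proof -
    have "image_mset f (mset_set {..<n}) = mset_set {..<n}" using that by (simp add: words_def content_def)
    hence "f ` {..<n} = {..<n}" by (metis finite_lessThan finite_set_mset_mset_set set_image_mset)
    thus ?thesis by (simp add: finite_surj_inj)
  qed
  have "s = 0" if f: "f \<in> words n (mset_set {..<n})" "word_act s f = f" for f
  proof -
    have "- s = 0"
    proof (rule sym_eqI)
      fix x
      have "f (app (- s) x) = f x" using fun_cong[OF f(2), of x] by (simp add: word_act_def)
      thus "app (- s) x = app 0 x"
        using inj[OF f(1)] symm_ge[OF symm_uminus[OF assms], of x] symm_lt[OF symm_uminus[OF assms], of x]
        by (cases "x < n") (auto simp: inj_on_def)
    qed
    thus ?thesis by simp
  qed
  thus "perm_char n (mset_set {..<n}) s = (if s = 0 then card (words n (mset_set {..<n})) else 0)"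
    by (auto simp: perm_char_def)
  have "(\<lambda>x. if x < n then x else 0) \<in> words n (mset_set {..<n})"
  proof -
    have "image_mset (\<lambda>x. if x < n then x else 0) (mset_set {..<n}) = image_mset (\<lambda>x. x) (mset_set {..<n})"
      by (intro image_mset_cong) auto
    thus ?thesis by (simp add: words_def content_def)
  qed
  thus "card (words n (mset_set {..<n})) \<noteq> 0" by (metis card_0_eq empty_iff finite_words)
qed

text \<open>A class function, viewed as a central element of the group algebra, multiplies each Young
  symmetrizer by a scalar.\<close>

lemma pchar_complete:
  assumes \<phi>: "\<And>g s. g \<in> symm n \<Longrightarrow> s \<in> symm n \<Longrightarrow> \<phi> (g + s - g) = \<phi> s"
  shows "\<exists>c. \<forall>s\<in>symm n. \<phi> s = (\<Sum>p\<in>par n. c p * pchar n p s)"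
proof -
  define z where "z = (\<Sum>g\<in>symm n. single g (\<phi> g))"
  have lz: "lookup z g = (if g \<in> symm n then \<phi> g else 0)" for g by (simp add: z_def lookup_elt_sum)
  have kz: "keys z \<subseteq> symm n" by (auto simp: in_keys_iff lz split: if_splits)
  have zg: "z * single h 1 = single h 1 * z" if h: "h \<in> symm n" for h
  proof (rule poly_mapping_eqI)
    fix g
    have mem: "g - h \<in> symm n \<longleftrightarrow> - h + g \<in> symm n"
    proof -
      have "g \<in> symm n" if "g - h \<in> symm n \<or> - h + g \<in> symm n"
        using that symm_add[of "g - h" n h] symm_add[of h n "- h + g"] h by (auto simp: add.assoc[symmetric])
      moreover have "g - h \<in> symm n \<and> - h + g \<in> symm n" if "g \<in> symm n"
        using that symm_add[of g n "- h"] symm_add[of "- h" n g] symm_uminus[OF h] by simp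
      ultimately show ?thesis by blast
    qed
    have "\<phi> (g - h) = \<phi> (- h + g)" if "- h + g \<in> symm n"
    proof -
      have "h + (- h + g) - h = g - h" by (simp add: add.assoc[symmetric])
      thus ?thesis using \<phi>[OF h that] by simp
    qed
    thus "lookup (z * single h 1) g = lookup (single h 1 * z) g"
      using mem by (simp add: lookup_mult_single lookup_single_mult lz)
  qed
  have zx: "z * x = x * z" if x: "keys x \<subseteq> symm n" for x
  proof -
    have "z * x = (\<Sum>g\<in>symm n. z * single g (lookup x g))"
      by (subst algebra_expand[OF x]) (simp_all add: sum_distrib_left)
    also have "\<dots> = (\<Sum>g\<in>symm n. single g (lookup x g) * z)"
    proof (intro sum.cong refl)
      fix g assume g: "g \<in> symm n"
      have "z * single g (lookup x g) = scal (lookup x g) * (z * single g 1)"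
        by (subst single_scal) (rule mult_scal)
      also have "\<dots> = single g (lookup x g) * z"
        unfolding zg[OF g] by (simp only: mult.assoc[symmetric] mult_single add_0 mult_1_right)
      finally show "z * single g (lookup x g) = single g (lookup x g) * z" .
    qed
    also have "\<dots> = x * z"
      by (subst (2) algebra_expand[OF x]) (simp_all add: sum_distrib_right)
    finally show ?thesis .
  qed
  have "\<exists>X c. (\<forall>s. lookup X s = pchar n p s) \<and> keys X \<subseteq> symm n \<and> z * X = scal c * X" if p: "p \<in> par n" for p
  proof -
    obtain row col where t: "tabl n p row col" and e: "pchar n p = chi n row col" using pchar_tabl[OF p] .
    let ?e = "young n row col" and ?h = "hookprod n row col"
    have h: "?h > 0" by (rule hookprod_pos[OF t])
    have "keys (z * (rho n row * kap n col)) \<subseteq> symm n"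
      by (intro keys_subset_mult kz keys_rho_symm keys_kap_symm)
    from sandwich_same_algebra[OF t this] obtain c where
      c: "kap n col * (z * (rho n row * kap n col)) * rho n row = scal c * ?e" unfolding young_def by blast
    have "scal ?h * (z * ?e) = z * (?e * ?e)" by (simp only: young_square[OF t] mult_scal)
    also have "\<dots> = (z * kap n col) * (rho n row * kap n col) * rho n row" by (simp only: young_def mult.assoc)
    also have "\<dots> = scal c * ?e" unfolding zx[OF keys_kap_symm] c[symmetric] by (simp only: mult.assoc)
    finally have "scal (1 / ?h) * (scal ?h * (z * ?e)) = scal (1 / ?h) * (scal c * ?e)" by simp
    hence ze: "z * ?e = scal (c / ?h) * ?e" using h by (simp add: scal_scal)
    \<comment> \<open>The character as an element of the group algebra. Being a sum of conjugates of
      the symmetrizer, it is multiplied by the central \<open>z\<close> with the same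
      scalar.\<close>
    define X where "X = scal (1 / ?h) * (\<Sum>g\<in>symm n. single g 1 * ?e * single (- g) 1)"
    have lX: "lookup X s = pchar n p s" for s
      by (simp add: X_def lookup_scal lookup_sum lookup_mult_single lookup_single_mult e chi_def add.assoc)
    have kX: "keys X \<subseteq> symm n"
    proof
      fix s assume "s \<in> keys X"
      hence "pchar n p s \<noteq> 0" by (simp add: in_keys_iff lX)
      then obtain g where g: "g \<in> symm n" "lookup ?e (- g + s + g) \<noteq> 0"
        unfolding e chi_def by (metis (no_types, lifting) div_0 sum.neutral)
      hence "- g + s + g \<in> symm n" using keys_young[of n row col] by (auto simp: in_keys_iff)
      from symm_add[OF symm_add[OF g(1) this] symm_uminus[OF g(1)]]
      have "g + (- g + s + g) + - g \<in> symm n" .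
      thus "s \<in> symm n" by (simp only: add.assoc right_minus add_0_right add_minus_cancel)
    qed
    have "z * X = scal (1 / ?h) * (\<Sum>g\<in>symm n. single g 1 * (z * ?e) * single (- g) 1)"
    proof -
      have "z * (single g 1 * ?e * single (- g) 1) = single g 1 * (z * ?e) * single (- g) 1" if "g \<in> symm n" for g
        using zg[OF that] by (metis mult.assoc)
      thus ?thesis unfolding X_def mult_scal by (simp add: sum_distrib_left)
    qed
    also have "\<dots> = scal (c / ?h) * X"
    proof -
      have "single g 1 * (z * ?e) * single (- g) 1 = scal (c / ?h) * (single g 1 * ?e * single (- g) 1)" for g
        unfolding ze mult_scal by (simp only: mult.assoc)
      hence "(\<Sum>g\<in>symm n. single g 1 * (z * ?e) * single (- g) 1) = scal (c / ?h) * (\<Sum>g\<in>symm n. single g 1 * ?e * single (- g) 1)"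
        by (simp add: sum_distrib_left)
      thus ?thesis unfolding X_def by (simp add: scal_scal mult.commute)
    qed
    finally show ?thesis using lX kX by blast
  qed
  then obtain X c where X: "\<And>p s. p \<in> par n \<Longrightarrow> lookup (X p) s = pchar n p s"
    "\<And>p. p \<in> par n \<Longrightarrow> keys (X p) \<subseteq> symm n" "\<And>p. p \<in> par n \<Longrightarrow> z * X p = scal (c p) * X p"
    by metis
  define W where "W = real (card (words n (mset_set {..<n})))"
  have W: "W \<noteq> 0" using perm_char_regular(2)[of 0 n] by (simp add: W_def)
  define k where "k p = real (card (ssyt p (mset_set {..<n})))" for p
  \<comment> \<open>Young's rule for the regular character writes a nonzero multiple of the identity
    as a combination of characters. Multiplying this equation by \<open>z\<close> expands
    \<open>z\<close> in characters.\<close>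
  have "scal W = (\<Sum>p\<in>par n. scal (k p) * X p)"
  proof (rule poly_mapping_eqI)
    fix s
    show "lookup (scal W) s = lookup (\<Sum>p\<in>par n. scal (k p) * X p) s"
    proof (cases "s \<in> symm n")
      case True
      have "real (perm_char n (mset_set {..<n}) s) = (\<Sum>p\<in>par n. k p * pchar n p s)"
        using young_rule(1)[of "mset_set {..<n}" n s] True by (simp add: k_def)
      moreover have "lookup (scal W) s = real (perm_char n (mset_set {..<n}) s)"
        unfolding perm_char_regular(1)[OF True] lookup_single when_def W_def by (cases "s = 0") simp_all
      moreover have "lookup (\<Sum>p\<in>par n. scal (k p) * X p) s = (\<Sum>p\<in>par n. k p * pchar n p s)"
        unfolding lookup_sum lookup_scal by (intro sum.cong refl) (simp only: X(1))
      ultimately show ?thesis by (simp only:)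
    next
      case False
      hence "lookup (X p) s = 0" if "p \<in> par n" for p using X(2)[OF that] by (auto simp: in_keys_iff)
      moreover have "s \<noteq> 0" using False by auto
      ultimately show ?thesis by (simp add: lookup_sum lookup_scal lookup_single when_def)
    qed
  qed
  hence "z * scal W = (\<Sum>p\<in>par n. scal (k p) * (z * X p))"
    by (simp only: sum_distrib_left mult_scal)
  hence "scal W * z = (\<Sum>p\<in>par n. scal (k p) * (scal (c p) * X p))"
    unfolding scal_commute[of W z] by (simp only: X(3) cong: sum.cong)
  hence eq: "lookup (scal W * z) s = lookup (\<Sum>p\<in>par n. scal (k p) * (scal (c p) * X p)) s" for s by simp
  have "\<phi> s = (\<Sum>p\<in>par n. (k p * c p / W) * pchar n p s)" if s: "s \<in> symm n" for s
  proof -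
    have "lookup (\<Sum>p\<in>par n. scal (k p) * (scal (c p) * X p)) s = (\<Sum>p\<in>par n. k p * c p * pchar n p s)"
      unfolding lookup_sum lookup_scal by (intro sum.cong refl) (simp only: X(1) mult.assoc)
    hence "W * \<phi> s = (\<Sum>p\<in>par n. k p * c p * pchar n p s)"
      using eq[of s] s unfolding lookup_scal lz by simp
    thus ?thesis using W by (simp add: field_simps sum_divide_distrib[symmetric])
  qed
  thus ?thesis by (intro exI[of _ "\<lambda>p. k p * c p / W"] ballI)
qed

section \<open>Symmetric functions\<close>

lemma chi_zero:
  assumes "tabl n p row col"
  shows "chi n row col 0 = fact n / hookprod n row col"
  using lookup_young_0[OF assms] by (simp add: chi_def card_symm)

text \<open>By completeness and orthogonality the two characters are proportional. Their equal norms
  leave only a sign, and both are positive at the identity.\<close>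

lemma chi_eq_pchar:
  assumes t: "tabl n p row col" and s: "s \<in> symm n"
  shows "chi n row col s = pchar n p s"
proof -
  have p: "p \<in> par n" using t by (simp add: tabl_def)
  obtain row2 col2 where t2: "tabl n p row2 col2" and e2: "pchar n p = chi n row2 col2" using pchar_tabl[OF p] .
  obtain c where c: "\<forall>s\<in>symm n. chi n row col s = (\<Sum>q\<in>par n. c q * pchar n q s)"
    using pchar_complete[of n "chi n row col"] chi_conj by metis
  have cq: "c q = 0" if q: "q \<in> par n" "q \<noteq> p" for q
  proof -
    obtain row3 col3 where t3: "tabl n q row3 col3" and e3: "pchar n q = chi n row3 col3" using pchar_tabl[OF q(1)] .
    have "fact n * c q = (\<Sum>s\<in>symm n. pchar n q s * chi n row col s)"
      using pchar_expansion_coeff[of n "chi n row col" c q] c q(1) by simp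
    also have "\<dots> = 0" unfolding e3 by (rule chi_orthogonal[OF t3 t q(2)])
    finally show ?thesis by simp
  qed
  have e: "chi n row col s = c p * pchar n p s" if "s \<in> symm n" for s
  proof -
    have "(\<Sum>q\<in>par n. c q * pchar n q s) = (\<Sum>q\<in>par n. if q = p then c p * pchar n p s else 0)"
      by (intro sum.cong refl) (simp add: cq)
    thus ?thesis using c that p by simp
  qed
  have "fact n = (\<Sum>s\<in>symm n. chi n row col s * chi n row col s)" by (rule chi_norm[OF t, symmetric])
  also have "\<dots> = (\<Sum>s\<in>symm n. (c p * c p) * (pchar n p s * pchar n p s))"
    by (intro sum.cong refl) (simp add: e)
  also have "\<dots> = (c p * c p) * fact n"
    by (simp only: sum_distrib_left[symmetric] pchar_orthonormal[OF p p]) simp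
  finally have "c p * c p = 1" by simp
  hence "c p = 1 \<or> c p = - 1" by (simp add: square_eq_1_iff)
  moreover have "c p * (fact n / hookprod n row2 col2) = fact n / hookprod n row col"
    using e[of 0] chi_zero[OF t] chi_zero[OF t2] e2 by simp
  moreover have "fact n / hookprod n row2 col2 > 0" "fact n / hookprod n row col > 0"
    using hookprod_pos[OF t] hookprod_pos[OF t2] by simp_all
  ultimately have "c p = 1" by auto
  thus ?thesis using e[OF s] by simp
qed

theorem irr_char_pchar:
  assumes lam: "lam \<in> partitions n" and s: "s \<in> symm n"
  shows "irr_char lam (app s) = of_real (pchar n (shape lam) s)"
proof -
  have "sum_list lam = n" using lam by (simp add: partitions_def)
  then obtain T where T: "T \<in> tableaux lam"
    using finite_same_card_bij[of "diagram lam" "{..<n}"] finite_diagram[of lam] card_diagram[of lam]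
    by (auto simp: tableaux_def)
  show ?thesis
    using irr_char_chi[OF lam T s] chi_eq_pchar[OF tabl_tableau[OF lam T] s] by simp
qed

text \<open>Exchanging rows and columns turns the coefficient of the symmetrizer at g into the sign
  of g times the coefficient at the inverse. The characters then differ by the sign and the quotient
  of the two hook products. That quotient is positive, and it is 1 because the norms agree.\<close>

lemma pchar_transpose:
  assumes p: "p \<in> par n" and p': "p' \<in> par n" and tr: "dia p' = prod.swap ` dia p" and s: "s \<in> symm n"
  shows "pchar n p' s = sgn_sym s * pchar n p s"
proof -
  obtain row col where t: "tabl n p row col" using tabl_exists[OF p] .
  have t': "tabl n p' col row"
  proof -
    have "bij_betw prod.swap (dia p) (dia p')" unfolding tr by (rule inj_on_imp_bij_betw) (rule inj_onI, metis swap_swap)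
    with t have "bij_betw (prod.swap \<circ> (\<lambda>x. (row x, col x))) {..<n} (dia p')"
      unfolding tabl_def by (blast intro: bij_betw_trans)
    thus ?thesis using p' by (simp add: tabl_def o_def)
  qed
  let ?h = "hookprod n row col" and ?h' = "hookprod n col row"
  have ly: "lookup (young n col row) g = sgn_sym g * lookup (young n row col) (- g)" for g
  proof -
    have "lookup (young n row col) (- g) = lookup (star (young n row col)) g" by (simp add: lookup_star)
    also have "star (young n row col) = rho n row * kap n col"
      unfolding young_def by (subst star_mult[OF keys_kap_symm keys_rho_symm]) simp
    also have "lookup \<dots> g = (\<Sum>q\<in>stab n row. lookup (rho n row) q * lookup (kap n col) (- q + g))"
      by (rule lookup_mult_sum[OF keys_rho finite_stab])
    also have "\<dots> = (\<Sum>q\<in>stab n row. if - q + g \<in> stab n col then sgn_sym q * sgn_sym g else 0)"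
      by (intro sum.cong refl) (simp add: lookup_rho lookup_kap sgn_sym_add)
    finally have "sgn_sym g * lookup (young n row col) (- g) =
        (\<Sum>q\<in>stab n row. sgn_sym g * (if - q + g \<in> stab n col then sgn_sym q * sgn_sym g else 0))"
      by (simp add: sum_distrib_left)
    also have "\<dots> = lookup (young n col row) g"
      unfolding lookup_young
    proof (intro sum.cong refl)
      fix q
      have "sgn_sym g * (sgn_sym q * sgn_sym g) = sgn_sym q" by (metis mult.commute mult.left_commute mult_1_right sgn_sym_square)
      thus "sgn_sym g * (if - q + g \<in> stab n col then sgn_sym q * sgn_sym g else 0) = (if - q + g \<in> stab n col then sgn_sym q else 0)"
        by simp
    qed
    finally show ?thesis by simp
  qed
  have h: "?h > 0" "?h' > 0" using hookprod_pos[OF t] hookprod_pos[OF t'] by auto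
  have e: "chi n col row s = sgn_sym s * (?h / ?h') * chi n row col s" for s
  proof -
    have "(\<Sum>g\<in>symm n. lookup (young n col row) (- g + s + g)) = (\<Sum>g\<in>symm n. sgn_sym s * lookup (young n row col) (- g + - s + g))"
    proof (intro sum.cong refl)
      fix g
      have "sgn_sym (- g + s + g) = sgn_sym s * (sgn_sym g * sgn_sym g)" by (simp add: sgn_sym_add)
      hence "sgn_sym (- g + s + g) = sgn_sym s" by simp
      thus "lookup (young n col row) (- g + s + g) = sgn_sym s * lookup (young n row col) (- g + - s + g)"
        unfolding ly conj_uminus by simp
    qed
    hence "chi n col row s * ?h' = sgn_sym s * (chi n row col (- s) * ?h)"
      using h by (simp add: chi_def sum_distrib_left)
    thus ?thesis using h unfolding chi_uminus by (simp add: field_simps)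
  qed
  have "fact n = (\<Sum>s\<in>symm n. chi n col row s * chi n col row s)" by (rule chi_norm[OF t', symmetric])
  also have "\<dots> = (\<Sum>s\<in>symm n. (?h / ?h')\<^sup>2 * (chi n row col s * chi n row col s))"
  proof (intro sum.cong refl)
    fix s
    have "chi n col row s * chi n col row s = (sgn_sym s * sgn_sym s) * ((?h / ?h')\<^sup>2 * (chi n row col s * chi n row col s))"
      unfolding e by (simp only: power2_eq_square mult.assoc mult.left_commute mult.commute)
    thus "chi n col row s * chi n col row s = (?h / ?h')\<^sup>2 * (chi n row col s * chi n row col s)" by simp
  qed
  also have "\<dots> = (?h / ?h')\<^sup>2 * fact n" by (simp only: sum_distrib_left[symmetric] chi_norm[OF t])
  finally have "(?h / ?h')\<^sup>2 = 1" by simp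
  moreover have "?h / ?h' > 0" using h by simp
  ultimately have "?h / ?h' = 1" by (auto simp: power2_eq_1_iff)
  thus ?thesis using e[of s] chi_eq_pchar[OF t s] chi_eq_pchar[OF t' s] by simp
qed

text \<open>The symmetrizer is the sum over the whole group, hence the character is constant; norm
  and positivity make the constant 1.\<close>

lemma pchar_one_row:
  assumes p: "p \<in> par n" and one: "\<And>i. i \<ge> 1 \<Longrightarrow> p i = 0" and s: "s \<in> symm n"
  shows "pchar n p s = 1"
proof -
  obtain row col where t: "tabl n p row col" using tabl_exists[OF p] .
  have row0: "row x = 0" if "x < n" for x
    using tabl_cell[OF t that] one[of "row x"] by (cases "row x") auto
  have R: "stab n row = symm n" by (auto simp: stab_def row0)
  have C: "stab n col = {0}"
  proof -
    have "g = 0" if g: "g \<in> stab n col" for g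
    proof (rule stab_row_col[OF t _ g])
      show "g \<in> stab n row" using g stab_subset R by blast
    qed
    thus ?thesis by auto
  qed
  have ly: "lookup (young n row col) g = 1" if "g \<in> symm n" for g
    unfolding lookup_young C R using that by simp
  let ?h = "hookprod n row col"
  have h: "?h > 0" by (rule hookprod_pos[OF t])
  have c: "chi n row col s = fact n / ?h" if "s \<in> symm n" for s
  proof -
    have "(\<Sum>g\<in>symm n. lookup (young n row col) (- g + s + g)) = (\<Sum>g\<in>symm n. 1)"
      using that by (intro sum.cong refl ly symm_add symm_uminus)
    thus ?thesis by (simp add: chi_def card_symm)
  qed
  have "fact n = (\<Sum>s\<in>symm n. chi n row col s * chi n row col s)" by (rule chi_norm[OF t, symmetric])
  also have "\<dots> = fact n * (fact n / ?h)\<^sup>2" by (simp add: c card_symm power2_eq_square)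
  finally have "(fact n / ?h)\<^sup>2 = 1" by simp
  moreover have "fact n / ?h > 0" using h by simp
  ultimately have "fact n / ?h = 1" by (auto simp: power2_eq_1_iff)
  thus ?thesis using c[OF s] chi_eq_pchar[OF t s] by simp
qed

section \<open>Monomials as multisets, Schur functions as counts of tableaux\<close>

definition mmset :: "monomial \<Rightarrow> nat multiset" where
  "mmset m = Abs_multiset (Poly_Mapping.lookup m)"

lemma count_mmset [simp]: "count (mmset m) k = Poly_Mapping.lookup m k"
proof -
  have "finite {k. Poly_Mapping.lookup m k > 0}"
    by (rule finite_subset[OF _ finite_keys[of m]]) (auto simp: in_keys_iff)
  thus ?thesis by (simp add: mmset_def count_Abs_multiset)
qed

lemma mmset_add: "mmset (a + b) = mmset a + mmset b"
  by (rule multiset_eqI) (simp add: lookup_add)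

lemma mmset_surj: obtains m where "mmset m = A"
proof -
  have fin: "finite {k. count A k \<noteq> 0}" by simp
  have "mmset (Abs_poly_mapping (count A)) = A"
    by (rule multiset_eqI) (simp add: lookup_Abs_poly_mapping[OF fin])
  thus thesis using that by blast
qed

lemma mmset_inj: "mmset a = mmset b \<Longrightarrow> a = b"
  by (rule poly_mapping_eqI) (metis count_mmset)

lemma count_image_mset_card:
  assumes "finite D"
  shows "count (image_mset T (mset_set D)) k = card {c \<in> D. T c = k}"
proof -
  have "{c \<in> D. T c = k} = T -` {k} \<inter> D" by auto
  thus ?thesis using assms by (simp add: count_image_mset)
qed

lemma schur_ssyt:
  assumes "lam \<in> partitions n"
  shows "schur lam m = int (card (ssyt (shape lam) (mmset m)))"
proof -
  have p: "shape lam \<in> par n" by (rule shape_par[OF assms])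
  have D: "diagram lam = dia (shape lam)" by (rule diagram_dia)
  have "(\<forall>k. card {c \<in> diagram lam. T c = k} = Poly_Mapping.lookup m k) \<longleftrightarrow>
        image_mset T (mset_set (dia (shape lam))) = mmset m" for T
    unfolding D multiset_eq_iff count_image_mset_card[OF finite_dia[OF p]] by simp
  moreover have "T \<in> semistandard lam \<longleftrightarrow> T \<in> extensional (dia (shape lam)) \<and>
     (\<forall>i j j'. j < j' \<longrightarrow> j' < shape lam i \<longrightarrow> T (i, j) \<le> T (i, j')) \<and>
     (\<forall>i i' j. i < i' \<longrightarrow> j < shape lam i' \<longrightarrow> T (i, j) < T (i', j))" for T
  proof -
    have "j < shape lam i" if "i < i'" "j < shape lam i'" for i i' j
      using par_antimono[OF p, of i i'] that by simp
    thus ?thesis unfolding semistandard_def D by (auto simp: dia_def)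
  qed
  ultimately have "{T \<in> semistandard lam. \<forall>k. card {c \<in> diagram lam. T c = k} = Poly_Mapping.lookup m k} = ssyt (shape lam) (mmset m)"
    unfolding ssyt_def by blast
  thus ?thesis by (simp add: schur_def)
qed

lemma ssyt_size: "p \<in> par n \<Longrightarrow> ssyt p a \<noteq> {} \<Longrightarrow> size a = n"
  using finite_dia[of p n] card_dia[of p n] by (auto simp: ssyt_def)

section \<open>Triangularity of the Kostka numbers\<close>

definition shape_content :: "nat \<Rightarrow> (nat \<Rightarrow> nat) \<Rightarrow> nat multiset" where
  "shape_content n q = (\<Sum>i<n. replicate_mset (q i) i)"

lemma count_shape_content:
  assumes "q \<in> par n"
  shows "count (shape_content n q) i = q i"
proof -
  have "count (shape_content n q) i = (\<Sum>j<n. if j = i then q i else 0)"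
    unfolding shape_content_def count_sum by (intro sum.cong) auto
  thus ?thesis using par_zero[OF assms, of i] by auto
qed

lemma size_filter_less: "size (filter_mset (\<lambda>x. x < i) a) = (\<Sum>k<i. count a (k::nat))"
proof (induction i)
  case (Suc i)
  have "filter_mset (\<lambda>x. x < Suc i) a = filter_mset (\<lambda>x. x < i) a + replicate_mset (count a i) i"
    by (rule multiset_eqI) auto
  thus ?case using Suc by simp
qed simp

lemma tab_word_less:
  assumes t: "tabl n p row col" and T: "T \<in> ssyt p a"
  shows "card {x \<in> {..<n}. tab_word n row col T x < i} = (\<Sum>k<i. count a k)"
proof -
  have "content n (tab_word n row col T) = a" using tab_word_content[OF t T] by (simp add: words_def)
  hence "(\<Sum>k<i. count a k) = size (filter_mset (\<lambda>x. x < i) (image_mset (tab_word n row col T) (mset_set {..<n})))"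
    by (simp add: size_filter_less content_def)
  thus ?thesis by (simp add: filter_mset_image_mset o_def filter_mset_mset_set)
qed

lemma tab_word_columns:
  assumes t: "tabl n p row col" and T: "T \<in> ssyt p a" and xy: "x < n" "y < n" "x \<noteq> y" "col x = col y"
  shows "tab_word n row col T x \<noteq> tab_word n row col T y"
proof -
  have "row x \<noteq> row y" using tabl_inj[OF t xy(1,2)] xy by blast
  hence "T (row x, col x) < T (row y, col x) \<or> T (row y, col x) < T (row x, col x)"
    using T tabl_cell[OF t xy(1)] tabl_cell[OF t xy(2)] xy(4) by (auto simp: ssyt_def nat_neq_iff)
  thus ?thesis using xy by (auto simp: tab_word_def)
qed

text \<open>Strict columns have distinct entries, so \<open>column_distinct_dominates\<close>
  applies to the filling itself.\<close>

lemma ssyt_dominates: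
  assumes p: "p \<in> par n" and q: "q \<in> par n" and ne: "ssyt p (shape_content n q) \<noteq> {}"
  shows "dominates p q"
proof -
  obtain T where T: "T \<in> ssyt p (shape_content n q)" using ne by blast
  obtain row col where t: "tabl n p row col" using tabl_exists[OF p] .
  show ?thesis unfolding dominates_def
  proof
    fix i
    show "sum q {..<i} \<le> sum p {..<i}"
    proof -
      have "card {x \<in> {..<n}. tab_word n row col T x < i} \<le> sum p {..<i}"
        by (rule column_distinct_dominates[OF t]) (rule tab_word_columns[OF t T])
      thus ?thesis unfolding tab_word_less[OF t T] by (simp add: count_shape_content[OF q])
    qed
  qed
qed

text \<open>Row k must be filled with k. Strict columns give entries at least k. By
  \<open>column_distinct_equality\<close> every entry names a row which its column has, whereas an
  entry that is too large would push the lowest entry of its column beyond the last row.\<close>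

lemma card_ssyt_own_content:
  assumes p: "p \<in> par n"
  shows "card (ssyt p (shape_content n p)) = 1"
proof -
  let ?a = "shape_content n p"
  define T0 where "T0 = (\<lambda>c. if c \<in> dia p then fst c else undefined :: nat)"
  have "image_mset T0 (mset_set (dia p)) = ?a"
  proof (rule multiset_eqI)
    fix k
    have "{c \<in> dia p. T0 c = k} = (\<lambda>j. (k, j)) ` {..<p k}" by (auto simp: T0_def dia_def)
    hence "card {c \<in> dia p. T0 c = k} = p k" by (simp add: card_image inj_on_def)
    thus "count (image_mset T0 (mset_set (dia p))) k = count ?a k"
      by (simp add: count_image_mset_card[OF finite_dia[OF p]] count_shape_content[OF p])
  qed
  moreover have "j < p i" if "i < i'" "j < p i'" for i i' j
    using par_antimono[OF p, of i i'] that by simp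
  ultimately have T0: "T0 \<in> ssyt p ?a" by (auto simp: ssyt_def T0_def dia_def extensional_def)
  obtain row col where t: "tabl n p row col" using tabl_exists[OF p] .
  have "T = T0" if T: "T \<in> ssyt p ?a" for T
  proof
    fix c :: "nat \<times> nat"
    obtain i j where c: "c = (i, j)" by (cases c)
    show "T c = T0 c"
    proof (cases "j < p i")
      case False
      thus ?thesis using T by (auto simp: ssyt_def extensional_def dia_def T0_def c)
    next
      case True
      have eq: "card {x \<in> {..<n}. tab_word n row col T x < i} = sum p {..<i}" for i
        unfolding tab_word_less[OF t T] by (simp add: count_shape_content[OF p])
      have bound: "col x < p (tab_word n row col T x)" if "x < n" for x
        by (rule column_distinct_equality[OF t _ eq that]) (rule tab_word_columns[OF t T])
      have pT: "j < p (T (k, j))" if k: "j < p k" for k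
      proof -
        obtain x where x: "x < n" "row x = k" "col x = j" using tabl_surj[OF t k] .
        thus ?thesis using bound[OF x(1)] by (simp add: tab_word_def)
      qed
      have step: "T (k, j) < T (k', j)" if "k < k'" "j < p k'" for k k'
        using T that by (auto simp: ssyt_def)
      have ge: "k \<le> T (k, j)" if "j < p k" for k
        using that
      proof (induction k)
        case (Suc k)
        have "j < p k" using par_antimono[OF p, of k "Suc k"] Suc.prems by simp
        thus ?case using Suc.IH step[of k "Suc k"] Suc.prems by simp
      qed simp
      have "T (k, j) \<le> k" if "j < p k" for k
      proof (rule ccontr)
        assume "\<not> T (k, j) \<le> k"
        define v where "v = Max {k. j < p k}"
        have fin: "finite {k. j < p k}"
        proof (rule finite_subset)
          have "k < n" if "j < p k" for k using par_zero[OF p, of k] that by (cases "k < n") auto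
          thus "{k. j < p k} \<subseteq> {..<n}" by auto
        qed simp
        have "d + k \<le> v \<longrightarrow> T (d + k, j) > d + k" for d
        proof (induction d)
          case 0 thus ?case using \<open>\<not> T (k, j) \<le> k\<close> by simp
        next
          case (Suc d)
          show ?case
          proof
            assume le: "Suc d + k \<le> v"
            have "v \<in> {k. j < p k}" unfolding v_def using fin that by (intro Max_in) auto
            hence "j < p (Suc d + k)" using par_antimono[OF p le] by simp
            thus "Suc d + k < T (Suc d + k, j)" using step[of "d + k" "Suc d + k"] Suc le by simp
          qed
        qed
        moreover have kv: "k \<le> v" unfolding v_def using fin that by (intro Max_ge) auto
        ultimately have "T (v, j) > v" by (metis le_add_diff_inverse2 order_refl)
        moreover have "v \<in> {k. j < p k}" unfolding v_def using fin that by (intro Max_in) auto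
        hence "T (v, j) \<in> {k. j < p k}" using pT by blast
        hence "T (v, j) \<le> v" unfolding v_def using fin by (intro Max_ge) (auto simp: v_def)
        ultimately show False by simp
      qed
      thus ?thesis using ge[OF True] True by (simp add: c T0_def dia_def le_antisym)
    qed
  qed
  hence "ssyt p ?a = {T0}" using T0 by blast
  thus ?thesis by simp
qed

text \<open>A linear extension of the dominance order on the shapes of size n; see
  \<open>dominates_weight\<close>.\<close>

definition dom_weight :: "nat \<Rightarrow> (nat \<Rightarrow> nat) \<Rightarrow> nat" where
  "dom_weight n p = (\<Sum>i\<le>n. sum p {..<i})"

lemma dominates_weight:
  assumes p: "p \<in> par n" and q: "q \<in> par n" and d: "dominates p q" and ne: "p \<noteq> q"
  shows "dom_weight n q < dom_weight n p"
proof (rule ccontr)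
  assume "\<not> ?thesis"
  moreover have "dom_weight n q \<le> dom_weight n p"
    unfolding dom_weight_def by (rule sum_mono) (use d in \<open>simp add: dominates_def\<close>)
  ultimately have e: "(\<Sum>i\<le>n. sum q {..<i}) = (\<Sum>i\<le>n. sum p {..<i})" by (simp add: dom_weight_def)
  have eq: "sum q {..<i} = sum p {..<i}" if "i \<le> n" for i
    by (rule sum_mono_inv[of "\<lambda>i. sum q {..<i}" "{..n}" "\<lambda>i. sum p {..<i}", OF e])
       (use d that in \<open>auto simp: dominates_def\<close>)
  have "p i = q i" for i
  proof (cases "i < n")
    case True
    thus ?thesis using eq[of i] eq[of "Suc i"] by simp
  next
    case False
    thus ?thesis using par_zero[OF p, of i] par_zero[OF q, of i] by simp
  qed
  thus False using ne by blast
qed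

lemma dom_weight_bound: "p \<in> par n \<Longrightarrow> dom_weight n p \<le> (\<Sum>i\<le>n. n)"
  unfolding dom_weight_def
proof (intro sum_mono)
  fix i assume "p \<in> par n" "i \<in> {..n}"
  have "sum p {..<i} \<le> sum p {..<n}" using \<open>i \<in> {..n}\<close> by (intro sum_mono2) auto
  thus "sum p {..<i} \<le> n" using \<open>p \<in> par n\<close> by (simp add: par_def)
qed

lemma size_shape_content: "q \<in> par n \<Longrightarrow> size (shape_content n q) = n"
  using ssyt_size[of q n "shape_content n q"] card_ssyt_own_content[of q n] by fastforce

lemma shape_inj: "lam \<in> partitions n \<Longrightarrow> \<mu> \<in> partitions n \<Longrightarrow> shape lam = shape \<mu> \<Longrightarrow> lam = \<mu>"
  using shape_bij[of n] by (auto simp: bij_betw_def inj_on_def)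

lemma schur_triangular:
  assumes lam: "lam \<in> partitions n'" and \<mu>: "\<mu> \<in> partitions n" and m: "mmset m = shape_content n (shape \<mu>)"
    and nz: "schur lam m \<noteq> 0"
  shows "lam = \<mu> \<or> n' = n \<and> dom_weight n (shape \<mu>) < dom_weight n (shape lam)"
proof -
  have ne: "ssyt (shape lam) (shape_content n (shape \<mu>)) \<noteq> {}"
    using nz unfolding schur_ssyt[OF lam] m by auto
  hence n': "n' = n" using ssyt_size[OF shape_par[OF lam] ne] size_shape_content[OF shape_par[OF \<mu>]] by simp
  have lam': "lam \<in> partitions n" using lam n' by simp
  show ?thesis
  proof (cases "shape lam = shape \<mu>")
    case True
    thus ?thesis using shape_inj[OF lam' \<mu>] by simp
  next
    case False
    have "dominates (shape lam) (shape \<mu>)" by (rule ssyt_dominates[OF shape_par[OF lam'] shape_par[OF \<mu>] ne])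
    thus ?thesis using dominates_weight[OF shape_par[OF lam'] shape_par[OF \<mu>] _ False] n' by simp
  qed
qed

lemma schur_diagonal:
  assumes \<mu>: "\<mu> \<in> partitions n" and m: "mmset m = shape_content n (shape \<mu>)"
  shows "schur \<mu> m = 1"
  unfolding schur_ssyt[OF \<mu>] m using card_ssyt_own_content[OF shape_par[OF \<mu>]] by simp

text \<open>Among the shapes of one size with nonzero coefficient take \<mu> of greatest weight: the
  monomial with exponents \<mu> occurs in no other Schur function of the combination. Coefficients
  are real in order to compare multiplicities computed from characters.\<close>

lemma schur_independent:
  fixes c :: "nat list \<Rightarrow> real"
  assumes A: "finite A" "A \<subseteq> (\<Union>n. partitions n)" and z: "\<And>m. (\<Sum>lam\<in>A. c lam * of_int (schur lam m)) = 0"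
    and l: "lam0 \<in> A"
  shows "c lam0 = 0"
proof (rule ccontr)
  assume c0: "c lam0 \<noteq> 0"
  obtain n where n: "lam0 \<in> partitions n" using A l by blast
  let ?P = "\<lambda>lam. lam \<in> A \<and> lam \<in> partitions n \<and> c lam \<noteq> 0"
  have "?P lam0" using l n c0 by simp
  moreover have "\<forall>lam. ?P lam \<longrightarrow> dom_weight n (shape lam) < Suc (\<Sum>i\<le>n. n)"
    using dom_weight_bound shape_par less_Suc_eq_le by blast
  ultimately have "\<exists>\<mu>. ?P \<mu> \<and> (\<forall>lam. ?P lam \<longrightarrow> dom_weight n (shape lam) \<le> dom_weight n (shape \<mu>))"
    by (rule ex_has_greatest_nat[of ?P lam0 "\<lambda>lam. dom_weight n (shape lam)" "Suc (\<Sum>i\<le>n. n)"])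
  then obtain \<mu> where \<mu>: "\<mu> \<in> A" "\<mu> \<in> partitions n" "c \<mu> \<noteq> 0"
    "\<And>lam. ?P lam \<Longrightarrow> dom_weight n (shape lam) \<le> dom_weight n (shape \<mu>)" by blast
  obtain m where m: "mmset m = shape_content n (shape \<mu>)" using mmset_surj .
  have z0: "c lam * of_int (schur lam m) = 0" if lam: "lam \<in> A - {\<mu>}" for lam
  proof (rule ccontr)
    assume a: "c lam * of_int (schur lam m) \<noteq> 0"
    obtain n' where n': "lam \<in> partitions n'" using A lam by blast
    have "n' = n \<and> dom_weight n (shape \<mu>) < dom_weight n (shape lam)"
      using schur_triangular[OF n' \<mu>(2) m] a lam by auto
    thus False using \<mu>(4)[of lam] lam n' a by auto
  qed
  have "(\<Sum>lam\<in>A - {\<mu>}. c lam * of_int (schur lam m)) = 0"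
    by (rule sum.neutral, rule ballI, rule z0)
  hence "(\<Sum>lam\<in>A. c lam * of_int (schur lam m)) = c \<mu> * of_int (schur \<mu> m)"
    using sum.remove[OF A(1) \<mu>(1), of "\<lambda>lam. c lam * of_int (schur lam m)"] by simp
  thus False using z[of m] schur_diagonal[OF \<mu>(2) m] \<mu>(3) by simp
qed

text \<open>The matrix of Kostka numbers is unitriangular, so the coefficients can be solved for
  within the integers, from the greatest weight downwards. It is meant for coefficients known only
  as averages over a group.\<close>

lemma schur_coeff_Ints:
  fixes D :: "nat list \<Rightarrow> real" and f :: series
  assumes f: "\<And>m. real_of_int (f m) = (\<Sum>\<nu>\<in>partitions n. D \<nu> * of_int (schur \<nu> m))" and \<mu>: "\<mu> \<in> partitions n"
  shows "D \<mu> \<in> \<int>"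
  using \<mu>
proof (induction "(\<Sum>i\<le>n. n) - dom_weight n (shape \<mu>)" arbitrary: \<mu> rule: less_induct)
  case (less \<mu>)
  obtain m where m: "mmset m = shape_content n (shape \<mu>)" using mmset_surj .
  have "D \<nu> * of_int (schur \<nu> m) \<in> \<int>" if \<nu>: "\<nu> \<in> partitions n - {\<mu>}" for \<nu>
  proof (cases "schur \<nu> m = 0")
    case False
    have \<nu>': "\<nu> \<in> partitions n" "\<nu> \<noteq> \<mu>" using \<nu> by auto
    have "dom_weight n (shape \<mu>) < dom_weight n (shape \<nu>)"
      using schur_triangular[OF \<nu>'(1) less.prems m False] \<nu>'(2) by simp
    moreover have "dom_weight n (shape \<nu>) \<le> (\<Sum>i\<le>n. n)" by (rule dom_weight_bound[OF shape_par[OF \<nu>'(1)]])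
    ultimately have "D \<nu> \<in> \<int>" by (intro less.hyps \<nu>'(1)) linarith
    thus ?thesis by simp
  qed simp
  hence "(\<Sum>\<nu>\<in>partitions n - {\<mu>}. D \<nu> * of_int (schur \<nu> m)) \<in> \<int>" by (rule Ints_sum)
  moreover have "D \<mu> = real_of_int (f m) - (\<Sum>\<nu>\<in>partitions n - {\<mu>}. D \<nu> * of_int (schur \<nu> m))"
    using f[of m] sum.remove[OF finite_partitions less.prems, of "\<lambda>\<nu>. D \<nu> * of_int (schur \<nu> m)"]
      schur_diagonal[OF less.prems m] by simp
  ultimately show ?case by simp
qed

section \<open>Coordinates in the Schur basis\<close>

text \<open>This gives access to the definite description in \<open>schur_coords\<close>: any finite
  Schur expansion is the described one, by independence.\<close>

lemma lookup_schur_coords: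
  fixes d :: "nat list \<Rightarrow> int"
  assumes A: "finite A" "A \<subseteq> (\<Union>n. partitions n)" and f: "\<And>m. f m = (\<Sum>lam\<in>A. d lam * schur lam m)"
  shows "Poly_Mapping.lookup (schur_coords f) lam = (if lam \<in> A then d lam else 0)"
proof -
  define a where "a = (\<Sum>lam\<in>A. Poly_Mapping.single lam (d lam))"
  have la: "Poly_Mapping.lookup a x = (if x \<in> A then d x else 0)" for x
  proof -
    have "Poly_Mapping.lookup a x = (\<Sum>lam\<in>A. if lam = x then d x else 0)"
      unfolding a_def lookup_sum by (intro sum.cong refl) (auto simp: lookup_single when_def)
    thus ?thesis using A(1) by simp
  qed
  have ka: "Poly_Mapping.keys a \<subseteq> A" by (auto simp: in_keys_iff la split: if_splits)
  let ?Q = "\<lambda>b. Poly_Mapping.keys b \<subseteq> (\<Union>n. partitions n) \<and>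
      f = (\<lambda>m. \<Sum>lam\<in>Poly_Mapping.keys b. Poly_Mapping.lookup b lam * schur lam m)"
  have Qa: "?Q a"
  proof
    show "Poly_Mapping.keys a \<subseteq> (\<Union>n. partitions n)" using ka A by blast
    have "f m = (\<Sum>lam\<in>Poly_Mapping.keys a. Poly_Mapping.lookup a lam * schur lam m)" for m
      unfolding f by (rule sum.mono_neutral_cong_right) (use A ka in \<open>auto simp: la in_keys_iff\<close>)
    thus "f = (\<lambda>m. \<Sum>lam\<in>Poly_Mapping.keys a. Poly_Mapping.lookup a lam * schur lam m)" by (rule ext)
  qed
  have "b = a" if b: "?Q b" for b
  proof (rule poly_mapping_eqI)
    fix x
    let ?B = "Poly_Mapping.keys a \<union> Poly_Mapping.keys b"
    let ?c = "\<lambda>l. Poly_Mapping.lookup b l - Poly_Mapping.lookup a l"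
    have "(\<Sum>l\<in>?B. real_of_int (?c l) * of_int (schur l m)) = 0" for m
    proof -
      have "(\<Sum>l\<in>?B. Poly_Mapping.lookup a l * schur l m) = f m"
        unfolding fun_cong[OF conjunct2[OF Qa], of m] by (rule sum.mono_neutral_right) (auto simp: in_keys_iff)
      moreover have "(\<Sum>l\<in>?B. Poly_Mapping.lookup b l * schur l m) = f m"
        unfolding fun_cong[OF conjunct2[OF b], of m] by (rule sum.mono_neutral_right) (auto simp: in_keys_iff)
      ultimately have "(\<Sum>l\<in>?B. ?c l * schur l m) = 0" by (simp add: left_diff_distrib sum_subtractf)
      hence "real_of_int (\<Sum>l\<in>?B. ?c l * schur l m) = 0" by simp
      thus ?thesis by simp
    qed
    note z = this
    show "Poly_Mapping.lookup b x = Poly_Mapping.lookup a x"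
    proof (cases "x \<in> ?B")
      case True
      have "finite ?B" "?B \<subseteq> (\<Union>n. partitions n)" using conjunct1[OF b] conjunct1[OF Qa] by auto
      from schur_independent[of ?B "\<lambda>l. real_of_int (?c l)", OF this z True] show ?thesis by simp
    qed (auto simp: in_keys_iff)
  qed
  hence "schur_coords f = a" unfolding schur_coords_def by (rule the_equality[where P = ?Q, OF Qa])
  thus ?thesis by (simp add: la)
qed

lemma lr_coeff_eq:
  fixes D :: "nat list \<Rightarrow> real"
  assumes \<nu>: "\<nu> \<in> partitions n"
    and D: "\<And>m. real_of_int (series_mult (schur \<rho>) (schur \<gamma>) m) = (\<Sum>\<nu>\<in>partitions n. D \<nu> * of_int (schur \<nu> m))"
  shows "real_of_int (lr_coeff \<nu> \<rho> \<gamma>) = D \<nu>"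
proof -
  let ?f = "series_mult (schur \<rho>) (schur \<gamma>)"
  \<comment> \<open>Rounding changes nothing, as the coefficients are integers; it supplies the
    integer-valued function that a Schur expansion in \<open>schur_coords\<close> consists
    of.\<close>
  define d where "d \<nu> = \<lfloor>D \<nu>\<rfloor>" for \<nu>
  have d: "real_of_int (d \<nu>) = D \<nu>" if "\<nu> \<in> partitions n" for \<nu>
    using schur_coeff_Ints[OF D that] by (auto simp: d_def elim: Ints_cases)
  have sub: "partitions n \<subseteq> (\<Union>n. partitions n)" by blast
  have "?f m = (\<Sum>\<nu>\<in>partitions n. d \<nu> * schur \<nu> m)" for m
  proof -
    have "real_of_int (?f m) = real_of_int (\<Sum>\<nu>\<in>partitions n. d \<nu> * schur \<nu> m)"
      unfolding D of_int_sum of_int_mult by (intro sum.cong refl) (simp add: d)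
    thus ?thesis by linarith
  qed
  hence c: "Poly_Mapping.lookup (schur_coords ?f) \<nu> = d \<nu>"
    using lookup_schur_coords[OF finite_partitions sub, of ?f d \<nu>] \<nu> by simp
  have s: "Poly_Mapping.lookup (schur_coords (schur \<nu>)) x = (if x = \<nu> then 1 else 0)" for x
  proof -
    have "{\<nu>} \<subseteq> (\<Union>n. partitions n)" using \<nu> by blast
    from lookup_schur_coords[OF _ this, of "schur \<nu>" "\<lambda>_. 1" x] show ?thesis by simp
  qed
  have "Poly_Mapping.keys (schur_coords (schur \<nu>)) = {\<nu>}" by (auto simp: in_keys_iff s split: if_splits)
  thus ?thesis using d[OF \<nu>] by (simp add: lr_coeff_def hall_inner_def s c)
qed

text \<open>The factorizations of a monomial correspond to the submultisets of its multiset of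
  variables.\<close>

lemma series_mult_mset:
  assumes f: "\<And>a. real_of_int (f a) = F (mmset a)" and g: "\<And>b. real_of_int (g b) = H (mmset b)"
  shows "real_of_int (series_mult f g m) = (\<Sum>A | A \<subseteq># mmset m. F A * H (mmset m - A))"
proof -
  define pm where "pm A = Abs_poly_mapping (count A)" for A :: "nat multiset"
  have pm: "mmset (pm A) = A" for A
  proof -
    have fin: "finite {k. count A k \<noteq> 0}" by simp
    show ?thesis unfolding pm_def
      by (rule multiset_eqI) (simp add: lookup_Abs_poly_mapping[OF fin])
  qed
  have "real_of_int (series_mult f g m) = (\<Sum>(a, b)\<in>{(a, b). a + b = m}. F (mmset a) * H (mmset b))"
    by (simp add: series_mult_def f g split_def)
  also have "\<dots> = (\<Sum>A | A \<subseteq># mmset m. F A * H (mmset m - A))"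
  proof (rule sum.reindex_bij_witness[of _ "\<lambda>A. (pm A, pm (mmset m - A))" "\<lambda>(a, b). mmset a"], goal_cases)
    case (1 ab)
    obtain a b where ab: "ab = (a, b)" "a + b = m" using 1 by auto
    have "pm (mmset a) = a" by (rule mmset_inj) (rule pm)
    moreover have "pm (mmset b) = b" by (rule mmset_inj) (rule pm)
    moreover have "mmset m - mmset a = mmset b" unfolding ab(2)[symmetric] mmset_add by simp
    ultimately show ?case unfolding ab(1) by simp
  next
    case (2 ab)
    obtain a b where ab: "ab = (a, b)" "a + b = m" using 2 by auto
    thus ?case unfolding ab(2)[symmetric] mmset_add by simp
  next
    case (3 A)
    show ?case by (simp add: pm)
  next
    case (4 A)
    hence "mmset (pm A + pm (mmset m - A)) = mmset m" by (simp add: mmset_add pm)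
    hence "pm A + pm (mmset m - A) = m" by (rule mmset_inj)
    thus ?case by simp
  next
    case (5 ab)
    obtain a b where ab: "ab = (a, b)" "a + b = m" using 5 by auto
    have "mmset m - mmset a = mmset b" unfolding ab(2)[symmetric] mmset_add by simp
    thus ?case unfolding ab(1) by simp
  qed
  finally show ?thesis .
qed

section \<open>Young subgroups and the restriction of words\<close>

text \<open>The embedding of S_N x S_k as a Young subgroup. Beyond N + k the formula is the identity
  for \<open>h \<in> symm k\<close>, which fixes every point from k on.\<close>

definition join :: "nat \<Rightarrow> sym \<Rightarrow> sym \<Rightarrow> sym" where
  "join N g h = Sym (\<lambda>x. if x < N then app g x else app h (x - N) + N)"

lemma app_join:
  assumes g: "g \<in> symm N" and h: "h \<in> symm k"
  shows "app (join N g h) x = (if x < N then app g x else app h (x - N) + N)"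
    and "join N g h \<in> symm (N + k)"
proof -
  let ?f = "\<lambda>g h x. if x < N then app g x else app h (x - N) + N"
  have bij: "bij_betw (?f g h) {..<N + k} {..<N + k}"
    by (rule bij_betw_byWitness[of _ "?f (- g) (- h)"])
       (use g h symm_uminus[OF g] symm_uminus[OF h] symm_lt[OF g] symm_lt[OF h] symm_lt[OF symm_uminus[OF h]] in
          \<open>auto simp: less_diff_conv2 intro: trans_less_add1 split: if_splits\<close>)
  have perm: "?f g h permutes {..<N + k}"
  proof (rule bij_imp_permutes[OF bij])
    fix x assume "x \<notin> {..<N + k}"
    thus "?f g h x = x" using symm_ge[OF h, of "x - N"] by auto
  qed
  hence "permutation (?f g h)" by (rule permutes_imp_permutation[rotated]) simp
  hence e: "app (join N g h) = ?f g h" unfolding join_def by (intro Sym_inverse) simp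
  show "app (join N g h) x = (if x < N then app g x else app h (x - N) + N)" by (simp add: e)
  show "join N g h \<in> symm (N + k)" using perm by (simp add: symm_def e)
qed

lemma join_add:
  assumes "g \<in> symm N" "h \<in> symm k" "g' \<in> symm N" "h' \<in> symm k"
  shows "join N (g + g') (h + h') = join N g h + join N g' h'"
  using app_join(1)[OF assms(1,2)] app_join(1)[OF assms(3,4)] symm_lt[OF assms(3)]
    app_join(1)[OF symm_add[OF assms(1,3)] symm_add[OF assms(2,4)]]
  by (intro sym_eqI) auto

lemma join_uminus:
  assumes g: "g \<in> symm N" and h: "h \<in> symm k"
  shows "join N (- g) (- h) = - join N g h"
proof -
  have "join N (- g) (- h) + join N g h = join N (- g + g) (- h + h)"
    by (rule join_add[symmetric]) (use assms symm_uminus in auto)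
  also have "\<dots> = 0" by (rule sym_eqI) (simp add: app_join[of 0 N 0 k])
  finally show ?thesis by (simp add: eq_neg_iff_add_eq_0)
qed

lemma word_act_fixed: "word_act s f = f \<longleftrightarrow> (\<forall>x. f (app s x) = f x)"
proof
  assume a: "word_act s f = f"
  show "\<forall>x. f (app s x) = f x"
  proof
    fix x show "f (app s x) = f x" using fun_cong[OF a, of "app s x"] by (simp add: word_act_def)
  qed
next
  assume a: "\<forall>x. f (app s x) = f x"
  show "word_act s f = f"
  proof
    fix x show "word_act s f x = f x" using a[rule_format, of "app (- s) x"] by (simp add: word_act_def)
  qed
qed

lemma content_append:
  "content (N + k) f = content N f + content k (\<lambda>x. f (x + N))"
proof -
  have "mset_set {..<N + k} = mset_set {..<N} + mset_set {N..<N + k}"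
    by (subst mset_set_Union[symmetric]) (auto intro!: arg_cong[of _ _ mset_set])
  moreover have "mset_set {N..<N + k} = image_mset (\<lambda>x. x + N) (mset_set {..<k})"
    by (subst image_mset_mset_set) (auto simp: image_add_atLeastLessThan' atLeast0LessThan[symmetric] add.commute)
  ultimately show ?thesis by (simp add: content_def multiset.map_comp o_def)
qed

text \<open>A word is cut after position \<open>N\<close>, and \<open>A\<close> is the content of
  its first piece. This is the counterpart of \<open>series_mult_mset\<close> on the side of the
  group.\<close>

lemma perm_char_join:
  assumes g: "g \<in> symm N" and h: "h \<in> symm k"
  shows "perm_char (N + k) M (join N g h) = (\<Sum>A | A \<subseteq># M. perm_char N A g * perm_char k (M - A) h)"
proof -
  let ?L = "{f \<in> words (N + k) M. word_act (join N g h) f = f}"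
  let ?F = "\<lambda>n s a. {f \<in> words n a. word_act s f = f}"
  let ?r = "\<lambda>f x. if x < N then f x else (0 :: nat)" and ?q = "\<lambda>f x. f (x + N) :: nat"
  have cr: "content N (?r f) = content N f" for f
    unfolding content_def by (intro image_mset_cong) auto
  have "card ?L = card (SIGMA A:{A. A \<subseteq># M}. ?F N g A \<times> ?F k h (M - A))"
  proof (rule bij_betw_same_card, rule bij_betw_byWitness[where
        f = "\<lambda>f. (content N f, ?r f, ?q f)" and f' = "\<lambda>(A, f1, f2). (\<lambda>x. if x < N then f1 x else f2 (x - N))"], goal_cases)
    case 1
    show ?case by (auto simp: fun_eq_iff)
  next
    case 2
    show ?case
    proof (rule ballI)
      fix y assume y: "y \<in> (SIGMA A:{A. A \<subseteq># M}. ?F N g A \<times> ?F k h (M - A))"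
      obtain A f1 f2 where y': "y = (A, f1, f2)" by (cases y) auto
      have f: "f1 \<in> words N A" "f2 \<in> words k (M - A)" using y y' by auto
      let ?f = "\<lambda>x. if x < N then f1 x else f2 (x - N)"
      have "content N ?f = content N f1" unfolding content_def by (intro image_mset_cong) auto
      moreover have "?r ?f = f1" using f(1) by (auto simp: words_def fun_eq_iff)
      ultimately have "(content N ?f, ?r ?f, ?q ?f) = y" using f(1) unfolding y' by (simp add: words_def)
      moreover have "(case y of (A, f1, f2) \<Rightarrow> (\<lambda>x. if x < N then f1 x else f2 (x - N))) = ?f" by (simp add: y')
      ultimately show "(\<lambda>f. (content N f, ?r f, ?q f)) (case y of (A, f1, f2) \<Rightarrow> (\<lambda>x. if x < N then f1 x else f2 (x - N))) = y"
        by (simp only:)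
    qed
  next
    case 3
    show ?case
    proof (rule image_subsetI)
      fix f assume f: "f \<in> ?L"
      hence fw: "\<And>x. x \<ge> N + k \<Longrightarrow> f x = 0" "content (N + k) f = M" by (auto simp: words_def)
      have fx: "f (app (join N g h) x) = f x" for x using f word_act_fixed[of "join N g h" f] by simp
      have M: "M = content N f + content k (?q f)" using fw(2) content_append[of N k f] by simp
      have "f (app g x) = f x" if "x < N" for x using fx[of x] that by (simp add: app_join[OF g h])
      hence 1: "word_act g (?r f) = ?r f" unfolding word_act_fixed using g by auto
      have "f (app h x + N) = f (x + N)" for x using fx[of "x + N"] by (simp add: app_join[OF g h])
      hence 2: "word_act h (?q f) = ?q f" unfolding word_act_fixed by auto
      have "?r f \<in> words N (content N f)" using cr by (simp add: words_def)
      moreover have "?q f \<in> words k (M - content N f)" using fw(1) M by (simp add: words_def)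
      ultimately show "(content N f, ?r f, ?q f) \<in> (SIGMA A:{A. A \<subseteq># M}. ?F N g A \<times> ?F k h (M - A))"
        using 1 2 M by simp
    qed
  next
    case 4
    show ?case
    proof (rule image_subsetI)
      fix y assume y: "y \<in> (SIGMA A:{A. A \<subseteq># M}. ?F N g A \<times> ?F k h (M - A))"
      obtain A f1 f2 where y': "y = (A, f1, f2)" by (cases y) auto
      have f: "f1 \<in> words N A" "f2 \<in> words k (M - A)" "word_act g f1 = f1" "word_act h f2 = f2" "A \<subseteq># M" using y y' by auto
      let ?f = "\<lambda>x. if x < N then f1 x else f2 (x - N)"
      have "content N ?f = content N f1" unfolding content_def by (intro image_mset_cong) auto
      hence "content (N + k) ?f = content N f1 + content k f2" by (simp add: content_append)
      also have "\<dots> = M" using f by (simp add: words_def)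
      finally have "?f \<in> words (N + k) M" using f(2) by (auto simp: words_def)
      moreover have "word_act (join N g h) ?f = ?f"
        unfolding word_act_fixed app_join[OF g h] using f(3,4) g unfolding word_act_fixed by auto
      ultimately show "(case y of (A, f1, f2) \<Rightarrow> (\<lambda>x. if x < N then f1 x else f2 (x - N))) \<in> ?L"
        unfolding y' by simp
    qed
  qed
  also have "\<dots> = (\<Sum>A | A \<subseteq># M. card (?F N g A \<times> ?F k h (M - A)))"
  proof (rule card_SigmaI)
    show "finite {A. A \<subseteq># M}" using finite_submultisets[of M "\<lambda>_. True"] by simp
  qed simp
  finally show ?thesis by (simp add: perm_char_def card_cartesian_product)
qed

section \<open>Hook shapes and the main theorem\<close>

text \<open>The partition (N, 1^k) of N + k. For k = 0 the value N = 0 is meaningful as well: the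
  empty shape starts the induction for single rows.\<close>

definition hook_shape :: "nat \<Rightarrow> nat \<Rightarrow> nat \<Rightarrow> nat" where
  "hook_shape N k = (\<lambda>i. if i = 0 then N else if i \<le> k then 1 else 0)"

lemma hook_shape_par: "1 \<le> N \<or> k = 0 \<Longrightarrow> hook_shape N k \<in> par (N + k)"
proof -
  assume N: "1 \<le> N \<or> k = 0"
  have am: "antimono (hook_shape N k)" unfolding decseq_Suc_iff using N by (auto simp: hook_shape_def)
  have "sum (hook_shape N k) {..<Suc (N + k)} = N + (\<Sum>i<N + k. hook_shape N k (Suc i))"
    by (simp only: sum.lessThan_Suc_shift) (simp add: hook_shape_def)
  also have "(\<Sum>i<N + k. hook_shape N k (Suc i)) = (\<Sum>i<k. 1)"
    by (rule sum.mono_neutral_cong_right) (auto simp: hook_shape_def)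
  finally have "sum (hook_shape N k) {..<Suc (N + k)} = N + k" by simp
  thus ?thesis using am par_iff[of "N + k" "Suc (N + k)"] by (auto simp: hook_shape_def)
qed

lemma shape_hook: "1 \<le> n \<Longrightarrow> r \<le> n - 1 \<Longrightarrow> shape (hook n r) = hook_shape (n - r) r"
  by (auto simp: shape_def hook_def hook_shape_def fun_eq_iff nth_Cons' less_Suc_eq_le)

lemma kostka_row:
  assumes "set_mset a \<subseteq> {..<L}"
  shows "kostka (hook_shape (size a) 0) a L = 1"
  using assms
proof (induction L arbitrary: a)
  case 0
  thus ?case by (auto simp: hook_shape_def)
next
  case (Suc L)
  define a' where "a' = filter_mset (\<lambda>x. x \<noteq> L) a"
  have le: "size a' \<le> size a" using size_split_letter[of L a] by (simp add: a'_def)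
  have "{q. q \<in> par (size a') \<and> hstrip (hook_shape (size a) 0) q} = {hook_shape (size a') 0}"
  proof (intro set_eqI iffI)
    fix q assume q: "q \<in> {q. q \<in> par (size a') \<and> hstrip (hook_shape (size a) 0) q}"
    have z: "q i = 0" if "i \<ge> 1" for i
    proof -
      have "q i \<le> hook_shape (size a) 0 i" using q by (simp add: hstrip_def)
      thus ?thesis using that by (simp add: hook_shape_def)
    qed
    have "sum q {..<Suc (size a')} = q 0 + (\<Sum>i<size a'. q (Suc i))" by (simp only: sum.lessThan_Suc_shift)
    hence "q 0 = size a'" using q par_sum[of q "size a'" "Suc (size a')"] z by simp
    thus "q \<in> {hook_shape (size a') 0}" using z by (auto simp: hook_shape_def fun_eq_iff)
  next
    fix q assume "q \<in> {hook_shape (size a') 0}"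
    thus "q \<in> {q. q \<in> par (size a') \<and> hstrip (hook_shape (size a) 0) q}"
      using hook_shape_par[of "size a'" 0] le by (auto simp: hstrip_def hook_shape_def)
  qed
  moreover have "set_mset a' \<subseteq> {..<L}" using Suc.prems unfolding a'_def by (rule filter_ne_Suc_subset)
  ultimately show ?case using Suc.IH[of a'] by (simp add: a'_def[symmetric])
qed

text \<open>A nonempty horizontal strip leaves a hook in two ways: with all \<open>i\<close> cells
  from the first row, where the corner must stay above the leg, or with i - 1 cells from the first
  row and the lowest cell of the leg.\<close>

lemma hook_strips:
  assumes N: "1 \<le> N" and k: "1 \<le> k" and i: "1 \<le> i" and s: "s + i = N + k"
  shows "{q. q \<in> par s \<and> hstrip (hook_shape N k) q} =
     (if i < N then {hook_shape (N - i) k} else {}) \<union> (if i \<le> N then {hook_shape (N + 1 - i) (k - 1)} else {})"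
    (is "?Q = ?R")
proof (intro set_eqI iffI)
  fix q assume q: "q \<in> ?Q"
  have b: "q j \<le> hook_shape N k j" "hook_shape N k (Suc j) \<le> q j" for j
    using q by (auto simp: hstrip_def)
  have q0: "1 \<le> q 0" "q 0 \<le> N" using b[of 0] k by (auto simp: hook_shape_def)
  have mid: "q j = 1" if "1 \<le> j" "j < k" for j using b[of j] that by (auto simp: hook_shape_def)
  have up: "q j = 0" if "k < j" for j using b[of j] that by (auto simp: hook_shape_def)
  have qk: "q k \<le> 1" using b[of k] k by (auto simp: hook_shape_def)
  define k' where "k' = (if q k = 1 then k else k - 1)"
  have e: "q = hook_shape (q 0) k'"
  proof
    fix j show "q j = hook_shape (q 0) k' j"
      using mid[of j] up[of j] qk k by (cases "j = k"; cases "j = 0"; cases "j < k") (auto simp: hook_shape_def k'_def)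
  qed
  have "hook_shape (q 0) k' \<in> par (q 0 + k')" using q0 by (intro hook_shape_par) simp
  hence "q \<in> par (q 0 + k')" using e by simp
  hence "s = q 0 + k'" using q par_sum[of q s "s + (q 0 + k')"] par_sum[of q "q 0 + k'" "s + (q 0 + k')"] by simp
  show "q \<in> ?R"
  proof (cases "q k = 1")
    case True
    hence "q 0 = N - i" "i < N" using \<open>s = q 0 + k'\<close> s q0 by (auto simp: k'_def)
    thus ?thesis using e True by (simp add: k'_def)
  next
    case False
    hence "q 0 = N + 1 - i" "i \<le> N" using \<open>s = q 0 + k'\<close> s q0 k by (auto simp: k'_def)
    thus ?thesis using e False by (simp add: k'_def)
  qed
next
  fix q assume "q \<in> ?R"
  then consider "i < N" "q = hook_shape (N - i) k" | "i \<le> N" "q = hook_shape (N + 1 - i) (k - 1)"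
    by (auto split: if_splits)
  thus "q \<in> ?Q"
  proof cases
    case 1
    have "s = N - i + k" using s 1 by simp
    moreover have "1 \<le> N - i" using 1 by simp
    ultimately have "q \<in> par s" using 1(2) hook_shape_par[OF disjI1, of "N - i" k] by simp
    moreover have "hstrip (hook_shape N k) q" using 1 by (auto simp: hstrip_def hook_shape_def)
    ultimately show ?thesis by simp
  next
    case 2
    have "s = N + 1 - i + (k - 1)" using s 2 k by simp
    moreover have "1 \<le> N + 1 - i" using 2 by simp
    ultimately have "q \<in> par s" using 2(2) hook_shape_par[OF disjI1, of "N + 1 - i" "k - 1"] by simp
    moreover have "hstrip (hook_shape N k) q" using 2 i k by (auto simp: hstrip_def hook_shape_def)
    ultimately show ?thesis by simp
  qed
qed

lemma card_set_mset_le: "card (set_mset a) \<le> size a"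
  by (metis card_length ex_mset set_mset_mset size_mset)

text \<open>The corner holds the smallest letter, the other k cells of the first column hold
  distinct letters chosen among the remaining ones, and the first row is then determined. The
  recursion over strips becomes Pascal's rule.\<close>

lemma kostka_hook:
  assumes "set_mset a \<subseteq> {..<L}" "1 \<le> N" "size a = N + k"
  shows "kostka (hook_shape N k) a L = (card (set_mset a) - 1) choose k"
  using assms
proof (induction L arbitrary: a N k)
  case 0
  thus ?case by simp
next
  case (Suc L)
  show ?case
  proof (cases "k = 0")
    case True
    thus ?thesis using kostka_row[OF Suc.prems(1)] Suc.prems(3) by simp
  next
    case False
    hence k: "1 \<le> k" by simp
    define a' where "a' = filter_mset (\<lambda>x. x \<noteq> L) a"
    define i where "i = count a L"
    have s: "size a' + i = N + k" using size_split_letter[of L a] Suc.prems(3) by (simp add: a'_def i_def)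
    have a'L: "set_mset a' \<subseteq> {..<L}" using Suc.prems(1) unfolding a'_def by (rule filter_ne_Suc_subset)
    have rec: "kostka (hook_shape N k) a (Suc L) = (\<Sum>q | q \<in> par (size a') \<and> hstrip (hook_shape N k) q. kostka q a' L)"
      by (simp add: a'_def)
    show ?thesis
    proof (cases "i = 0")
      case True
      have aa: "a' = a" using mset_split_letter[of L a] True by (simp add: a'_def i_def)
      have hp: "hook_shape N k \<in> par (N + k)" using Suc.prems(2) by (intro hook_shape_par) simp
      have "{q. q \<in> par (size a') \<and> hstrip (hook_shape N k) q} = {hook_shape N k}"
      proof (intro set_eqI iffI)
        fix q assume "q \<in> {q. q \<in> par (size a') \<and> hstrip (hook_shape N k) q}"
        thus "q \<in> {hook_shape N k}" using hstrip_same_size[OF _ hp, of q] Suc.prems(3) aa by simp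
      next
        fix q assume "q \<in> {hook_shape N k}"
        thus "q \<in> {q. q \<in> par (size a') \<and> hstrip (hook_shape N k) q}"
          using hp Suc.prems(2,3) aa by (auto simp: hstrip_def hook_shape_def)
      qed
      thus ?thesis unfolding rec using Suc.IH[OF a'L Suc.prems(2), of k] Suc.prems(3) aa by simp
    next
      case False
      hence i: "1 \<le> i" by simp
      define c where "c = card (set_mset a')"
      have cs: "c \<le> size a'" unfolding c_def by (rule card_set_mset_le)
      have "L \<in># a" using False by (simp add: i_def)
      hence "set_mset a = insert L (set_mset a')" by (auto simp: a'_def)
      moreover have "L \<notin> set_mset a'" by (simp add: a'_def)
      ultimately have ca: "card (set_mset a) = Suc c" by (simp add: c_def)
      have ne: "hook_shape (N - i) k \<noteq> hook_shape (N + 1 - i) (k - 1)" if "i < N"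
      proof
        assume e: "hook_shape (N - i) k = hook_shape (N + 1 - i) (k - 1)"
        from fun_cong[OF e, of 0] that show False by (simp add: hook_shape_def)
      qed
      have A: "kostka (hook_shape (N - i) k) a' L = (c - 1) choose k" if "i < N"
        unfolding c_def by (rule Suc.IH[OF a'L]) (use that s in auto)
      have B: "kostka (hook_shape (N + 1 - i) (k - 1)) a' L = (c - 1) choose (k - 1)" if "i \<le> N"
        unfolding c_def by (rule Suc.IH[OF a'L]) (use that s k in auto)
      have "kostka (hook_shape N k) a (Suc L) =
        (if i < N then (c - 1) choose k else 0) + (if i \<le> N then (c - 1) choose (k - 1) else 0)"
        unfolding rec hook_strips[OF Suc.prems(2) k i s] using A B ne by auto
      \<comment> \<open>Pascal's rule for i < N. For i = N the missing term would be 0 because c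
        \<le> k, and for i > N both sides are 0 because c < k.\<close>
      also have "\<dots> = c choose k"
      proof -
        consider "i < N" | "i = N" | "i > N" by linarith
        thus ?thesis
        proof cases
          case 1
          have "a' \<noteq> {#}" using s 1 by auto
          hence "c \<noteq> 0" by (simp add: c_def)
          then obtain c' where "c = Suc c'" using not0_implies_Suc by blast
          moreover obtain k' where "k = Suc k'" using k by (cases k) auto
          ultimately show ?thesis using 1 by simp
        next
          case 2
          have "c \<le> k" using cs s 2 by simp
          have "a' \<noteq> {#}" using s 2 k by auto
          hence "c \<noteq> 0" by (simp add: c_def)
          then obtain c' where c': "c = Suc c'" using not0_implies_Suc by blast
          obtain k' where k': "k = Suc k'" using k by (cases k) auto
          have "c' choose k = 0" using \<open>c \<le> k\<close> c' by (simp add: binomial_eq_0)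
          thus ?thesis using 2 c' k' by simp
        next
          case 3
          have "c < k" using cs s 3 by simp
          thus ?thesis using 3 by (simp add: binomial_eq_0)
        qed
      qed
      finally show ?thesis by (simp add: ca)
    qed
  qed
qed

lemma card_ssyt_hook:
  assumes "1 \<le> N"
  shows "card (ssyt (hook_shape N k) a) = (if size a = N + k then (card (set_mset a) - 1) choose k else 0)"
proof -
  have p: "hook_shape N k \<in> par (N + k)" using assms by (intro hook_shape_par) simp
  show ?thesis
  proof (cases "size a = N + k")
    case True
    obtain L where L: "set_mset a \<subseteq> {..<L}" using finite_nat_set_iff_bounded[of "set_mset a"] by auto
    thus ?thesis using card_ssyt[OF L, of "hook_shape N k"] kostka_hook[OF L assms True] p True by simp
  next
    case False
    hence "ssyt (hook_shape N k) a = {}" using ssyt_size[OF p] by blast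
    thus ?thesis using False by simp
  qed
qed

text \<open>A multiset with as many distinct elements as its size is a set.\<close>

lemma card_distinct_submultisets:
  "card {B. B \<subseteq># M \<and> size B = k \<and> card (set_mset B) = k} = card (set_mset M) choose k"
proof -
  have "card {B. B \<subseteq># M \<and> size B = k \<and> card (set_mset B) = k} = card {S. S \<subseteq> set_mset M \<and> card S = k}"
  proof (rule bij_betw_same_card[of set_mset], rule bij_betw_byWitness[of _ mset_set])
    show "\<forall>B\<in>{B. B \<subseteq># M \<and> size B = k \<and> card (set_mset B) = k}. mset_set (set_mset B) = B"
    proof
      fix B assume B: "B \<in> {B. B \<subseteq># M \<and> size B = k \<and> card (set_mset B) = k}"
      have "mset_set (set_mset B) \<subseteq># B" by (rule mset_set_set_mset_msubset)
      moreover have "size (mset_set (set_mset B)) = size B" using B by simp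
      ultimately show "mset_set (set_mset B) = B" by (metis mset_subset_size nless_le subset_mset.le_imp_less_or_eq)
    qed
    show "\<forall>S\<in>{S. S \<subseteq> set_mset M \<and> card S = k}. set_mset (mset_set S) = S"
      using finite_subset[OF _ finite_set_mset[of M]] by simp
    show "set_mset ` {B. B \<subseteq># M \<and> size B = k \<and> card (set_mset B) = k} \<subseteq> {S. S \<subseteq> set_mset M \<and> card S = k}"
      by (auto dest: mset_subset_eqD)
    show "mset_set ` {S. S \<subseteq> set_mset M \<and> card S = k} \<subseteq> {B. B \<subseteq># M \<and> size B = k \<and> card (set_mset B) = k}"
    proof (rule image_subsetI)
      fix S assume S: "S \<in> {S. S \<subseteq> set_mset M \<and> card S = k}"
      hence f: "finite S" using finite_subset[OF _ finite_set_mset[of M]] by blast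
      have "mset_set S \<subseteq># mset_set (set_mset M)" using S by (intro subset_imp_msubset_mset_set) auto
      hence "mset_set S \<subseteq># M" using mset_set_set_mset_msubset[of M] subset_mset.order_trans by blast
      thus "mset_set S \<in> {B. B \<subseteq># M \<and> size B = k \<and> card (set_mset B) = k}" using S f by simp
    qed
  qed
  thus ?thesis by (simp add: n_subsets)
qed

text \<open>The product h_N e_k as a sum of two hook Schur functions. If \<open>M\<close> has d
  distinct letters and size N + k, the left side chooses k of them for the column, and d choose k
  splits by Pascal's rule into the two hook counts of \<open>card_ssyt_hook\<close>.\<close>

lemma hook_pieri:
  assumes N: "1 \<le> N"
  shows "(\<Sum>A | A \<subseteq># M. card (ssyt (hook_shape N 0) A) * card (ssyt (shape (replicate k 1)) (M - A))) =
    card (ssyt (hook_shape N k) M) + (if k = 0 then 0 else card (ssyt (hook_shape (N + 1) (k - 1)) M))"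
proof (cases "k = 0")
  case True
  have s0: "shape (replicate k 1) = (\<lambda>_. 0)" using True by (auto simp: shape_def)
  have c0: "card (ssyt (\<lambda>_. 0) B) = (if B = {#} then 1 else 0)" for B
  proof -
    have "ssyt (\<lambda>_. 0) B = (if B = {#} then {\<lambda>_. undefined} else {})" by (auto simp: ssyt_def dia_def)
    thus ?thesis by simp
  qed
  have "(\<Sum>A | A \<subseteq># M. card (ssyt (hook_shape N 0) A) * card (ssyt (\<lambda>_. 0) (M - A))) =
        (\<Sum>A\<in>{M}. card (ssyt (hook_shape N 0) A) * card (ssyt (\<lambda>_. 0) (M - A)))"
    by (rule sum.mono_neutral_right)
       (use finite_submultisets[of M "\<lambda>_. True"] in \<open>auto simp: c0 Diff_eq_empty_iff_mset subset_mset.antisym\<close>)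
  thus ?thesis unfolding s0 using True by (simp add: c0)
next
  case False
  hence k: "1 \<le> k" by simp
  have s1: "shape (replicate k 1) = hook_shape 1 (k - 1)"
    using k by (auto simp: shape_def hook_shape_def fun_eq_iff)
  have one: "card (ssyt (hook_shape 1 (k - 1)) B) = (if size B = k \<and> card (set_mset B) = k then 1 else 0)" for B
  proof (cases "size B = k")
    case True
    have "card (set_mset B) \<le> k" using card_set_mset_le[of B] True by simp
    moreover have "B \<noteq> {#}" using True k by auto
    hence "card (set_mset B) \<noteq> 0" by simp
    ultimately have "card (set_mset B) - 1 < k - 1" if "card (set_mset B) \<noteq> k" using that by linarith
    thus ?thesis using card_ssyt_hook[of 1 "k - 1" B] True k
      by (cases "card (set_mset B) = k") (auto simp: binomial_eq_0)
  next
    case False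
    thus ?thesis using card_ssyt_hook[of 1 "k - 1" B] k by simp
  qed
  have dd: "M - (M - A) = A" if "A \<subseteq># M" for A
    using that by (intro multiset_eqI) (simp add: mset_subset_eq_count)
  have fin: "finite {A. A \<subseteq># M}" using finite_submultisets[of M "\<lambda>_. True"] by simp
  have "(\<Sum>A | A \<subseteq># M. card (ssyt (hook_shape N 0) A) * card (ssyt (shape (replicate k 1)) (M - A))) =
        (\<Sum>B | B \<subseteq># M. card (ssyt (hook_shape N 0) (M - B)) * card (ssyt (hook_shape 1 (k - 1)) B))"
    unfolding s1 by (rule sum.reindex_bij_witness[of _ "\<lambda>B. M - B" "\<lambda>A. M - A"]) (auto simp: dd)
  also have "\<dots> = (\<Sum>B | B \<subseteq># M. if size M = N + k \<and> size B = k \<and> card (set_mset B) = k then 1 else 0)"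
  proof (intro sum.cong refl)
    fix B assume B: "B \<in> {B. B \<subseteq># M}"
    hence "size (M - B) = size M - size B" "size B \<le> size M" by (simp_all add: size_Diff_submset size_mset_mono)
    thus "card (ssyt (hook_shape N 0) (M - B)) * card (ssyt (hook_shape 1 (k - 1)) B) =
        (if size M = N + k \<and> size B = k \<and> card (set_mset B) = k then 1 else 0)"
      unfolding one card_ssyt_hook[OF N] by auto
  qed
  also have "\<dots> = (if size M = N + k then card (set_mset M) choose k else 0)"
    using fin card_distinct_submultisets[of M k] by (simp add: sum.If_cases Int_def)
  also have "\<dots> = card (ssyt (hook_shape N k) M) + card (ssyt (hook_shape (N + 1) (k - 1)) M)"
  proof (cases "size M = N + k")
    case True
    have "M \<noteq> {#}" using True N by auto
    hence "card (set_mset M) \<noteq> 0" by simp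
    then obtain c where "card (set_mset M) = Suc c" using not0_implies_Suc by blast
    moreover obtain k' where "k = Suc k'" using k by (cases k) auto
    ultimately show ?thesis using True N by (simp add: card_ssyt_hook)
  next
    case False
    thus ?thesis using N k by (simp add: card_ssyt_hook)
  qed
  finally show ?thesis using False by simp
qed

section \<open>Transposes, and Kostka numbers as multiplicities\<close>

lemma transpose_part_partitions:
  assumes lam: "lam \<in> partitions n"
  shows "transpose_part lam \<in> partitions n"
proof -
  let ?C = "\<lambda>j. {i. (i, j) \<in> diagram lam}"
  have fin: "finite (?C j)" for j by (rule finite_subset[of _ "{..<length lam}"]) (auto simp: diagram_def)
  have anti: "?C j' \<subseteq> ?C j" if "j \<le> j'" for j j' using that by (auto simp: diagram_def)
  have "sorted_wrt (\<ge>) (transpose_part lam)"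
    using card_mono[OF fin anti] by (auto simp: transpose_part_def sorted_wrt_iff_nth_less)
  moreover have "0 < x" if "x \<in> set (transpose_part lam)" for x
  proof -
    obtain j where j: "lam \<noteq> []" "j < hd lam" "x = card (?C j)"
      using \<open>x \<in> set (transpose_part lam)\<close> by (auto simp: transpose_part_def split: if_splits)
    hence "0 \<in> ?C j" by (simp add: diagram_def hd_conv_nth)
    thus ?thesis using fin[of j] j(3) by (auto simp: card_gt_0_iff)
  qed
  moreover have "sum_list (transpose_part lam) = n"
  proof -
    have "sum_list (transpose_part lam) = card (diagram (transpose_part lam))" by (simp add: card_diagram)
    also have "\<dots> = card (diagram lam)"
      unfolding diagram_transpose[OF lam] by (rule card_image) (rule inj_onI, metis swap_swap)
    finally show ?thesis using lam by (simp add: card_diagram partitions_def)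
  qed
  ultimately show ?thesis by (simp add: partitions_def)
qed

lemma pchar_transpose_part:
  assumes lam: "lam \<in> partitions n" and s: "s \<in> symm n"
  shows "pchar n (shape (transpose_part lam)) s = sgn_sym s * pchar n (shape lam) s"
  by (rule pchar_transpose[OF shape_par[OF lam] shape_par[OF transpose_part_partitions[OF lam]] _ s])
     (simp add: diagram_dia[symmetric] diagram_transpose[OF lam])

lemma pchar_one_column:
  assumes s: "s \<in> symm k"
  shows "pchar k (shape (replicate k 1)) s = sgn_sym s"
proof -
  have r: "hook_shape k 0 \<in> par k" using hook_shape_par[of k 0] by simp
  have c: "replicate k 1 \<in> partitions k"
    by (simp add: partitions_def sum_list_replicate sorted_wrt_iff_nth_less)
  have "dia (shape (replicate k 1)) = prod.swap ` dia (hook_shape k 0)"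
    by (auto simp: dia_def shape_def hook_shape_def image_iff split: if_splits)
  from pchar_transpose[OF r shape_par[OF c] this s] show ?thesis
    using pchar_one_row[OF r _ s] by (simp add: hook_shape_def)
qed

text \<open>Extends Young's rule to contents of another size, where both sides are 0; such contents
  occur in the sums over submultisets.\<close>

lemma card_ssyt_pchar:
  assumes p: "p \<in> par n"
  shows "real (card (ssyt p a)) = (\<Sum>s\<in>symm n. pchar n p s * perm_char n a s) / fact n"
proof (cases "size a = n")
  case True
  thus ?thesis using young_rule(2)[OF True p] by simp
next
  case False
  hence "words n a = {}" using words_size by blast
  hence "perm_char n a s = 0" for s by (simp add: perm_char_def)
  moreover have "ssyt p a = {}" using ssyt_size[OF p] False by blast
  ultimately show ?thesis by simp
qed

lemma perm_char_pchar:
  assumes s: "s \<in> symm n"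
  shows "real (perm_char n a s) = (\<Sum>p\<in>par n. card (ssyt p a) * pchar n p s)"
proof (cases "size a = n")
  case True
  thus ?thesis using young_rule(1)[OF True s] by simp
next
  case False
  hence "words n a = {}" using words_size by blast
  moreover have "ssyt p a = {}" if "p \<in> par n" for p using ssyt_size[OF that] False by blast
  ultimately show ?thesis by (simp add: perm_char_def)
qed

section \<open>Pairings over Young subgroups\<close>

text \<open>The inner product over S_N x S_k of \<alpha> x \<beta> with the restriction of \<phi>.
  For class functions it is, by Frobenius reciprocity, the pairing of \<phi> with the class function
  induced from \<alpha> x \<beta>.\<close>

definition young_ip :: "nat \<Rightarrow> nat \<Rightarrow> (sym \<Rightarrow> real) \<Rightarrow> (sym \<Rightarrow> real) \<Rightarrow> (sym \<Rightarrow> real) \<Rightarrow> real" where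
  "young_ip N k \<alpha> \<beta> \<phi> =
     (\<Sum>g\<in>symm N. \<Sum>h\<in>symm k. \<alpha> g * \<beta> h * \<phi> (join N g h)) / (fact N * fact k)"

lemma sum_rotate:
  "(\<Sum>g\<in>A. \<Sum>h\<in>B. \<Sum>p\<in>C. f g h p) = (\<Sum>p\<in>C. \<Sum>g\<in>A. \<Sum>h\<in>B. f g h p)"
proof -
  have "(\<Sum>g\<in>A. \<Sum>h\<in>B. \<Sum>p\<in>C. f g h p) = (\<Sum>g\<in>A. \<Sum>p\<in>C. \<Sum>h\<in>B. f g h p)"
    by (intro sum.cong refl sum.swap)
  also have "\<dots> = (\<Sum>p\<in>C. \<Sum>g\<in>A. \<Sum>h\<in>B. f g h p)" by (rule sum.swap)
  finally show ?thesis .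
qed

text \<open>Young's rule is used in both directions: the two Kostka numbers become averages of
  permutation characters, \<open>perm_char_join\<close> merges these into one permutation character,
  and that is expanded into irreducible characters again.\<close>

lemma kostka_product:
  assumes p: "p \<in> par N" and q: "q \<in> par k"
  shows "(\<Sum>A | A \<subseteq># M. real (card (ssyt p A)) * real (card (ssyt q (M - A)))) =
    (\<Sum>\<nu>\<in>par (N + k). young_ip N k (pchar N p) (pchar k q) (pchar (N + k) \<nu>) * card (ssyt \<nu> M))"
proof -
  let ?P = "\<lambda>g h A. pchar N p g * pchar k q h * (real (perm_char N A g) * real (perm_char k (M - A) h))"
  have "real (card (ssyt p A)) * real (card (ssyt q (M - A))) =
        (\<Sum>g\<in>symm N. \<Sum>h\<in>symm k. ?P g h A) / (fact N * fact k)" for A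
    unfolding card_ssyt_pchar[OF p] card_ssyt_pchar[OF q] times_divide_times_eq sum_product
    by (rule arg_cong2[of _ _ _ _ "(/)"]) (auto intro!: sum.cong simp: algebra_simps)
  hence "(\<Sum>A | A \<subseteq># M. real (card (ssyt p A)) * real (card (ssyt q (M - A)))) =
        (\<Sum>A | A \<subseteq># M. \<Sum>g\<in>symm N. \<Sum>h\<in>symm k. ?P g h A) / (fact N * fact k)"
    by (simp only: sum_divide_distrib)
  also have "(\<Sum>A | A \<subseteq># M. \<Sum>g\<in>symm N. \<Sum>h\<in>symm k. ?P g h A) =
        (\<Sum>g\<in>symm N. \<Sum>h\<in>symm k. \<Sum>A | A \<subseteq># M. ?P g h A)"
    by (subst sum.swap) (intro sum.cong refl, rule sum.swap)
  also have "\<dots> = (\<Sum>g\<in>symm N. \<Sum>h\<in>symm k. \<Sum>\<nu>\<in>par (N + k).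
        pchar N p g * pchar k q h * pchar (N + k) \<nu> (join N g h) * card (ssyt \<nu> M))"
  proof (intro sum.cong refl)
    fix g h assume g: "g \<in> symm N" and h: "h \<in> symm k"
    have "(\<Sum>A | A \<subseteq># M. ?P g h A) = pchar N p g * pchar k q h * real (perm_char (N + k) M (join N g h))"
      unfolding perm_char_join[OF g h] by (simp add: sum_distrib_left)
    thus "(\<Sum>A | A \<subseteq># M. ?P g h A) = (\<Sum>\<nu>\<in>par (N + k).
        pchar N p g * pchar k q h * pchar (N + k) \<nu> (join N g h) * card (ssyt \<nu> M))"
      unfolding perm_char_pchar[OF app_join(2)[OF g h]] sum_distrib_left
      by (simp only: mult.assoc mult.commute[of "real (card _)"])
  qed
  also have "\<dots> = (\<Sum>\<nu>\<in>par (N + k). \<Sum>g\<in>symm N. \<Sum>h\<in>symm k.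
        pchar N p g * pchar k q h * pchar (N + k) \<nu> (join N g h) * card (ssyt \<nu> M))"
    by (rule sum_rotate)
  also have "\<dots> / (fact N * fact k) =
     (\<Sum>\<nu>\<in>par (N + k). young_ip N k (pchar N p) (pchar k q) (pchar (N + k) \<nu>) * card (ssyt \<nu> M))"
    by (simp add: young_ip_def sum_distrib_right sum_divide_distrib)
  finally show ?thesis .
qed

lemma sum_partitions_shape: "(\<Sum>\<nu>\<in>partitions n. f (shape \<nu>)) = (\<Sum>p\<in>par n. f p)"
  by (rule sum.reindex_bij_betw[OF shape_bij])

text \<open>By \<open>kostka_product\<close> the pairings are coefficients of a Schur expansion of
  the product, compared monomial by monomial; \<open>lr_coeff_eq\<close> identifies such
  coefficients.\<close>

lemma lr_coeff_young_ip:
  assumes \<rho>: "\<rho> \<in> partitions N" and \<gamma>: "\<gamma> \<in> partitions k" and \<nu>: "\<nu> \<in> partitions (N + k)"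
  shows "real_of_int (lr_coeff \<nu> \<rho> \<gamma>) =
    young_ip N k (pchar N (shape \<rho>)) (pchar k (shape \<gamma>)) (pchar (N + k) (shape \<nu>))"
proof (rule lr_coeff_eq[OF \<nu>])
  fix m
  let ?D = "\<lambda>p. young_ip N k (pchar N (shape \<rho>)) (pchar k (shape \<gamma>)) (pchar (N + k) p)"
  have "real_of_int (series_mult (schur \<rho>) (schur \<gamma>) m) =
        (\<Sum>A | A \<subseteq># mmset m. real (card (ssyt (shape \<rho>) A)) * real (card (ssyt (shape \<gamma>) (mmset m - A))))"
    by (rule series_mult_mset) (simp_all add: schur_ssyt[OF \<rho>] schur_ssyt[OF \<gamma>])
  also have "\<dots> = (\<Sum>p\<in>par (N + k). ?D p * card (ssyt p (mmset m)))"
    by (rule kostka_product[OF shape_par[OF \<rho>] shape_par[OF \<gamma>]])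
  also have "\<dots> = (\<Sum>\<nu>\<in>partitions (N + k). ?D (shape \<nu>) * card (ssyt (shape \<nu>) (mmset m)))"
    by (rule sum_partitions_shape[symmetric])
  also have "\<dots> = (\<Sum>\<nu>\<in>partitions (N + k). ?D (shape \<nu>) * of_int (schur \<nu> m))"
    by (intro sum.cong refl) (simp add: schur_ssyt)
  finally show "real_of_int (series_mult (schur \<rho>) (schur \<gamma>) m) =
    (\<Sum>\<nu>\<in>partitions (N + k). ?D (shape \<nu>) * of_int (schur \<nu> m))" .
qed

lemma pchar_parseval:
  assumes \<psi>: "\<And>g s. g \<in> symm n \<Longrightarrow> s \<in> symm n \<Longrightarrow> \<psi> (g + s - g) = \<psi> s"
  shows "(\<Sum>p\<in>par n. (\<Sum>s\<in>symm n. pchar n p s * \<phi> s) * (\<Sum>s\<in>symm n. pchar n p s * \<psi> s)) =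
         fact n * (\<Sum>s\<in>symm n. \<phi> s * \<psi> s)"
proof -
  obtain c where c: "\<forall>s\<in>symm n. \<psi> s = (\<Sum>p\<in>par n. c p * pchar n p s)"
    using pchar_complete[of n \<psi>] \<psi> by metis
  have "(\<Sum>p\<in>par n. (\<Sum>s\<in>symm n. pchar n p s * \<phi> s) * (\<Sum>s\<in>symm n. pchar n p s * \<psi> s)) =
        (\<Sum>p\<in>par n. (\<Sum>s\<in>symm n. pchar n p s * \<phi> s) * (fact n * c p))"
    using c by (intro sum.cong refl arg_cong2[of _ _ _ _ times] pchar_expansion_coeff) auto
  also have "\<dots> = (\<Sum>p\<in>par n. \<Sum>s\<in>symm n. fact n * (\<phi> s * (c p * pchar n p s)))"
    unfolding sum_distrib_right by (intro sum.cong refl) (simp add: algebra_simps)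
  also have "\<dots> = (\<Sum>s\<in>symm n. fact n * (\<phi> s * (\<Sum>p\<in>par n. c p * pchar n p s)))"
    by (subst sum.swap) (simp add: sum_distrib_left)
  also have "\<dots> = (\<Sum>s\<in>symm n. fact n * (\<phi> s * \<psi> s))"
    using c by (intro sum.cong refl) simp
  finally show ?thesis by (simp add: sum_distrib_left)
qed

lemma join_conj:
  assumes "g \<in> symm N" "h \<in> symm k" "u \<in> symm N" "v \<in> symm k"
  shows "join N (u + g - u) (v + h - v) = join N u v + join N g h - join N u v"
proof -
  have "join N (u + g + - u) (v + h + - v) = join N (u + g) (v + h) + join N (- u) (- v)"
    using assms by (intro join_add symm_add symm_uminus)
  also have "\<dots> = join N u v + join N g h + - join N u v"
    using join_add[OF assms(3,4,1,2)] join_uminus[OF assms(3,4)] by simp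
  finally show ?thesis by simp
qed

text \<open>Parseval is applied twice: over the shapes of size N for fixed \<open>q\<close>, then
  over the shapes of size k for fixed \<open>g\<close>. The sign attached to the character of
  \<open>q\<close> is first moved to \<psi>, and it becomes the sign character on the right.\<close>

lemma young_ip_parseval:
  assumes \<phi>: "\<And>g s. g \<in> symm (N + k) \<Longrightarrow> \<phi> (g + s - g) = \<phi> s"
    and \<psi>: "\<And>g s. g \<in> symm (N + k) \<Longrightarrow> \<psi> (g + s - g) = \<psi> s"
  shows "(\<Sum>q\<in>par k. \<Sum>p\<in>par N. young_ip N k (pchar N p) (pchar k q) \<phi> *
            young_ip N k (pchar N p) (\<lambda>h. sgn_sym h * pchar k q h) \<psi>) =
         young_ip N k (\<lambda>_. 1) sgn_sym (\<lambda>s. \<phi> s * \<psi> s)"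
proof -
  define \<Phi> where "\<Phi> q g = (\<Sum>h\<in>symm k. pchar k q h * \<phi> (join N g h))" for q g
  define \<Psi> where "\<Psi> q g = (\<Sum>h\<in>symm k. pchar k q h * (sgn_sym h * \<psi> (join N g h)))" for q g
  let ?F = "fact N * fact k :: real"
  have 1: "young_ip N k (pchar N p) (pchar k q) \<phi> = (\<Sum>g\<in>symm N. pchar N p g * \<Phi> q g) / ?F" for p q
    by (simp add: young_ip_def \<Phi>_def sum_distrib_left mult.assoc)
  have 2: "young_ip N k (pchar N p) (\<lambda>h. sgn_sym h * pchar k q h) \<psi> = (\<Sum>g\<in>symm N. pchar N p g * \<Psi> q g) / ?F" for p q
    by (simp add: young_ip_def \<Psi>_def sum_distrib_left mult.assoc mult.left_commute)
  have z: "join N (u + g - u) h = join N u 0 + join N g h - join N u 0" if "g \<in> symm N" "h \<in> symm k" "u \<in> symm N" for g h u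
    using join_conj[OF that(1,2,3) symm_zero] by simp
  have z': "join N g (v + h - v) = join N 0 v + join N g h - join N 0 v" if "g \<in> symm N" "h \<in> symm k" "v \<in> symm k" for g h v
    using join_conj[OF that(1,2) symm_zero that(3)] by simp
  \<comment> \<open>Conjugating the first factor alone is conjugation by \<open>join N u 0\<close>,
    under which \<open>\<psi>\<close> is invariant; this makes the inner sum a class function on
    S_N.\<close>
  have c1: "\<Psi> q (u + g - u) = \<Psi> q g" if "u \<in> symm N" "g \<in> symm N" for q u g
    unfolding \<Psi>_def using that by (intro sum.cong refl) (simp add: z \<psi> app_join(2))
  have "(\<Sum>q\<in>par k. \<Sum>p\<in>par N. young_ip N k (pchar N p) (pchar k q) \<phi> *
            young_ip N k (pchar N p) (\<lambda>h. sgn_sym h * pchar k q h) \<psi>) =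
        (\<Sum>q\<in>par k. \<Sum>p\<in>par N. (\<Sum>g\<in>symm N. pchar N p g * \<Phi> q g) * (\<Sum>g\<in>symm N. pchar N p g * \<Psi> q g)) / (?F * ?F)"
    by (simp only: 1 2 times_divide_times_eq) (simp only: sum_divide_distrib)
  also have "(\<Sum>q\<in>par k. \<Sum>p\<in>par N. (\<Sum>g\<in>symm N. pchar N p g * \<Phi> q g) * (\<Sum>g\<in>symm N. pchar N p g * \<Psi> q g)) =
        (\<Sum>q\<in>par k. fact N * (\<Sum>g\<in>symm N. \<Phi> q g * \<Psi> q g))"
    by (intro sum.cong refl pchar_parseval c1)
  also have "\<dots> = fact N * (\<Sum>g\<in>symm N. \<Sum>q\<in>par k. \<Phi> q g * \<Psi> q g)"
    by (simp only: sum_distrib_left[symmetric]) (subst sum.swap, simp)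
  also have "(\<Sum>g\<in>symm N. \<Sum>q\<in>par k. \<Phi> q g * \<Psi> q g) =
        (\<Sum>g\<in>symm N. fact k * (\<Sum>h\<in>symm k. \<phi> (join N g h) * (sgn_sym h * \<psi> (join N g h))))"
    unfolding \<Phi>_def \<Psi>_def
  proof (intro sum.cong refl pchar_parseval)
    fix g v h assume "g \<in> symm N" "v \<in> symm k" "h \<in> symm k"
    thus "sgn_sym (v + h - v) * \<psi> (join N g (v + h - v)) = sgn_sym h * \<psi> (join N g h)"
      by (simp add: z' \<psi> app_join(2) sgn_sym_diff sgn_sym_add)
  qed
  also have "fact N * \<dots> / (?F * ?F) = young_ip N k (\<lambda>_. 1) sgn_sym (\<lambda>s. \<phi> s * \<psi> s)"
    by (simp add: young_ip_def sum_distrib_left[symmetric] field_simps)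
  finally show ?thesis .
qed

text \<open>\<open>kostka_product\<close> and \<open>hook_pieri\<close> expand the same product in
  Schur functions, and independence equates the coefficients.\<close>

lemma young_ip_hook:
  assumes N: "1 \<le> N" and \<nu>: "\<nu> \<in> partitions (N + k)"
  shows "young_ip N k (\<lambda>_. 1) sgn_sym (pchar (N + k) (shape \<nu>)) =
    (if \<nu> = hook (N + k) k then 1 else 0) + (if 1 \<le> k then (if \<nu> = hook (N + k) (k - 1) then 1 else 0) else 0)"
proof -
  let ?n = "N + k" and ?D = "\<lambda>p. young_ip N k (\<lambda>_. 1) sgn_sym (pchar (N + k) p)"
  \<comment> \<open>For k = 0 truncated subtraction makes \<open>?H'\<close> coincide with
    \<open>?H\<close>; the guard \<open>1 \<le> k\<close> keeps it from being counted twice.\<close>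
  let ?H = "hook (N + k) k" and ?H' = "hook (N + k) (k - 1)"
  let ?E = "\<lambda>\<nu>. (if \<nu> = ?H then 1 else 0) + (if 1 \<le> k then (if \<nu> = ?H' then 1 else (0 :: real)) else 0)"
  have r: "hook_shape N 0 \<in> par N" using hook_shape_par[of N 0] by simp
  have cp: "replicate k 1 \<in> partitions k"
    by (simp add: partitions_def sum_list_replicate sorted_wrt_iff_nth_less)
  have ip: "young_ip N k (pchar N (hook_shape N 0)) (pchar k (shape (replicate k 1))) f = young_ip N k (\<lambda>_. 1) sgn_sym f" for f
  proof -
    have one: "pchar N (hook_shape N 0) g = 1" if "g \<in> symm N" for g
      using pchar_one_row[OF r _ that] by (simp add: hook_shape_def)
    show ?thesis unfolding young_ip_def
      by (intro arg_cong2[of _ _ _ _ "(/)"] sum.cong refl) (simp only: one pchar_one_column)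
  qed
  have H: "?H \<in> partitions ?n" and sH: "shape ?H = hook_shape N k"
    using N hook_in_partitions[of ?n k] shape_hook[of ?n k] by auto
  have H': "?H' \<in> partitions ?n" and sH': "1 \<le> k \<Longrightarrow> shape ?H' = hook_shape (N + 1) (k - 1)"
    using N hook_in_partitions[of ?n "k - 1"] shape_hook[of ?n "k - 1"] by auto
  have "(\<Sum>\<nu>\<in>partitions ?n. (?D (shape \<nu>) - ?E \<nu>) * of_int (schur \<nu> m)) = 0" for m
  proof -
    let ?K = "\<lambda>p. real (card (ssyt p (mmset m)))"
    have "(\<Sum>\<nu>\<in>partitions ?n. ?D (shape \<nu>) * ?K (shape \<nu>)) = (\<Sum>p\<in>par ?n. ?D p * ?K p)"
      by (rule sum_partitions_shape)
    also have "\<dots> = (\<Sum>A | A \<subseteq># mmset m. real (card (ssyt (hook_shape N 0) A)) * real (card (ssyt (shape (replicate k 1)) (mmset m - A))))"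
      using kostka_product[OF r shape_par[OF cp], of "mmset m"] by (simp only: ip)
    also have "\<dots> = real (card (ssyt (hook_shape N k) (mmset m)) + (if k = 0 then 0 else card (ssyt (hook_shape (N + 1) (k - 1)) (mmset m))))"
      unfolding hook_pieri[OF N, where M = "mmset m" and k = k, symmetric] by simp
    also have "\<dots> = (\<Sum>\<nu>\<in>partitions ?n. ?E \<nu> * ?K (shape \<nu>))"
    proof -
      have "(\<Sum>\<nu>\<in>partitions ?n. ?E \<nu> * ?K (shape \<nu>)) =
            (\<Sum>\<nu>\<in>partitions ?n. (if \<nu> = ?H then ?K (shape ?H) else 0) + (if \<nu> = ?H' then (if 1 \<le> k then ?K (shape ?H') else 0) else 0))"
        by (intro sum.cong refl) auto
      also have "\<dots> = ?K (shape ?H) + (if 1 \<le> k then ?K (shape ?H') else 0)"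
        using H H' by (simp add: sum.distrib finite_partitions)
      finally show ?thesis using sH sH' by (cases "k = 0") auto
    qed
    finally have "(\<Sum>\<nu>\<in>partitions ?n. (?D (shape \<nu>) - ?E \<nu>) * ?K (shape \<nu>)) = 0"
      by (simp add: left_diff_distrib sum_subtractf)
    moreover have "(\<Sum>\<nu>\<in>partitions ?n. (?D (shape \<nu>) - ?E \<nu>) * of_int (schur \<nu> m)) =
        (\<Sum>\<nu>\<in>partitions ?n. (?D (shape \<nu>) - ?E \<nu>) * ?K (shape \<nu>))"
      by (intro sum.cong refl) (simp add: schur_ssyt)
    ultimately show ?thesis by simp
  qed
  moreover have "partitions ?n \<subseteq> (\<Union>n. partitions n)" by blast
  ultimately have "?D (shape \<nu>) - ?E \<nu> = 0"
    using \<nu> by (intro schur_independent[OF finite_partitions, of ?n "\<lambda>\<nu>. ?D (shape \<nu>) - ?E \<nu>"])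
  thus ?thesis by simp
qed

section \<open>The alternating sum over hooks\<close>

lemma alternating_telescope:
  fixes a :: "nat \<Rightarrow> real"
  shows "(\<Sum>k=0..r. (-1) ^ (r + k) * (a k + (if 1 \<le> k then a (k - 1) else 0))) = a r"
proof (induction r)
  case (Suc r)
  have "(\<Sum>k=0..r. (-1) ^ (Suc r + k) * (a k + (if 1 \<le> k then a (k - 1) else 0))) =
        - (\<Sum>k=0..r. (-1) ^ (r + k) * (a k + (if 1 \<le> k then a (k - 1) else 0)))"
    by (simp add: sum_negf[symmetric])
  moreover have "(-1 :: real) ^ (Suc r + Suc r) = 1" by simp
  ultimately show ?case using Suc by simp
qed simp

lemma hook_char_pairing:
  assumes n: "1 \<le> n" and r: "r \<le> n - 1" and \<theta>: "\<And>g s. g \<in> symm n \<Longrightarrow> \<theta> (g + s - g) = \<theta> s"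
  shows "(\<Sum>s\<in>symm n. pchar n (shape (hook n r)) s * \<theta> s) / fact n =
    (\<Sum>k=0..r. (-1) ^ (r + k) * young_ip (n - k) k (\<lambda>_. 1) sgn_sym \<theta>)"
proof -
  obtain c where c: "\<forall>s\<in>symm n. \<theta> s = (\<Sum>p\<in>par n. c p * pchar n p s)"
    using pchar_complete[of n \<theta>] \<theta> by metis
  have H: "shape (hook n r) \<in> par n" by (rule shape_par[OF hook_in_partitions[OF n r]])
  have ip: "young_ip (n - k) k (\<lambda>_. 1) sgn_sym \<theta> =
      (\<Sum>\<nu>\<in>partitions n. c (shape \<nu>) * ((if \<nu> = hook n k then 1 else 0) + (if 1 \<le> k then (if \<nu> = hook n (k - 1) then 1 else 0) else 0)))"
    if k: "k \<le> r" for k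
  proof -
    \<comment> \<open>Here r \<le> n - 1 matters: a nonempty first row is what
      \<open>young_ip_hook\<close> demands.\<close>
    have nk: "n - k + k = n" "1 \<le> n - k" using k n r by auto
    have "young_ip (n - k) k (\<lambda>_. 1) sgn_sym \<theta> =
        (\<Sum>g\<in>symm (n - k). \<Sum>h\<in>symm k. \<Sum>p\<in>par n. c p * (1 * sgn_sym h * pchar n p (join (n - k) g h))) / (fact (n - k) * fact k)"
      unfolding young_ip_def
    proof (intro arg_cong2[of _ _ _ _ "(/)"] sum.cong refl)
      fix g h assume "g \<in> symm (n - k)" "h \<in> symm k"
      hence "join (n - k) g h \<in> symm n" using app_join(2)[of g "n - k" h k] nk by simp
      thus "1 * sgn_sym h * \<theta> (join (n - k) g h) = (\<Sum>p\<in>par n. c p * (1 * sgn_sym h * pchar n p (join (n - k) g h)))"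
        using c by (simp add: sum_distrib_left mult.left_commute)
    qed
    also have "(\<Sum>g\<in>symm (n - k). \<Sum>h\<in>symm k. \<Sum>p\<in>par n. c p * (1 * sgn_sym h * pchar n p (join (n - k) g h))) =
        (\<Sum>p\<in>par n. \<Sum>g\<in>symm (n - k). \<Sum>h\<in>symm k. c p * (1 * sgn_sym h * pchar n p (join (n - k) g h)))"
      by (rule sum_rotate)
    also have "\<dots> / (fact (n - k) * fact k) = (\<Sum>p\<in>par n. c p * young_ip (n - k) k (\<lambda>_. 1) sgn_sym (pchar n p))"
      by (simp add: young_ip_def sum_distrib_left sum_divide_distrib)
    also have "\<dots> = (\<Sum>\<nu>\<in>partitions n. c (shape \<nu>) * young_ip (n - k) k (\<lambda>_. 1) sgn_sym (pchar n (shape \<nu>)))"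
      by (rule sum_partitions_shape[symmetric])
    also have "\<dots> = (\<Sum>\<nu>\<in>partitions n. c (shape \<nu>) * ((if \<nu> = hook n k then 1 else 0) + (if 1 \<le> k then (if \<nu> = hook n (k - 1) then 1 else 0) else 0)))"
      using young_ip_hook[OF nk(2), of _ k] unfolding nk(1) by (intro sum.cong refl) simp
    finally show ?thesis .
  qed
  have "(\<Sum>k=0..r. (-1) ^ (r + k) * young_ip (n - k) k (\<lambda>_. 1) sgn_sym \<theta>) =
        (\<Sum>k=0..r. \<Sum>\<nu>\<in>partitions n. c (shape \<nu>) * ((-1) ^ (r + k) * ((if \<nu> = hook n k then 1 else 0) + (if 1 \<le> k then (if \<nu> = hook n (k - 1) then 1 else 0) else 0))))"
    by (intro sum.cong refl) (simp only: ip atLeastAtMost_iff sum_distrib_left mult.left_commute)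
  also have "\<dots> = (\<Sum>\<nu>\<in>partitions n. c (shape \<nu>) * (\<Sum>k=0..r. (-1) ^ (r + k) * ((if \<nu> = hook n k then 1 else 0) + (if 1 \<le> k then (if \<nu> = hook n (k - 1) then 1 else 0) else 0))))"
    by (subst sum.swap) (simp only: sum_distrib_left)
  also have "\<dots> = (\<Sum>\<nu>\<in>partitions n. c (shape \<nu>) * (if \<nu> = hook n r then 1 else 0))"
    by (simp only: alternating_telescope[of r "\<lambda>k. if _ = hook n k then 1 else 0"])
  also have "\<dots> = c (shape (hook n r))"
    using hook_in_partitions[OF n r] by (simp add: if_distrib finite_partitions cong: if_cong)
  also have "\<dots> = (\<Sum>s\<in>symm n. pchar n (shape (hook n r)) s * \<theta> s) / fact n"
    using pchar_expansion_coeff[of n \<theta> c, OF _ H] c by simp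
  finally show ?thesis by simp
qed

theorem mainTheorem1:
  fixes n r :: nat and \<nu> lam :: "nat list"
  assumes "n \<ge> 1" and "r \<le> n - 1"
    and "\<nu> \<in> partitions n" and "lam \<in> partitions n"
  shows "kronecker n (hook n r) \<nu> lam =
    (\<Sum>k=0..r. (-1) ^ (r + k) *
      (\<Sum>\<gamma>\<in>partitions k. \<Sum>\<rho>\<in>partitions (n - k).
        of_int (lr_coeff \<nu> \<rho> \<gamma> * lr_coeff lam \<rho> (transpose_part \<gamma>))))"
proof -
  let ?\<nu> = "pchar n (shape \<nu>)" and ?l = "pchar n (shape lam)" and ?h = "pchar n (shape (hook n r))"
  have H: "hook n r \<in> partitions n" by (rule hook_in_partitions[OF assms(1,2)])
  have "(\<Sum>\<sigma> | \<sigma> permutes {..<n}. irr_char (hook n r) \<sigma> * irr_char \<nu> \<sigma> * irr_char lam \<sigma>) =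
        (\<Sum>s\<in>symm n. irr_char (hook n r) (app s) * irr_char \<nu> (app s) * irr_char lam (app s))"
    unfolding app_image_symm[symmetric] by (subst sum.reindex[OF inj_app]) simp
  also have "\<dots> = (\<Sum>s\<in>symm n. of_real (?h s * (?\<nu> s * ?l s)))"
    by (intro sum.cong refl) (simp add: irr_char_pchar[OF H] irr_char_pchar[OF assms(3)] irr_char_pchar[OF assms(4)])
  finally have "kronecker n (hook n r) \<nu> lam = of_real ((\<Sum>s\<in>symm n. ?h s * (?\<nu> s * ?l s)) / fact n)"
    by (simp add: kronecker_def)
  also have "(\<Sum>s\<in>symm n. ?h s * (?\<nu> s * ?l s)) / fact n =
        (\<Sum>k=0..r. (-1) ^ (r + k) * young_ip (n - k) k (\<lambda>_. 1) sgn_sym (\<lambda>s. ?\<nu> s * ?l s))"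
    by (rule hook_char_pairing[OF assms(1,2)]) (simp add: pchar_conj)
  also have "\<dots> = (\<Sum>k=0..r. (-1) ^ (r + k) *
      (\<Sum>\<gamma>\<in>partitions k. \<Sum>\<rho>\<in>partitions (n - k).
        of_int (lr_coeff \<nu> \<rho> \<gamma> * lr_coeff lam \<rho> (transpose_part \<gamma>))))"
  proof (intro sum.cong refl arg_cong2[of _ _ _ _ times])
    fix k assume k: "k \<in> {0..r}"
    hence nk: "n - k + k = n" using assms(1,2) by auto
    let ?Y = "young_ip (n - k) k"
    have "?Y (\<lambda>_. 1) sgn_sym (\<lambda>s. ?\<nu> s * ?l s) =
        (\<Sum>q\<in>par k. \<Sum>p\<in>par (n - k). ?Y (pchar (n - k) p) (pchar k q) ?\<nu> * ?Y (pchar (n - k) p) (\<lambda>h. sgn_sym h * pchar k q h) ?l)"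
      by (rule young_ip_parseval[symmetric]) (simp_all add: nk pchar_conj)
    also have "\<dots> = (\<Sum>\<gamma>\<in>partitions k. \<Sum>\<rho>\<in>partitions (n - k).
        ?Y (pchar (n - k) (shape \<rho>)) (pchar k (shape \<gamma>)) ?\<nu> * ?Y (pchar (n - k) (shape \<rho>)) (\<lambda>h. sgn_sym h * pchar k (shape \<gamma>) h) ?l)"
      unfolding sum_partitions_shape[symmetric] ..
    also have "\<dots> = (\<Sum>\<gamma>\<in>partitions k. \<Sum>\<rho>\<in>partitions (n - k).
        of_int (lr_coeff \<nu> \<rho> \<gamma> * lr_coeff lam \<rho> (transpose_part \<gamma>)))"
    proof (intro sum.cong refl)
      fix \<gamma> \<rho> assume \<gamma>: "\<gamma> \<in> partitions k" and \<rho>: "\<rho> \<in> partitions (n - k)"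
      \<comment> \<open>The sign that \<open>young_ip_parseval\<close> attaches to the second
        character is what turns \<open>\<gamma>\<close> into its transpose in the theorem.\<close>
      have "?Y (pchar (n - k) (shape \<rho>)) (\<lambda>h. sgn_sym h * pchar k (shape \<gamma>) h) ?l =
            ?Y (pchar (n - k) (shape \<rho>)) (pchar k (shape (transpose_part \<gamma>))) ?l"
        unfolding young_ip_def
        by (intro arg_cong2[of _ _ _ _ "(/)"] sum.cong refl) (simp add: pchar_transpose_part[OF \<gamma>])
      thus "?Y (pchar (n - k) (shape \<rho>)) (pchar k (shape \<gamma>)) ?\<nu> * ?Y (pchar (n - k) (shape \<rho>)) (\<lambda>h. sgn_sym h * pchar k (shape \<gamma>) h) ?l =
            of_int (lr_coeff \<nu> \<rho> \<gamma> * lr_coeff lam \<rho> (transpose_part \<gamma>))"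
        using lr_coeff_young_ip[OF \<rho> \<gamma>, of \<nu>] lr_coeff_young_ip[OF \<rho> transpose_part_partitions[OF \<gamma>], of lam] assms(3,4)
        by (simp add: nk)
    qed
    finally show "?Y (\<lambda>_. 1) sgn_sym (\<lambda>s. ?\<nu> s * ?l s) = (\<Sum>\<gamma>\<in>partitions k. \<Sum>\<rho>\<in>partitions (n - k).
        of_int (lr_coeff \<nu> \<rho> \<gamma> * lr_coeff lam \<rho> (transpose_part \<gamma>)))" .
  qed
  finally show ?thesis by simp
qed

end
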